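(* For any $\gamma=\gamma(n)\ge1$, there is an efficient (polynomial-time) reduction from $\gamma'$-GapCVP$^{1/\gamma'}$ to $\gamma$-GapLDP, where $\gamma'=O(\gamma)$.
   Context: For $\gamma\ge1$, $\alpha>0$, $\gamma$-GapCVP$^{\alpha}$ is the promise problem: given a lattice $\mathcal{L}\subset\mathbb{Q}^n$ (by a basis), a target $t\in\mathbb{Q}^n$ and $d>0$, it is a YES instance if $\mathrm{dist}(t,\mathcal{L})\le d$, and a NO instance if $\mathrm{dist}(kt,\mathcal{L})>\gamma d$ for all nonzero integers $k$ and $d<\alpha\cdot\lambda_1(\mathcal{L})$. Here $\mathrm{dist}(t,\mathcal{L})$ is the Euclidean distance from $t$ to $\mathcal{L}$ and $\lambda_1(\mathcal{L})$ the length of a shortest nonzero vector. $\gamma$-GapLDP is the promise problem: given full-rank lattices $\mathcal{L}_1,\mathcal{L}_2$ (by rational bases) and $c\ge1$, YES if $\mathrm{Dist}(\mathcal{L}_1,\mathcal{L}_2)\le c$, NO if $\mathrm{Dist}(\mathcal{L}_1,\mathcal{L}_2)>\gamma c$, where the lattice distortion is $\mathrm{Dist}(\mathcal{L}_1,\mathcal{L}_2)=\min\{\|T\|\,\|T^{-1}\|: T\text{ linear},\ T(\mathcal{L}_1)=\mathcal{L}_2\}$ with $\|\cdot\|$ the Euclidean operator norm. *)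

theory Defs
  imports
    Complex_Main
    "HOL-Computational_Algebra.Polynomial"
    "Jordan_Normal_Form.Matrix"
begin

section \<open>Lattices in Euclidean space\<close>

text \<open>The dimension varies from instance to instance, so vectors and matrices carry their
  dimensions as values. A basis is the matrix whose columns are the basis vectors.\<close>

definition vnorm :: "real vec \<Rightarrow> real" where
  "vnorm v = sqrt (v \<bullet> v)"

definition lin_indep_cols :: "real mat \<Rightarrow> bool" where
  "lin_indep_cols B \<longleftrightarrow>
     (\<forall>x \<in> carrier_vec (dim_col B). B *\<^sub>v x = 0\<^sub>v (dim_row B) \<longrightarrow> x = 0\<^sub>v (dim_col B))"

definition real_mat :: "rat mat \<Rightarrow> real mat" where
  "real_mat B = map_mat of_rat B"

definition real_vec :: "rat vec \<Rightarrow> real vec" where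
  "real_vec v = map_vec of_rat v"

definition lat :: "real mat \<Rightarrow> real vec set" where
  "lat B = {B *\<^sub>v map_vec real_of_int x | x. x \<in> carrier_vec (dim_col B)}"

text \<open>For the sets to which they are applied below, the infima in the next definitions, in
  particular the one in \<open>lat_distortion\<close>, are attained, i.e. they are minima.\<close>

definition lat_dist :: "real vec \<Rightarrow> real vec set \<Rightarrow> real" where
  "lat_dist t L = Inf {vnorm (t - v) | v. v \<in> L}"

definition lambda1 :: "real vec set \<Rightarrow> real" where
  "lambda1 L = Inf {vnorm v | v. v \<in> L \<and> v \<noteq> 0\<^sub>v (dim_vec v)}"

definition op_norm :: "real mat \<Rightarrow> real" where
  "op_norm A = Sup {vnorm (A *\<^sub>v x) | x. x \<in> carrier_vec (dim_col A) \<and> vnorm x = 1}"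

text \<open>A linear map that maps one full-rank lattice onto another is invertible, so asking for an
  inverse matrix \<open>S\<close> of \<open>T\<close> excludes no map.\<close>

definition lat_distortion :: "nat \<Rightarrow> real vec set \<Rightarrow> real vec set \<Rightarrow> real" where
  "lat_distortion n L1 L2 =
     Inf {op_norm T * op_norm S | T S.
            T \<in> carrier_mat n n \<and> S \<in> carrier_mat n n \<and>
            inverts_mat T S \<and> inverts_mat S T \<and> (\<lambda>v. T *\<^sub>v v) ` L1 = L2}"


section \<open>Polynomial-time computable functions\<close>

text \<open>Deterministic multi-tape Turing machines with two-way infinite tapes. A cell is blank
  (\<open>None\<close>) or holds a letter; the alphabet is a finite type. States are the numbers up to
  \<open>tm_halt\<close>; 0 is the initial state and \<open>tm_halt\<close> the only halting state. Using the input
  alphabet (plus blank) as the tape alphabet is no restriction up to polynomial time, since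
  further tapes are available.\<close>

datatype dir = Go_Left | Stay | Go_Right

type_synonym 'a tape = "(int \<Rightarrow> 'a option) \<times> int"

type_synonym 'a tm_config = "nat \<times> 'a tape list"

record 'a tm =
  tm_tapes :: nat
  tm_halt :: nat
  tm_delta :: "nat \<Rightarrow> 'a option list \<Rightarrow> nat \<times> ('a option \<times> dir) list"

definition tm_wf :: "'a tm \<Rightarrow> bool" where
  "tm_wf M \<longleftrightarrow> 2 \<le> tm_tapes M \<and>
     (\<forall>q < tm_halt M. \<forall>syms. length syms = tm_tapes M \<longrightarrow>
        fst (tm_delta M q syms) \<le> tm_halt M \<and>
        length (snd (tm_delta M q syms)) = tm_tapes M)"

definition tape_read :: "'a tape \<Rightarrow> 'a option" where
  "tape_read tp = fst tp (snd tp)"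

fun dir_offset :: "dir \<Rightarrow> int" where
  "dir_offset Go_Left = -1"
| "dir_offset Stay = 0"
| "dir_offset Go_Right = 1"

definition tape_act :: "'a tape \<Rightarrow> 'a option \<times> dir \<Rightarrow> 'a tape" where
  "tape_act tp a = ((fst tp)(snd tp := fst a), snd tp + dir_offset (snd a))"

definition tm_step :: "'a tm \<Rightarrow> 'a tm_config \<Rightarrow> 'a tm_config" where
  "tm_step M c =
     (if fst c = tm_halt M then c
      else let r = tm_delta M (fst c) (map tape_read (snd c))
           in (fst r, map2 tape_act (snd c) (snd r)))"

definition word_tape :: "'a list \<Rightarrow> 'a tape" where
  "word_tape w = ((\<lambda>i. if 0 \<le> i \<and> i < int (length w) then Some (w ! nat i) else None), 0)"

text \<open>The input is written on tape 0.\<close>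

definition tm_init :: "'a tm \<Rightarrow> 'a list \<Rightarrow> 'a tm_config" where
  "tm_init M w = (0, word_tape w # replicate (tm_tapes M - 1) (word_tape []))"

text \<open>The output is read off tape 1, from cell 0 up to the first blank.\<close>

definition tape_holds :: "'a tape \<Rightarrow> 'a list \<Rightarrow> bool" where
  "tape_holds tp w \<longleftrightarrow>
     (\<forall>i < length w. fst tp (int i) = Some (w ! i)) \<and> fst tp (int (length w)) = None"

definition tm_computes_in :: "'a tm \<Rightarrow> 'a list \<Rightarrow> 'a list \<Rightarrow> nat \<Rightarrow> bool" where
  "tm_computes_in M w w' s \<longleftrightarrow>
     (let c = (tm_step M ^^ s) (tm_init M w)
      in fst c = tm_halt M \<and> tape_holds (snd c ! 1) w')"

definition polytime :: "('a::finite list \<Rightarrow> 'a list) \<Rightarrow> bool" where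
  "polytime f \<longleftrightarrow>
     (\<exists>M p. tm_wf M \<and> (\<forall>w. \<exists>s \<le> poly (p :: nat poly) (length w). tm_computes_in M w (f w) s))"


section \<open>Promise problems and reductions\<close>

text \<open>A promise problem is a pair of sets of words, the YES and the NO instances.\<close>

type_synonym 'a promise_problem = "'a list set \<times> 'a list set"

definition polytime_reduces ::
    "'a::finite promise_problem \<Rightarrow> 'a promise_problem \<Rightarrow> bool" where
  "polytime_reduces P P' \<longleftrightarrow>
     (\<exists>f. polytime f \<and> (\<forall>w \<in> fst P. f w \<in> fst P') \<and> (\<forall>w \<in> snd P. f w \<in> snd P'))"


section \<open>Encoding of instances\<close>

datatype letter = Zero | One | Minus | Slash | Comma | Semicolon | Hash

instance letter :: finite
proof
  have "(UNIV :: letter set) \<subseteq> {Zero, One, Minus, Slash, Comma, Semicolon, Hash}"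
    by (auto intro: letter.exhaust)
  then show "finite (UNIV :: letter set)"
    by (rule finite_subset) simp
qed

text \<open>Binary, most significant bit first.\<close>

fun enc_nat :: "nat \<Rightarrow> letter list" where
  "enc_nat n =
     (if n < 2 then [] else enc_nat (n div 2)) @ [if even n then Zero else One]"

declare enc_nat.simps [simp del]

text \<open>Fractions are in lowest terms with positive denominator.\<close>

definition enc_rat :: "rat \<Rightarrow> letter list" where
  "enc_rat q = (case quotient_of q of (a, b) \<Rightarrow>
     (if a < 0 then [Minus] else []) @ enc_nat (nat \<bar>a\<bar>) @ [Slash] @ enc_nat (nat b))"

definition enc_vec :: "rat vec \<Rightarrow> letter list" where
  "enc_vec v = concat (map (\<lambda>q. enc_rat q @ [Comma]) (list_of_vec v)) @ [Semicolon]"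

definition enc_basis :: "rat mat \<Rightarrow> letter list" where
  "enc_basis B = concat (map enc_vec (cols B)) @ [Hash]"

definition enc_cvp :: "rat mat \<Rightarrow> rat vec \<Rightarrow> rat \<Rightarrow> letter list" where
  "enc_cvp B t d = enc_basis B @ enc_vec t @ enc_rat d"

definition enc_ldp :: "rat mat \<Rightarrow> rat mat \<Rightarrow> rat \<Rightarrow> letter list" where
  "enc_ldp B1 B2 c = enc_basis B1 @ enc_basis B2 @ enc_rat c"


section \<open>The problems GapCVP and GapLDP\<close>

text \<open>The lattice may have any rank \<open>m\<close> with \<open>1 \<le> m \<le> n\<close>; rank 0 is excluded because
  \<open>\<lambda>\<^sub>1\<close> is then undefined. The parameters \<open>\<gamma>\<close> and \<open>\<alpha>\<close> are evaluated at the dimension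
  \<open>n\<close> of the instance.\<close>

definition cvp_instance :: "nat \<Rightarrow> rat mat \<Rightarrow> rat vec \<Rightarrow> rat \<Rightarrow> bool" where
  "cvp_instance n B t d \<longleftrightarrow>
     dim_row B = n \<and> 1 \<le> dim_col B \<and> lin_indep_cols (real_mat B) \<and>
     t \<in> carrier_vec n \<and> 0 < d"

definition gap_cvp :: "(nat \<Rightarrow> real) \<Rightarrow> (nat \<Rightarrow> real) \<Rightarrow> letter promise_problem" where
  "gap_cvp \<gamma> \<alpha> =
     ({enc_cvp B t d | n B t d. cvp_instance n B t d \<and>
         lat_dist (real_vec t) (lat (real_mat B)) \<le> of_rat d},
      {enc_cvp B t d | n B t d. cvp_instance n B t d \<and>
         (\<forall>k::int. k \<noteq> 0 \<longrightarrow>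
            lat_dist (real_of_int k \<cdot>\<^sub>v real_vec t) (lat (real_mat B)) > \<gamma> n * of_rat d) \<and>
         of_rat d < \<alpha> n * lambda1 (lat (real_mat B))})"

definition ldp_instance :: "nat \<Rightarrow> rat mat \<Rightarrow> rat mat \<Rightarrow> rat \<Rightarrow> bool" where
  "ldp_instance n B1 B2 c \<longleftrightarrow>
     1 \<le> n \<and> B1 \<in> carrier_mat n n \<and> B2 \<in> carrier_mat n n \<and>
     lin_indep_cols (real_mat B1) \<and> lin_indep_cols (real_mat B2) \<and> 1 \<le> c"

definition gap_ldp :: "(nat \<Rightarrow> real) \<Rightarrow> letter promise_problem" where
  "gap_ldp \<gamma> =
     ({enc_ldp B1 B2 c | n B1 B2 c. ldp_instance n B1 B2 c \<and>
         lat_distortion n (lat (real_mat B1)) (lat (real_mat B2)) \<le> of_rat c},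
      {enc_ldp B1 B2 c | n B1 B2 c. ldp_instance n B1 B2 c \<and>
         lat_distortion n (lat (real_mat B1)) (lat (real_mat B2)) > \<gamma> n * of_rat c})"

end

theory Submission
  imports
    Defs
    "Jordan_Normal_Form.Determinant"
    "HOL-Analysis.L2_Norm"
begin

text \<open>
  Given a basis \<open>B\<close> of \<open>L\<close>, a target \<open>t\<close> and a distance \<open>d\<close>, compare the lattices generated by
  \<open>L \<times> {0}\<close> together with \<open>(0, d)\<close> and with \<open>(t, d)\<close>. If \<open>t\<close> is close to \<open>v \<in> L\<close>, the shear that
  sends \<open>(0, d)\<close> to \<open>(t - v, d)\<close> has bounded distortion. In the NO case every nonzero vector of the
  second lattice is longer than \<open>\<gamma>' d\<close> while the first contains \<open>(0, d)\<close>; since the determinants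
  agree, the inverse of a map between them has norm at least 1, so that the distortion exceeds
  \<open>\<gamma>'\<close> up to a constant.

  Lattices of deficient rank are first completed without any linear algebra: the diagonal entries of
  \<open>B\<close> are perturbed by tiny powers of 2 (which makes the top square block nonsingular, by
  a 2-adic argument) and huge multiples of the remaining unit vectors are added. With a suitable
  choice of the perturbation, the binary encoding of the output arises from that of the input by
  copying, stripping and padding with zeros. This is carried out by a program whose only loops
  repeat their body once per input letter; such programs run in polynomial time on Turing machines.
\<close>


section \<open>Loop programs\<close>

text \<open>The scales \<open>len ^ 3\<close> and \<open>len ^ 5\<close>, with \<open>len\<close>
  the input length, settle a conflict. The perturbation must hardly move the lattice vectors that
  matter; Cramer's rule on the Gram matrix bounds their coefficients by about
  \<open>2 ^ (6 * len ^ 2)\<close> times their size, whence nudges of at most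
  \<open>2 ^ - len ^ 3\<close>. The rows that carry the extra unit vectors are controlled only
  through the top block, whose nonsingularity is owed to these tiny nudges. Its inverse is bounded
  by about \<open>2 ^ len ^ 4\<close> only, and the multiple \<open>2 ^ len ^ 5\<close> has to
  outweigh that.

  The distortion threshold 16 of the output is \<open>(1 + 3)\<^sup>2\<close>: a lattice vector
  within \<open>2 * d\<close> of the target, as the infimum is not shown to be attained, and a
  further error \<open>d\<close> from the perturbation.

  In the NO case the vectors of the second lattice have upper part \<open>k t + v\<close>. The bound
  on \<open>lambda1\<close> takes care of \<open>k = 0\<close>, the distance condition of all other
  \<open>k\<close>; this is why the promise speaks of every nonzero multiple of the target.\<close>

datatype 'a prog =
    Emit 'a
  | Copy
  | Move nat dir
  | Seq "'a prog" "'a prog"  (infixr ";;" 60)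
  | Cond nat "'a option set" "'a prog" "'a prog"
  | Rep "'a prog"

type_synonym 'a pstate = "(nat \<Rightarrow> int) \<times> 'a list"

definition word_at :: "'a list \<Rightarrow> int \<Rightarrow> 'a option" where
  "word_at w i = (if 0 \<le> i \<and> i < int (length w) then Some (w ! nat i) else None)"

text \<open>Head 0 points into the input. The heads \<open>i \<ge> 1\<close> are integer counters, each on a tape
  whose only mark is at the origin, so that reading it is a zero test.\<close>

definition head_cell :: "'a list \<Rightarrow> nat \<Rightarrow> int \<Rightarrow> 'a option" where
  "head_cell w i = (if i = 0 then word_at w else (\<lambda>p. if p = 0 then Some undefined else None))"

fun run :: "'a list \<Rightarrow> 'a prog \<Rightarrow> 'a pstate \<Rightarrow> 'a pstate" where
  "run w (Emit a) (h, out) = (h, out @ [a])"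
| "run w Copy (h, out) =
     (h, out @ (case word_at w (h 0) of None \<Rightarrow> [] | Some a \<Rightarrow> [a]))"
| "run w (Move i d) (h, out) = (h(i := h i + dir_offset d), out)"
| "run w (Seq p q) s = run w q (run w p s)"
| "run w (Cond i A p q) (h, out) =
     (if head_cell w i (h i) \<in> A then run w p (h, out) else run w q (h, out))"
| "run w (Rep p) s = (run w p ^^ length w) s"

definition program_fun :: "'a prog \<Rightarrow> 'a list \<Rightarrow> 'a list" where
  "program_fun p w = snd (run w p (\<lambda>_. 0, []))"

text \<open>A conditional has a state for the test and one for the jump over its second branch. A
  loop has four: test the counter, advance it, step back from the blank at its end, and scan left to
  the blank before its start.\<close>

fun code_size :: "'a prog \<Rightarrow> nat" where
  "code_size (Seq p q) = code_size p + code_size q"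
| "code_size (Cond i A p q) = code_size p + code_size q + 2"
| "code_size (Rep p) = code_size p + 4"
| "code_size _ = 1"

text \<open>Determines the counter tape of a loop. Nested loops have different heights, and loops of
  equal height can share a tape because every loop rewinds its counter.\<close>

fun rep_height :: "'a prog \<Rightarrow> nat" where
  "rep_height (Seq p q) = max (rep_height p) (rep_height q)"
| "rep_height (Cond i A p q) = max (rep_height p) (rep_height q)"
| "rep_height (Rep p) = Suc (rep_height p)"
| "rep_height _ = 0"

fun heads_below :: "nat \<Rightarrow> 'a prog \<Rightarrow> bool" where
  "heads_below c (Move i d) \<longleftrightarrow> i < c"
| "heads_below c (Seq p q) \<longleftrightarrow> heads_below c p \<and> heads_below c q"
| "heads_below c (Cond i A p q) \<longleftrightarrow> i < c \<and> heads_below c p \<and> heads_below c q"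
| "heads_below c (Rep p) \<longleftrightarrow> heads_below c p"
| "heads_below c _ \<longleftrightarrow> True"

text \<open>Each round of a loop pays two steps for test and advance; a third one is charged for the
  rewinding of the counter.\<close>

fun time_bound :: "'a prog \<Rightarrow> nat poly" where
  "time_bound (Seq p q) = time_bound p + time_bound q"
| "time_bound (Cond i A p q) = time_bound p + time_bound q + [:2:]"
| "time_bound (Rep p) = [:0, 1:] * (time_bound p + [:3:]) + [:3:]"
| "time_bound _ = [:1:]"

section \<open>Compilation to Turing machines\<close>

declare upt_Suc [simp del]

text \<open>Tape 0 is the input, tape 1 the output, head \<open>i \<ge> 1\<close> lives on tape \<open>i + 1\<close>, and tape
  \<open>c + 1 + k\<close> (where \<open>c\<close> is the number of heads) holds a copy of the input that serves as the
  loop counter of the \<open>Rep\<close> instructions whose body has nesting height \<open>k\<close>.\<close>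

definition head_tape :: "nat \<Rightarrow> nat" where
  "head_tape i = (if i = 0 then 0 else i + 1)"

type_synonym 'a action = "nat \<times> (nat \<Rightarrow> 'a option \<times> dir)"

definition keep :: "(nat \<Rightarrow> 'a option) \<Rightarrow> nat \<Rightarrow> 'a option \<times> dir" where
  "keep r i = (r i, Stay)"

definition shift :: "nat \<Rightarrow> dir \<Rightarrow> (nat \<Rightarrow> 'a option) \<Rightarrow> nat \<Rightarrow> 'a option \<times> dir" where
  "shift k d r i = (r i, if i = k then d else Stay)"

text \<open>The action in state \<open>q\<close> when the code of the program occupies the states
  from \<open>s\<close> on. Control leaves at \<open>s + code_size p\<close>, so that sequential
  composition needs no linking step.\<close>

fun code :: "nat \<Rightarrow> 'a prog \<Rightarrow> nat \<Rightarrow> nat \<Rightarrow> (nat \<Rightarrow> 'a option) \<Rightarrow> 'a action" where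
  "code c (Emit a) s q r = (s + 1, (keep r)(1 := (Some a, Go_Right)))"
| "code c Copy s q r =
     (s + 1, (keep r)(1 := (case r 0 of None \<Rightarrow> (r 1, Stay) | Some a \<Rightarrow> (Some a, Go_Right))))"
| "code c (Move i d) s q r = (s + 1, shift (head_tape i) d r)"
| "code c (Seq p p') s q r =
     (if q < s + code_size p then code c p s q r else code c p' (s + code_size p) q r)"
| "code c (Cond i A p p') s q r =
     (if q = s then (if r (head_tape i) \<in> A then s + 1 else s + code_size p + 2, keep r)
      else if q \<le> s + code_size p then code c p (s + 1) q r
      else if q = s + code_size p + 1 then (s + code_size p + code_size p' + 2, keep r)
      else code c p' (s + code_size p + 2) q r)"
| "code c (Rep p) s q r =
     (let k = c + 1 + rep_height p in
      if q = s then (if r k = None then s + code_size p + 2 else s + 1, keep r)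
      else if q \<le> s + code_size p then code c p (s + 1) q r
      else if q = s + code_size p + 1 then (s, shift k Go_Right r)
      else if q = s + code_size p + 2 then (s + code_size p + 3, shift k Go_Left r)
      else if r k = None then (s + code_size p + 4, shift k Go_Right r)
      else (s + code_size p + 3, shift k Go_Left r))"

text \<open>The simulation invariant. The output head stands behind the output, and
  \<open>l k\<close> is the position on the counter tape of height \<open>k\<close>.\<close>

definition prog_tape :: "nat \<Rightarrow> 'a list \<Rightarrow> 'a pstate \<Rightarrow> (nat \<Rightarrow> int) \<Rightarrow> nat \<Rightarrow> 'a tape" where
  "prog_tape c w s l i =
     (if i = 0 then (word_at w, fst s 0)
      else if i = 1 then (word_at (snd s), int (length (snd s)))
      else if i < c + 1 then (head_cell w (i - 1), fst s (i - 1))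
      else (word_at w, l (i - (c + 1))))"

definition conf :: "nat \<Rightarrow> nat \<Rightarrow> 'a list \<Rightarrow> nat \<Rightarrow> 'a pstate \<Rightarrow> (nat \<Rightarrow> int) \<Rightarrow> 'a tm_config" where
  "conf n c w q s l = (q, map (prog_tape c w s l) [0..<n])"

definition runs_code :: "'a tm \<Rightarrow> nat \<Rightarrow> 'a prog \<Rightarrow> nat \<Rightarrow> bool" where
  "runs_code M c p s \<longleftrightarrow>
     (\<forall>q. s \<le> q \<and> q < s + code_size p \<longrightarrow> q < tm_halt M \<and>
       (\<forall>syms. length syms = tm_tapes M \<longrightarrow>
          tm_delta M q syms =
            (let a = code c p s q ((!) syms) in (fst a, map (snd a) [0..<tm_tapes M]))))"

lemma code_size_pos: "0 < code_size p"
  by (induction p) auto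

lemma map2_map_upt:
  "map2 f (map g [0..<n]) (map h [0..<n]) = map (\<lambda>i. f (g i) (h i)) [0..<n]"
  by (rule nth_equalityI) auto

text \<open>The machine supplies a list of read symbols, whose entries beyond the number of tapes
  are unspecified. This allows the list to be exchanged for the function that reads every
  tape.\<close>

lemma code_cong:
  assumes "\<And>i. i < n \<Longrightarrow> r i = r' i" "heads_below c p" "c + 1 + rep_height p \<le> n" "1 \<le> c"
  shows "fst (code c p s q r) = fst (code c p s q r') \<and>
    (\<forall>i<n. snd (code c p s q r) i = snd (code c p s q r') i)"
  using assms
proof (induction p arbitrary: s)
  case Copy
  then have "r 0 = r' 0" "r 1 = r' 1" by auto
  then show ?case using Copy.prems(1) by (auto simp: keep_def split: option.splits)
next
  case (Move i d)
  then show ?case by (auto simp: shift_def)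
next
  case (Cond i A p q)
  then have "r (head_tape i) = r' (head_tape i)" by (auto simp: head_tape_def)
  then show ?case using Cond by (auto simp: keep_def)
next
  case (Rep p)
  then have "r (c + 1 + rep_height p) = r' (c + 1 + rep_height p)" by auto
  then show ?case using Rep by (auto simp: keep_def shift_def Let_def)
qed (auto simp: keep_def)

lemma runs_code_step:
  assumes M: "runs_code M c p s" and q: "s \<le> q" "q < s + code_size p"
    and c: "heads_below c p" "c + 1 + rep_height p \<le> tm_tapes M" "1 \<le> c"
  shows "tm_step M (q, map g [0..<tm_tapes M]) =
    (let a = code c p s q (\<lambda>i. tape_read (g i))
     in (fst a, map (\<lambda>i. tape_act (g i) (snd a i)) [0..<tm_tapes M]))"
proof -
  let ?n = "tm_tapes M"
  let ?syms = "map (\<lambda>i. tape_read (g i)) [0..<?n]"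
  have "q \<noteq> tm_halt M" and
    "tm_delta M q ?syms = (let a = code c p s q ((!) ?syms) in (fst a, map (snd a) [0..<?n]))"
    using M q unfolding runs_code_def by auto
  moreover have "fst (code c p s q ((!) ?syms)) = fst (code c p s q (\<lambda>i. tape_read (g i))) \<and>
    (\<forall>i<?n. snd (code c p s q ((!) ?syms)) i = snd (code c p s q (\<lambda>i. tape_read (g i))) i)"
    by (rule code_cong) (use c in auto)
  ultimately show ?thesis
    by (auto simp: tm_step_def Let_def comp_def map2_map_upt)
qed

lemma tape_act_keep [simp]: "tape_act tp (keep (\<lambda>i. tape_read (g i)) i) = tp" if "tp = g i"
  using that by (simp add: tape_act_def keep_def tape_read_def)

lemma tape_act_shift:
  "tape_act (g i) (shift k d (\<lambda>i. tape_read (g i)) i) =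
     (if i = k then (fst (g i), snd (g i) + dir_offset d) else g i)"
  by (simp add: tape_act_def shift_def tape_read_def)

lemma word_at_snoc: "(word_at w)(int (length w) := Some a) = word_at (w @ [a])"
  by (auto simp: word_at_def nth_append fun_eq_iff)

lemma funpow_trans:
  assumes "(f ^^ k) x = y" "(f ^^ k') y = z"
  shows "(f ^^ (k' + k)) x = z"
  using assms by (simp add: funpow_add)

section \<open>Simulation of loop programs with time bounds\<close>

definition reaches :: "'a tm \<Rightarrow> nat \<Rightarrow> 'a tm_config \<Rightarrow> 'a tm_config \<Rightarrow> bool" where
  "reaches M k x y \<longleftrightarrow> (\<exists>t\<le>k. (tm_step M ^^ t) x = y)"

lemma reaches_refl: "reaches M k x x"
  unfolding reaches_def by (rule exI[of _ 0]) simp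

lemma reaches_step: "tm_step M x = y \<Longrightarrow> reaches M k y z \<Longrightarrow> reaches M (k + 1) x z"
  unfolding reaches_def by (metis Suc_eq_plus1 Suc_le_mono comp_apply funpow_Suc_right)

lemma reaches_trans: "reaches M k x y \<Longrightarrow> reaches M k' y z \<Longrightarrow> reaches M (k + k') x z"
  unfolding reaches_def by (metis add.commute add_mono funpow_trans)

lemma reaches_mono: "reaches M k x y \<Longrightarrow> k \<le> k' \<Longrightarrow> reaches M k' x y"
  unfolding reaches_def using le_trans by blast

lemma conf_eqI:
  assumes "q = q'" "\<And>i. i < n \<Longrightarrow> f i = prog_tape c w s l i"
  shows "(q, map f [0..<n]) = conf n c w q' s l"
  using assms by (auto simp: conf_def)

lemma tape_read_head:
  "i < c \<Longrightarrow> tape_read (prog_tape c w s l (head_tape i)) = head_cell w i (fst s i)"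
  by (auto simp: prog_tape_def head_tape_def tape_read_def head_cell_def)

lemma prog_tape_upd_loop:
  assumes "1 \<le> c"
  shows "prog_tape c w s (l(k := x)) i =
    (if i = c + 1 + k then (word_at w, x) else prog_tape c w s l i)"
  using assms by (auto simp: prog_tape_def)

lemma tape_read_loop:
  "1 \<le> c \<Longrightarrow> tape_read (prog_tape c w s (l(k := x)) (Suc (c + k))) = word_at w x"
  by (simp add: prog_tape_upd_loop tape_read_def)

lemma prog_tape_upd_head:
  assumes "j < c"
  shows "prog_tape c w (h(j := x), out) l i =
    (if i = head_tape j then (fst (prog_tape c w (h, out) l i), x) else prog_tape c w (h, out) l i)"
  using assms by (auto simp: prog_tape_def head_tape_def)

text \<open>The scan ends on the blank at position -1, one step left of the origin; with the
  position written as \<open>j - 1\<close>, this is the base case.\<close>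

lemma loop_rewind:
  assumes M: "runs_code M c (Rep p) s"
    and c: "heads_below c p" "c + 1 + rep_height (Rep p) \<le> tm_tapes M" "1 \<le> c"
    and k: "k = rep_height p" and j: "j \<le> length w"
  shows "reaches M (j + 1)
    (conf (tm_tapes M) c w (s + code_size p + 3) st (l(k := int j - 1)))
    (conf (tm_tapes M) c w (s + code_size (Rep p)) st (l(k := 0)))"
  using j
proof (induction j)
  case 0
  show ?case
  proof (rule reaches_step[OF _ reaches_refl])
    show "tm_step M (conf (tm_tapes M) c w (s + code_size p + 3) st (l(k := int 0 - 1))) =
      conf (tm_tapes M) c w (s + code_size (Rep p)) st (l(k := 0))"
      unfolding conf_def[of _ _ _ _ _ "l(k := int 0 - 1)"]
      apply (subst runs_code_step[OF M])
      using c k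
      by (auto simp: Let_def tape_act_shift tape_read_loop word_at_def intro!: conf_eqI)
        (auto simp: prog_tape_upd_loop)
  qed
next
  case (Suc j)
  have "tm_step M (conf (tm_tapes M) c w (s + code_size p + 3) st (l(k := int (Suc j) - 1))) =
      conf (tm_tapes M) c w (s + code_size p + 3) st (l(k := int j - 1))"
      unfolding conf_def[of _ _ _ _ _ "l(k := int (Suc j) - 1)"]
      apply (subst runs_code_step[OF M])
      using c k Suc.prems
      by (auto simp: Let_def tape_act_shift tape_read_loop word_at_def intro!: conf_eqI)
        (auto simp: prog_tape_upd_loop)
  from reaches_step[OF this Suc.IH[OF Suc_leD[OF Suc.prems]]] show ?case
    by (simp only: Suc_eq_plus1)
qed

lemma runs_codeI:
  assumes "runs_code M c p s" "s \<le> s'" "s' + code_size p' \<le> s + code_size p"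
    and "\<And>q r. s' \<le> q \<Longrightarrow> q < s' + code_size p' \<Longrightarrow> code c p s q r = code c p' s' q r"
  shows "runs_code M c p' s'"
  unfolding runs_code_def
proof (intro allI impI)
  fix q assume q: "s' \<le> q \<and> q < s' + code_size p'"
  then have "s \<le> q \<and> q < s + code_size p" using assms by auto
  with assms(1) assms(4)[of q] q
  show "q < tm_halt M \<and> (\<forall>syms. length syms = tm_tapes M \<longrightarrow> tm_delta M q syms =
     (let a = code c p' s' q ((!) syms) in (fst a, map (snd a) [0..<tm_tapes M])))"
    unfolding runs_code_def by simp
qed

text \<open>Only the counters below the height of \<open>p\<close> have to start at the origin.
  Those of enclosing loops may stand anywhere and are left alone, which is what the induction needs
  for a loop body.\<close>

lemma code_correct:
  assumes "runs_code M c p s" "heads_below c p" "c + 1 + rep_height p \<le> tm_tapes M" "1 \<le> c"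
    and "\<And>i. i < rep_height p \<Longrightarrow> l i = 0"
  shows "reaches M (poly (time_bound p) (length w))
    (conf (tm_tapes M) c w s st l)
    (conf (tm_tapes M) c w (s + code_size p) (run w p st) l)"
  using assms
proof (induction p arbitrary: s st l)
  case (Emit a)
  obtain h out where st: "st = (h, out)" by fastforce
  have "tm_step M (conf (tm_tapes M) c w s st l) =
      conf (tm_tapes M) c w (s + code_size (Emit a)) (run w (Emit a) st) l"
    unfolding conf_def[of _ _ _ _ st]
    apply (subst runs_code_step[OF Emit.prems(1)])
    using Emit.prems
    by (auto simp: st Let_def prog_tape_def tape_act_def keep_def tape_read_def word_at_snoc
        intro!: conf_eqI)
  from reaches_step[OF this reaches_refl[of M 0]] show ?case by simp
next
  case Copy
  obtain h out where st: "st = (h, out)" by fastforce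
  have "tm_step M (conf (tm_tapes M) c w s st l) =
      conf (tm_tapes M) c w (s + code_size (Copy :: 'a prog)) (run w Copy st) l"
    unfolding conf_def[of _ _ _ _ st]
    apply (subst runs_code_step[OF Copy.prems(1)])
    using Copy.prems
    by (auto simp: st Let_def prog_tape_def tape_act_def keep_def tape_read_def word_at_snoc
        fun_upd_idem_iff intro!: conf_eqI split: option.splits)
  from reaches_step[OF this reaches_refl[of M 0]] show ?case by simp
next
  case (Move i d)
  obtain h out where st: "st = (h, out)" by fastforce
  have "tm_step M (conf (tm_tapes M) c w s st l) =
      conf (tm_tapes M) c w (s + code_size (Move i d :: 'a prog)) (run w (Move i d) st) l"
    unfolding conf_def[of _ _ _ _ st]
    apply (subst runs_code_step[OF Move.prems(1)])
    using Move.prems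
    by (auto simp: st Let_def tape_act_shift intro!: conf_eqI)
      (auto simp: prog_tape_upd_head prog_tape_def head_tape_def)
  from reaches_step[OF this reaches_refl[of M 0]] show ?case by simp
next
  case (Seq p q)
  have "runs_code M c p s" by (rule runs_codeI[OF Seq.prems(1)]) auto
  moreover have "runs_code M c q (s + code_size p)" by (rule runs_codeI[OF Seq.prems(1)]) auto
  ultimately have
    "reaches M (poly (time_bound p) (length w))
      (conf (tm_tapes M) c w s st l) (conf (tm_tapes M) c w (s + code_size p) (run w p st) l)"
    "reaches M (poly (time_bound q) (length w))
      (conf (tm_tapes M) c w (s + code_size p) (run w p st) l)
      (conf (tm_tapes M) c w (s + code_size p + code_size q) (run w q (run w p st)) l)"
    using Seq by auto
  from reaches_trans[OF this] show ?case by (simp add: add.assoc)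
next
  case (Cond i A p q)
  obtain h out where st: "st = (h, out)" by fastforce
  let ?n = "tm_tapes M"
  have p: "runs_code M c p (s + 1)" by (rule runs_codeI[OF Cond.prems(1)]) auto
  have q: "runs_code M c q (s + code_size p + 2)" by (rule runs_codeI[OF Cond.prems(1)]) auto
  have 1: "tm_step M (conf ?n c w s st l) =
    conf ?n c w (if head_cell w i (h i) \<in> A then s + 1 else s + code_size p + 2) st l"
    unfolding conf_def[of _ _ _ s st]
    apply (subst runs_code_step[OF Cond.prems(1)])
    using Cond.prems by (auto simp: st Let_def tape_read_head intro!: conf_eqI)
  show ?case
  proof (cases "head_cell w i (h i) \<in> A")
    case True
    have 2: "reaches M (poly (time_bound p) (length w)) (conf ?n c w (s + 1) st l)
        (conf ?n c w (s + 1 + code_size p) (run w p st) l)"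
      using Cond.IH(1)[OF p] Cond.prems by auto
    have 3: "tm_step M (conf ?n c w (s + 1 + code_size p) (run w p st) l) =
        conf ?n c w (s + code_size (Cond i A p q)) (run w p st) l"
      unfolding conf_def[of _ _ _ "s + 1 + code_size p"]
      apply (subst runs_code_step[OF Cond.prems(1)])
      using Cond.prems by (auto simp: Let_def intro!: conf_eqI)
    have "reaches M (poly (time_bound p) (length w) + (0 + 1))
        (conf ?n c w (s + 1) st l) (conf ?n c w (s + code_size (Cond i A p q)) (run w p st) l)"
      by (rule reaches_trans[OF 2 reaches_step[OF 3 reaches_refl]])
    from reaches_step[OF _ this] 1 True
    have "reaches M (poly (time_bound p) (length w) + (0 + 1) + 1) (conf ?n c w s st l)
       (conf ?n c w (s + code_size (Cond i A p q)) (run w p st) l)" by simp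
    then show ?thesis using True by (rule_tac reaches_mono) (auto simp: st)
  next
    case False
    have "reaches M (poly (time_bound q) (length w)) (conf ?n c w (s + code_size p + 2) st l)
        (conf ?n c w (s + code_size p + 2 + code_size q) (run w q st) l)"
      using Cond.IH(2)[OF q] Cond.prems by auto
    from reaches_step[OF _ this] 1 False
    have "reaches M (poly (time_bound q) (length w) + 1) (conf ?n c w s st l)
       (conf ?n c w (s + code_size p + 2 + code_size q) (run w q st) l)" by simp
    then have le: "reaches M (poly (time_bound (Cond i A p q)) (length w)) (conf ?n c w s st l)
       (conf ?n c w (s + code_size p + 2 + code_size q) (run w q st) l)"
      by (rule reaches_mono) simp
    have sz: "s + code_size (Cond i A p q) = s + code_size p + 2 + code_size q" by simp
    have "run w (Cond i A p q) st = run w q st" using False by (simp add: st)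
    then show ?thesis unfolding sz using le by (simp only:)
  qed
next
  case (Rep p)
  let ?n = "tm_tapes M"
  let ?k = "rep_height p"
  let ?T = "poly (time_bound p) (length w)"
  have p: "runs_code M c p (s + 1)" by (rule runs_codeI[OF Rep.prems(1)]) auto
  \<comment> \<open>After \<open>j\<close> rounds the counter head is on cell \<open>j\<close> of
    its copy of the input, so the blank is met after exactly \<open>length w\<close> rounds.\<close>
  have iter: "reaches M ((?T + 2) * j) (conf ?n c w s st l)
      (conf ?n c w s ((run w p ^^ j) st) (l(?k := int j)))" if "j \<le> length w" for j
    using that
  proof (induction j)
    case 0
    have "l(?k := int 0) = l" using Rep.prems(5)[of ?k] by auto
    then show ?case by (simp add: reaches_refl)
  next
    case (Suc j)
    let ?st = "(run w p ^^ j) st" and ?l = "l(?k := int j)"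
    have 1: "tm_step M (conf ?n c w s ?st ?l) = conf ?n c w (s + 1) ?st ?l"
      unfolding conf_def[of _ _ _ s]
      apply (subst runs_code_step[OF Rep.prems(1)])
      using Rep.prems Suc.prems
      by (auto simp: Let_def tape_read_loop word_at_def intro!: conf_eqI)
    have 2: "reaches M ?T (conf ?n c w (s + 1) ?st ?l)
        (conf ?n c w (s + 1 + code_size p) (run w p ?st) ?l)"
      by (rule Rep.IH[OF p]) (use Rep.prems in auto)
    have 3: "tm_step M (conf ?n c w (s + 1 + code_size p) (run w p ?st) ?l) =
        conf ?n c w s (run w p ?st) (l(?k := int (Suc j)))"
      unfolding conf_def[of _ _ _ "s + 1 + code_size p"]
      apply (subst runs_code_step[OF Rep.prems(1)])
      using Rep.prems Suc.prems
      by (auto simp: Let_def tape_act_shift intro!: conf_eqI) (auto simp: prog_tape_upd_loop)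
    have "reaches M (?T + (0 + 1) + 1) (conf ?n c w s ?st ?l)
      (conf ?n c w s (run w p ?st) (l(?k := int (Suc j))))"
      by (rule reaches_step[OF 1 reaches_trans[OF 2 reaches_step[OF 3 reaches_refl]]])
    from reaches_trans[OF Suc.IH this] Suc.prems show ?case
      by (simp add: algebra_simps fun_upd_def)
  qed
  let ?w = "length w"
  let ?st = "(run w p ^^ ?w) st" and ?l = "l(?k := int ?w)"
  have 1: "tm_step M (conf ?n c w s ?st ?l) = conf ?n c w (s + code_size p + 2) ?st ?l"
    unfolding conf_def[of _ _ _ s]
    apply (subst runs_code_step[OF Rep.prems(1)])
    using Rep.prems
    by (auto simp: Let_def tape_read_loop word_at_def intro!: conf_eqI)
  have 2: "tm_step M (conf ?n c w (s + code_size p + 2) ?st ?l) =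
      conf ?n c w (s + code_size p + 3) ?st (l(?k := int ?w - 1))"
    unfolding conf_def[of _ _ _ "s + code_size p + 2"]
    apply (subst runs_code_step[OF Rep.prems(1)])
    using Rep.prems
    by (auto simp: Let_def tape_act_shift intro!: conf_eqI) (auto simp: prog_tape_upd_loop)
  have 3: "reaches M (?w + 1) (conf ?n c w (s + code_size p + 3) ?st (l(?k := int ?w - 1)))
      (conf ?n c w (s + code_size (Rep p)) ?st (l(?k := 0)))"
    by (rule loop_rewind[OF Rep.prems(1)]) (use Rep.prems in auto)
  have "reaches M (?w + 1 + 1 + 1) (conf ?n c w s ?st ?l)
      (conf ?n c w (s + code_size (Rep p)) ?st (l(?k := 0)))"
    by (rule reaches_step[OF 1 reaches_step[OF 2 3]])
  from reaches_trans[OF iter[OF order_refl] this]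
  have "reaches M ((?T + 2) * ?w + (?w + 1 + 1 + 1)) (conf ?n c w s st l)
      (conf ?n c w (s + code_size (Rep p)) (run w (Rep p) st) (l(?k := 0)))"
    by simp
  moreover have "l(?k := 0) = l" using Rep.prems(5)[of ?k] by auto
  moreover have "(?T + 2) * ?w + (?w + 1 + 1 + 1) = poly (time_bound (Rep p)) ?w"
    by (simp add: algebra_simps)
  ultimately show ?case by (simp only:)
qed

section \<open>Initialisation: copying the input to the counter tapes\<close>

definition load :: "nat \<Rightarrow> (nat \<Rightarrow> 'a option) \<Rightarrow> 'a action" where
  "load c r = (if r 0 = None then 1 else 0,
     \<lambda>i. if i = 0 \<or> c + 1 \<le> i then (r 0, if r 0 = None then Go_Left else Go_Right)
         else if i = 1 then (r i, Stay) else (Some undefined, Stay))"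

definition rewind :: "nat \<Rightarrow> (nat \<Rightarrow> 'a option) \<Rightarrow> 'a action" where
  "rewind c r = (if r 0 = None then 2 else 1,
     \<lambda>i. if i = 0 \<or> c + 1 \<le> i then (r i, if r 0 = None then Go_Right else Go_Left)
         else (r i, Stay))"

definition compile :: "nat \<Rightarrow> 'a prog \<Rightarrow> 'a tm" where
  "compile c p = \<lparr>tm_tapes = c + 1 + rep_height p, tm_halt = 2 + code_size p,
     tm_delta = (\<lambda>q syms.
       let a = (if q = 0 then load c ((!) syms) else if q = 1 then rewind c ((!) syms)
                else code c p 2 q ((!) syms))
       in (fst a, map (snd a) [0..<c + 1 + rep_height p]))\<rparr>"

lemma code_target:
  assumes "s \<le> q" "q < s + code_size p"
  shows "fst (code c p s q r) \<le> s + code_size p"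
  using assms
proof (induction p arbitrary: s)
  case (Seq p1 p2)
  show ?case using Seq.prems Seq.IH(1)[of s] Seq.IH(2)[of "s + code_size p1"] by auto
next
  case (Cond i A p1 p2)
  show ?case
    using Cond.prems Cond.IH(1)[of "s + 1"] Cond.IH(2)[of "s + code_size p1 + 2"] by auto
next
  case (Rep p)
  show ?case using Rep.prems Rep.IH[of "s + 1"] by (auto simp: Let_def)
qed auto

lemma tm_wf_compile: "1 \<le> c \<Longrightarrow> tm_wf (compile c p)"
  using code_target[of 2 _ p c]
  by (auto simp: tm_wf_def compile_def Let_def load_def rewind_def)

text \<open>The flag \<open>b\<close> tells whether the marks at the origins have been written. They
  are rewritten in every loading step, including the one that reads the final blank, so they are
  also present for the empty input.\<close>

definition load_tape :: "nat \<Rightarrow> 'a list \<Rightarrow> bool \<Rightarrow> nat \<Rightarrow> nat \<Rightarrow> 'a tape" where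
  "load_tape c w b j i =
     (if i = 0 then (word_at w, int j)
      else if i = 1 then (word_at [], 0)
      else if i < c + 1 then (if b then head_cell w (i - 1) else word_at [], 0)
      else (word_at (take j w), int j))"

lemma load_step:
  fixes p :: "'a prog"
  assumes c: "1 \<le> c" and n: "n = c + 1 + rep_height p"
  shows "j < length w \<Longrightarrow> tm_step (compile c p) (0, map (load_tape c w b j) [0..<n]) =
      (0, map (load_tape c w True (Suc j)) [0..<n])"
    and "tm_step (compile c p) (0, map (load_tape c w b (length w)) [0..<n]) =
      conf n c w 1 ((\<lambda>_. 0)(0 := int (length w) - 1), []) (\<lambda>_. int (length w) - 1)"
proof -
  have 1: "tm_step (compile c p) (0, map g [0..<n]) =
      (let a = load c (\<lambda>i. tape_read (g i)) in
        (fst a, map (\<lambda>i. tape_act (g i) (snd a i)) [0..<n]))" for g :: "nat \<Rightarrow> 'a tape"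
    using n c by (auto simp: tm_step_def compile_def Let_def map2_map_upt comp_def load_def)
  show "tm_step (compile c p) (0, map (load_tape c w b j) [0..<n]) =
      (0, map (load_tape c w True (Suc j)) [0..<n])" if "j < length w"
    unfolding 1 using that c word_at_snoc[of "take j w" "w ! j"]
    by (auto simp: Let_def load_def load_tape_def tape_read_def tape_act_def word_at_def
        take_Suc_conv_app_nth min_def head_cell_def fun_eq_iff)
  show "tm_step (compile c p) (0, map (load_tape c w b (length w)) [0..<n]) =
      conf n c w 1 ((\<lambda>_. 0)(0 := int (length w) - 1), []) (\<lambda>_. int (length w) - 1)"
    unfolding 1 using c
    by (auto simp: Let_def load_def load_tape_def tape_read_def tape_act_def word_at_def
        head_cell_def fun_eq_iff prog_tape_def intro!: conf_eqI)
qed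

lemma rewind_reaches:
  fixes p :: "'a prog"
  assumes c: "1 \<le> c" and n: "n = c + 1 + rep_height p" and "j \<le> length w"
  shows "reaches (compile c p) (j + 1)
      (conf n c w 1 ((\<lambda>_. 0)(0 := int j - 1), []) (\<lambda>_. int j - 1))
      (conf n c w 2 (\<lambda>_. 0, []) (\<lambda>_. 0))"
  using assms(3)
proof (induction j)
  have 1: "tm_step (compile c p) (1, map g [0..<n]) =
      (let a = rewind c (\<lambda>i. tape_read (g i)) in
        (fst a, map (\<lambda>i. tape_act (g i) (snd a i)) [0..<n]))" for g :: "nat \<Rightarrow> 'a tape"
    using n c code_size_pos[of p]
    by (auto simp: tm_step_def compile_def Let_def map2_map_upt comp_def rewind_def)
  {
    case 0
    have "tm_step (compile c p) (conf n c w 1 ((\<lambda>_. 0)(0 := int 0 - 1), []) (\<lambda>_. int 0 - 1)) =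
      conf n c w 2 (\<lambda>_. 0, []) (\<lambda>_. 0)"
      unfolding conf_def[of _ _ _ 1] 1 using c
      by (auto simp: Let_def rewind_def tape_read_def tape_act_def word_at_def
          prog_tape_def fun_upd_idem_iff intro!: conf_eqI)
    from reaches_step[OF this reaches_refl[of _ 0]] show ?case by (simp add: fun_upd_def)
  next
    case (Suc j)
    have "tm_step (compile c p)
        (conf n c w 1 ((\<lambda>_. 0)(0 := int (Suc j) - 1), []) (\<lambda>_. int (Suc j) - 1)) =
      conf n c w 1 ((\<lambda>_. 0)(0 := int j - 1), []) (\<lambda>_. int j - 1)"
      unfolding conf_def[of _ _ _ _ _ "\<lambda>_. int (Suc j) - 1"] 1 using c Suc.prems
      by (auto simp: Let_def rewind_def tape_read_def tape_act_def word_at_def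
          prog_tape_def fun_upd_idem_iff intro!: conf_eqI)
    from reaches_step[OF this Suc.IH] Suc.prems show ?case by (simp add: fun_upd_def)
  }
qed

lemma compile_reaches:
  fixes p :: "'a prog"
  assumes c: "1 \<le> c" and n: "n = c + 1 + rep_height p" and p: "heads_below c p"
  shows "reaches (compile c p) (2 * length w + 2 + poly (time_bound p) (length w))
      (tm_init (compile c p) w)
      (conf n c w (tm_halt (compile c p)) (run w p (\<lambda>_. 0, [])) (\<lambda>_. 0))"
proof -
  let ?M = "compile c p" and ?w = "length w"
  have "tm_init ?M w = (0, map (load_tape c w False 0) [0..<n])"
    unfolding tm_init_def
  proof (rule arg_cong[of _ _ "Pair 0"], rule nth_equalityI)
    fix i assume "i < length (word_tape w # replicate (tm_tapes ?M - 1) (word_tape []))"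
    then have "i < n" using n c by (simp add: compile_def)
    then show "(word_tape w # replicate (tm_tapes ?M - 1) (word_tape [])) ! i =
        map (load_tape c w False 0) [0..<n] ! i"
      using n by (cases i) (auto simp: load_tape_def word_at_def word_tape_def compile_def
          nth_append)
  qed (use n c in \<open>simp add: compile_def\<close>)
  moreover have "\<exists>b. reaches ?M j (0, map (load_tape c w False 0) [0..<n])
      (0, map (load_tape c w b j) [0..<n])" if "j \<le> ?w" for j
    using that
  proof (induction j)
    case 0 show ?case by (auto intro: reaches_refl)
  next
    case (Suc j)
    then obtain b where "reaches ?M j (0, map (load_tape c w False 0) [0..<n])
      (0, map (load_tape c w b j) [0..<n])" by auto
    from reaches_trans[OF this reaches_step[OF load_step(1)[OF c n, of j w b] reaches_refl[of _ 0]]]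
      Suc.prems
    show ?case by auto
  qed
  ultimately obtain b where 1: "reaches ?M ?w (tm_init ?M w) (0, map (load_tape c w b ?w) [0..<n])"
    by auto
  have 2: "reaches ?M (?w + 1 + 1) (0, map (load_tape c w b ?w) [0..<n])
      (conf n c w 2 (\<lambda>_. 0, []) (\<lambda>_. 0))"
    by (rule reaches_step[OF load_step(2)[OF c n] rewind_reaches[OF c n order_refl]])
  have "runs_code ?M c p 2"
    unfolding runs_code_def by (auto simp: compile_def Let_def)
  from code_correct[OF this p _ c, of "\<lambda>_. 0" w "(\<lambda>_. 0, [])"]
  have 3: "reaches ?M (poly (time_bound p) ?w) (conf n c w 2 (\<lambda>_. 0, []) (\<lambda>_. 0))
      (conf n c w (tm_halt ?M) (run w p (\<lambda>_. 0, [])) (\<lambda>_. 0))"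
    using n by (simp add: compile_def)
  from reaches_trans[OF reaches_trans[OF 1 2] 3] show ?thesis by (simp add: mult_2)
qed

theorem polytime_program_fun:
  fixes p :: "'a::finite prog"
  assumes c: "1 \<le> c" and p: "heads_below c p"
  shows "polytime (program_fun p)"
  unfolding polytime_def
proof (rule exI[of _ "compile c p"], rule exI[of _ "[:2, 2:] + time_bound p"], intro conjI allI)
  let ?M = "compile c p"
  show "tm_wf ?M" using c by (rule tm_wf_compile)
  fix w :: "'a list"
  obtain s where s: "s \<le> 2 * length w + 2 + poly (time_bound p) (length w)"
    and eq: "(tm_step ?M ^^ s) (tm_init ?M w) =
      conf (c + 1 + rep_height p) c w (tm_halt ?M) (run w p (\<lambda>_. 0, [])) (\<lambda>_. 0)"
    using compile_reaches[OF c refl p, of w] unfolding reaches_def by blast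
  have "tm_computes_in ?M w (program_fun p w) s"
    unfolding tm_computes_in_def eq Let_def program_fun_def
    using c by (auto simp: conf_def prog_tape_def tape_holds_def word_at_def)
  moreover have "s \<le> poly ([:2, 2:] + time_bound p) (length w)" using s by simp
  ultimately show "\<exists>s\<le>poly ([:2, 2:] + time_bound p) (length w).
      tm_computes_in ?M w (program_fun p w) s" by blast
qed


section \<open>Encodings of perturbed entries\<close>

lemma enc_nat_set: "set (enc_nat n) \<subseteq> {Zero, One}"
  by (induction n rule: enc_nat.induct) (subst enc_nat.simps, auto)

lemma enc_nat_double:
  assumes "0 < a"
  shows "enc_nat (2 * a) = enc_nat a @ [Zero]" "enc_nat (Suc (2 * a)) = enc_nat a @ [One]"
  using assms by (subst enc_nat.simps, simp)+

lemma enc_nat_small [simp]: "enc_nat 0 = [Zero]" "enc_nat (Suc 0) = [One]"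
  by (subst enc_nat.simps, simp)+

lemma enc_nat_nonempty: "enc_nat n \<noteq> []"
  by (subst enc_nat.simps) simp

lemma enc_nat_hd: "0 < n \<Longrightarrow> hd (enc_nat n) = One"
proof (induction n rule: enc_nat.induct)
  case (1 n)
  show ?case
  proof (cases "n < 2")
    case True
    with 1 have "n = 1" by auto
    then show ?thesis by (simp add: enc_nat.simps)
  next
    case False
    then have "hd (enc_nat (n div 2)) = One" using 1 by auto
    then show ?thesis using False enc_nat_nonempty[of "n div 2"]
      by (subst enc_nat.simps) (simp add: hd_append)
  qed
qed

lemma enc_nat_shift: "0 < a \<Longrightarrow> enc_nat (a * 2 ^ k) = enc_nat a @ replicate k Zero"
proof (induction k)
  case (Suc k)
  have "a * 2 ^ Suc k = 2 * (a * 2 ^ k)" by simp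
  then show ?case using Suc enc_nat_double(1)[of "a * 2 ^ k"]
    by (simp add: replicate_append_same mult.left_commute)
qed simp

text \<open>The digits of \<open>b\<close> occupy exactly the positions that the shift frees, even
  for \<open>b = 0\<close>, whose encoding has one digit. Induction on the digits of
  \<open>b\<close>.\<close>

lemma enc_nat_concat:
  assumes "0 < a"
  shows "enc_nat (a * 2 ^ (k + length (enc_nat b)) + b) = enc_nat a @ replicate k Zero @ enc_nat b"
proof (induction b rule: enc_nat.induct)
  case (1 b)
  have pos: "0 < a * 2 ^ k" using assms by simp
  show ?case
  proof (cases "b < 2")
    case True
    then have "b = 0 \<or> b = 1" by auto
    moreover have "a * 2 ^ (k + 1) = 2 * (a * 2 ^ k)" by simp
    ultimately show ?thesis
      using enc_nat_double[OF pos] enc_nat_shift[OF assms, of k] by (auto simp: mult.left_commute)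
  next
    case False
    define c where "c = a * 2 ^ (k + length (enc_nat (b div 2))) + b div 2"
    have c: "0 < c" using assms by (simp add: c_def)
    have b: "enc_nat b = enc_nat (b div 2) @ [if even b then Zero else One]"
      using False by (subst enc_nat.simps) simp
    have "a * 2 ^ (k + length (enc_nat b)) + b = 2 * c + b mod 2"
      unfolding b by (simp add: c_def power_add algebra_simps)
    then have "enc_nat (a * 2 ^ (k + length (enc_nat b)) + b) =
      enc_nat c @ [if even b then Zero else One]"
      using enc_nat_double[OF c] by (cases "even b") (simp_all add: odd_iff_mod_2_eq_one)
    then show ?thesis using 1 False b by (simp add: c_def)
  qed
qed

lemma less_two_power_enc_nat: "n < 2 ^ length (enc_nat n)"
proof (induction n rule: enc_nat.induct)
  case (1 n)
  then show ?case by (cases "n < 2"; subst enc_nat.simps) auto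
qed

lemma odd_part:
  assumes "0 < (b::nat)"
  obtains o' s where "b = o' * 2 ^ s" "odd o'"
  using assms
proof (induction b arbitrary: thesis rule: less_induct)
  case (less b)
  show ?case
  proof (cases "odd b")
    case True then show ?thesis using less.prems(1)[of b 0] by simp
  next
    case False
    then obtain c where c: "b = 2 * c" by (meson evenE)
    then have "c < b" "0 < c" using less.prems by auto
    then obtain o' s where "c = o' * 2 ^ s" "odd o'" using less.IH by metis
    then show ?thesis using less.prems(1)[of o' "Suc s"] c by simp
  qed
qed

text \<open>Pointing away from zero keeps the sign, so that on absolute values the perturbation is
  an addition of natural numbers.\<close>

definition nudge :: "nat \<Rightarrow> rat \<Rightarrow> rat" where
  "nudge K q = q + (if q < 0 then -1 else 1) /
     2 ^ (K + length (enc_nat (nat (snd (quotient_of q)))))"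

definition strip_zeros :: "letter list \<Rightarrow> letter list" where
  "strip_zeros xs = rev (dropWhile (\<lambda>x. x = Zero) (rev xs))"

lemma strip_zeros_snoc [simp]:
  "strip_zeros (xs @ [Zero]) = strip_zeros xs" "strip_zeros (xs @ [One]) = xs @ [One]"
  "strip_zeros [] = []"
  by (simp_all add: strip_zeros_def)

lemma strip_zeros_replicate: "strip_zeros (xs @ replicate k Zero) = strip_zeros xs"
  by (induction k arbitrary: xs) (simp, simp flip: replicate_append_same append_assoc)

lemma enc_nat_odd: "odd n \<Longrightarrow> strip_zeros (enc_nat n) = enc_nat n"
  by (subst (1 2) enc_nat.simps) simp

lemma enc_rat_eq:
  "enc_rat q = (if q < 0 then [Minus] else []) @ enc_nat (nat \<bar>fst (quotient_of q)\<bar>) @ [Slash] @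
     enc_nat (nat (snd (quotient_of q)))"
proof -
  obtain a b where ab: "quotient_of q = (a, b)" by fastforce
  have b: "b > 0" and q: "q = of_int a / of_int b"
    using quotient_of_denom_pos[OF ab] quotient_of_div[OF ab] by auto
  have "q < 0 \<longleftrightarrow> a < 0" unfolding q using b by (simp add: divide_less_0_iff)
  then show ?thesis by (simp add: enc_rat_def ab)
qed

text \<open>The perturbation \<open>2\<^bsup>-(K + |b|)\<^esup>\<close> of \<open>a/b\<close> is chosen such that, writing \<open>b = b' 2\<^sup>s\<close> with
  \<open>b'\<close> odd, the new fraction \<open>(a 2\<^sup>X + b') / (b 2\<^sup>X)\<close> with \<open>X = K + |b'|\<close> is in lowest terms, so
  that its binary encoding arises by concatenation, without any arithmetic.\<close>

lemma enc_rat_nudge: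
  fixes q :: rat
  defines "a \<equiv> nat \<bar>fst (quotient_of q)\<bar>" and "b \<equiv> enc_nat (nat (snd (quotient_of q)))"
  shows "enc_rat (nudge K q) =
    (if q < 0 then [Minus] else []) @
    (if a = 0 then [] else enc_nat a @ replicate K Zero) @ strip_zeros b @ [Slash] @
    b @ replicate (K + length (strip_zeros b)) Zero"
proof -
  obtain x y where xy: "quotient_of q = (x, y)" by fastforce
  have y: "y > 0" and q: "q = of_int x / of_int y" and cop: "coprime x y"
    using quotient_of_denom_pos[OF xy] quotient_of_div[OF xy] quotient_of_coprime[OF xy] by auto
  obtain o' s where os: "nat y = o' * 2 ^ s" "odd o'" using odd_part[of "nat y"] y by auto
  have o': "0 < o'" using os by (auto intro: Nat.gr0I)
  have y_eq: "y = int o' * 2 ^ s"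
    using os(1) y by (metis int_nat_eq int_ops(7) less_imp_le of_nat_numeral of_nat_power)
  have b: "b = enc_nat o' @ replicate s Zero"
    unfolding b_def xy using enc_nat_shift[OF o'] os by simp
  have strip: "strip_zeros b = enc_nat o'"
    unfolding b strip_zeros_replicate using os enc_nat_odd by simp
  define X where "X = K + length (enc_nat o')"
  have X: "X > 0" unfolding X_def using enc_nat_nonempty[of o'] by simp
  define sg :: int where "sg = (if q < 0 then -1 else 1)"
  have sg: "x = sg * int a" using y
    by (simp add: sg_def a_def xy) (simp add: q divide_less_0_iff)
  define num where "num = int a * 2 ^ X + int o'"
  have num: "num > 0" unfolding num_def using o' by (simp add: add_nonneg_pos)
  have "coprime (int a) (int o')"
    using cop unfolding sg y_eq by (simp add: sg_def split: if_splits)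
  moreover have odd: "coprime (2 ^ k) (int o')" for k using os(2) by simp
  ultimately have "coprime (int a * 2 ^ X) (int o')"
    by (simp only: coprime_mult_left_iff)
  then have 1: "coprime num (int o')"
    unfolding num_def by (metis coprime_iff_gcd_eq_1 gcd_add1)
  have "odd num" unfolding num_def using X os(2) by simp
  then have 2: "coprime num (2 ^ k)" for k by simp
  have cop': "coprime (sg * num) (y * 2 ^ X)"
    unfolding y_eq using 1 2 by (simp add: sg_def)
  have "nudge K q = of_int (sg * num) / of_int (y * 2 ^ X)"
  proof -
    \<comment> \<open>The denominator has \<open>s\<close> more digits than its odd part
      \<open>o'\<close>, so the nudge is, up to sign, \<open>1 / 2 ^ (X + s)\<close>, which is
      \<open>o' / (y * 2 ^ X)\<close>.\<close>
    have len: "K + length (enc_nat (nat (snd (quotient_of q)))) = X + s"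
      using b unfolding b_def X_def by simp
    have "nudge K q = of_int x / of_int y + of_int sg / 2 ^ (X + s)"
      unfolding nudge_def len by (subst q) (simp add: sg_def)
    also have "\<dots> = of_int (sg * num) / of_int (y * 2 ^ X)"
      unfolding sg y_eq num_def using o' by (simp add: field_simps power_add)
    finally show ?thesis .
  qed
  then have "nudge K q = Rat.Fract (sg * num) (y * 2 ^ X)"
    by (simp only: Fract_of_int_quotient)
  then have quot: "quotient_of (nudge K q) = (sg * num, y * 2 ^ X)"
    using cop' y by (simp only: quotient_of_Fract) (rule normalize_stable, simp_all)
  have neg: "nudge K q < 0 \<longleftrightarrow> q < 0" 
    unfolding nudge_def by (auto simp: not_less add_nonneg_pos intro: less_trans[of _ 0])
  have "nat \<bar>sg * num\<bar> = a * 2 ^ X + o'"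
    using num by (simp add: num_def sg_def nat_add_distrib nat_mult_distrib nat_power_eq)
  \<comment> \<open>The digit \<open>Zero\<close> of \<open>a = 0\<close> would be a leading zero
    here, hence the case distinction.\<close>
  moreover have "enc_nat (a * 2 ^ X + o') =
      (if a = 0 then [] else enc_nat a @ replicate K Zero) @ enc_nat o'"
    using enc_nat_concat[of a K o'] unfolding X_def by auto
  moreover have "nat (y * 2 ^ X) = nat y * 2 ^ X" using y by (simp add: nat_mult_distrib nat_power_eq)
  moreover have "enc_nat (nat y * 2 ^ X) = b @ replicate X Zero"
    using enc_nat_shift[of "nat y" X] y by (simp add: b_def xy)
  ultimately show ?thesis
    unfolding enc_rat_eq[of "nudge K q"] quot neg strip by (simp add: X_def)
qed


section \<open>The program of the reduction\<close>

abbreviation skip :: "'a prog" where "skip \<equiv> Move 0 Stay"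
abbreviation right :: "'a prog" where "right \<equiv> Move 0 Go_Right"
abbreviation left :: "'a prog" where "left \<equiv> Move 0 Go_Left"

text \<open>The body runs at most once per input letter, so this is a true while loop only as long
  as the test fails within that many rounds.\<close>

definition while :: "nat \<Rightarrow> 'a option set \<Rightarrow> 'a prog \<Rightarrow> 'a prog" where
  "while i A p = Rep (Cond i A p skip)"

abbreviation until :: "'a \<Rightarrow> 'a prog \<Rightarrow> 'a prog" where
  "until x p \<equiv> while 0 (- {Some x}) p"

abbreviation while_nonzero :: "nat \<Rightarrow> 'a prog \<Rightarrow> 'a prog" where
  "while_nonzero i p \<equiv> while i {None} p"

fun emit_list :: "'a list \<Rightarrow> 'a prog" where
  "emit_list [] = skip"
| "emit_list (a # as) = Emit a ;; emit_list as"

text \<open>Nested loops give a power of the input length; the exponents of the scales in the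
  construction come from here.\<close>

fun zeros :: "nat \<Rightarrow> letter prog" where
  "zeros 0 = Emit Zero"
| "zeros (Suc k) = Rep (zeros k)"

definition copy_to :: "letter \<Rightarrow> letter prog" where "copy_to x = until x (Copy ;; right)"
definition skip_to :: "letter \<Rightarrow> letter prog" where "skip_to x = until x right"
definition back_to :: "letter \<Rightarrow> letter prog" where "back_to x = until x left"

text \<open>Head 5 counts the zeros that are held back until a later \<open>One\<close> shows up.\<close>

definition copy_stripped :: "letter \<Rightarrow> letter prog" where
  "copy_stripped x =
     until Comma
       (Cond 0 {Some One} (while_nonzero 5 (Emit Zero ;; Move 5 Go_Left) ;; Emit x)
          (Move 5 Go_Right) ;; right) ;;
     while_nonzero 5 (Move 5 Go_Left)"

text \<open>The denominator is scanned three times: stripped, as the low end of the new numerator;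
  in full, as the start of the new denominator; and stripped again with all digits turned into
  \<open>Zero\<close>, as padding of the right length.\<close>

definition nudge_entry :: "letter prog" where
  "nudge_entry =
     Cond 0 {Some Minus} (Copy ;; right) skip ;;
     Cond 0 {Some Zero} right (copy_to Slash ;; zeros 3) ;;
     right ;; copy_stripped One ;; back_to Slash ;; Emit Slash ;;
     right ;; copy_to Comma ;; zeros 3 ;; back_to Slash ;; right ;; copy_stripped Zero"

text \<open>Head 1 holds the index \<open>j\<close> of the column, head 3 the distance \<open>j - i\<close> to the diagonal,
  head 2 the difference between the numbers of rows and columns seen; head 4 is auxiliary.\<close>

definition load_column_index :: "letter prog" where
  "load_column_index =
     while_nonzero 1 (Move 1 Go_Left ;; Move 3 Go_Right ;; Move 4 Go_Right) ;;
     while_nonzero 4 (Move 4 Go_Left ;; Move 1 Go_Right)"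

text \<open>The column ends with the entry 0 of the additional row. Head 3 has been decreased once
  per row, so it is at \<open>j - n\<close>, which is not positive; hence it is reset by moving
  right.\<close>

definition finish_column :: "letter prog" where
  "finish_column =
     emit_list [Zero, Slash, One, Comma, Semicolon] ;;
     while_nonzero 3 (Move 3 Go_Right) ;; Move 1 Go_Right ;; Move 2 Go_Left"

definition entry :: "letter prog" where
  "entry = Cond 3 {None} (copy_to Comma) nudge_entry ;; Copy ;; right ;; Move 3 Go_Left"

definition columns :: "letter prog" where
  "columns = until Hash (load_column_index ;; until Semicolon entry ;; right ;; finish_column)"

text \<open>The number \<open>n\<close> of rows is read off the target. As head 2 holds
  \<open>- m\<close> after the \<open>m\<close> columns, it then holds the number
  \<open>n - m\<close> of missing columns.\<close>

definition count_rows :: "letter prog" where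
  "count_rows = right ;; until Semicolon (skip_to Comma ;; right ;; Move 2 Go_Right) ;; back_to Hash"

text \<open>The entries of the target only serve as a ruler of length \<open>n\<close> here.\<close>

definition extra_entry :: "letter prog" where
  "extra_entry =
     Cond 3 {None} (emit_list [Zero, Slash, One, Comma])
       (Emit One ;; zeros 5 ;; emit_list [Slash, One, Comma]) ;;
     Move 3 Go_Left ;; skip_to Comma ;; right"

definition extra_columns :: "letter prog" where
  "extra_columns = while_nonzero 2
     (load_column_index ;; right ;; until Semicolon extra_entry ;; back_to Hash ;; finish_column)"

definition common_basis :: "letter prog" where
  "common_basis = columns ;; count_rows ;; extra_columns"

text \<open>\<open>p\<close> has to emit the upper entries and carry the head to the semicolon
  behind the target. What follows there in the input is the encoding of \<open>d\<close>, the bottom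
  entry of the column.\<close>

definition last_column :: "letter prog \<Rightarrow> letter prog" where
  "last_column p = right ;; p ;; right ;; while 0 (- {None}) (Copy ;; right) ;;
     emit_list [Comma, Semicolon, Hash]"

text \<open>The head is on the blank behind the input, which has to be left before the scan for the
  blank in front of it. Of the counters only head 1, the column index, is nonzero at this
  point.\<close>

definition restart :: "letter prog" where
  "restart = left ;; while 0 (- {None}) left ;; right ;; while_nonzero 1 (Move 1 Go_Left)"

text \<open>A program cannot store what it has emitted, so the columns common to both bases are
  generated a second time from the input. The final letters encode the threshold 16.\<close>

definition reduction :: "letter prog" where
  "reduction =
     common_basis ;;
     last_column (until Semicolon (emit_list [Zero, Slash, One, Comma] ;; skip_to Comma ;; right)) ;;
     restart ;;
     common_basis ;; last_column (copy_to Semicolon) ;;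
     emit_list [One, Zero, Zero, Zero, Zero, Slash, One]"

section \<open>Symbolic execution of the building blocks\<close>

lemma heads_below_while [simp]:
  "heads_below c (while i A p) \<longleftrightarrow> 0 < c \<and> i < c \<and> heads_below c p"
  by (auto simp: while_def)

lemma heads_below_zeros [simp]: "heads_below c (zeros k)"
  by (induction k) auto

lemma heads_below_reduction: "heads_below 6 reduction"
  by (simp add: reduction_def common_basis_def last_column_def restart_def columns_def
      count_rows_def extra_columns_def extra_entry_def entry_def finish_column_def
      load_column_index_def nudge_entry_def copy_stripped_def copy_to_def skip_to_def back_to_def)

text \<open>\<open>s\<close> lists the successive states. Fewer than \<open>length w\<close> rounds
  are fine: once the test fails, the remaining repetitions change nothing.\<close>

lemma run_while:
  assumes k: "k \<le> length w"
    and step: "\<And>j. j < k \<Longrightarrow> head_cell w i (fst (s j) i) \<in> A \<and> run w p (s j) = s (Suc j)"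
    and stop: "head_cell w i (fst (s k) i) \<notin> A"
  shows "run w (while i A p) (s 0) = s k"
proof -
  let ?f = "run w (Cond i A p skip)"
  have cond: "?f t = (if head_cell w i (fst t i) \<in> A then run w p t else t)" for t
    by (cases t) (simp add: fun_upd_def)
  have "(?f ^^ j) (s 0) = s j" if "j \<le> k" for j
    using that
  proof (induction j)
    case (Suc j)
    then show ?case using step[of j] by (simp add: cond)
  qed simp
  moreover have "(?f ^^ j) (s k) = s k" for j
    by (induction j) (use stop in \<open>auto simp: cond\<close>)
  ultimately have "(?f ^^ (length w - k + k)) (s 0) = s k"
    by (simp only: funpow_add comp_apply)
  then show ?thesis using k by (simp add: while_def)
qed

text \<open>Heads 0 to 5 in order: input position, column index, difference of rows and columns,
  distance to the diagonal, auxiliary counter, zeros held back.\<close>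

definition st :: "int \<Rightarrow> int \<Rightarrow> int \<Rightarrow> int \<Rightarrow> int \<Rightarrow> int \<Rightarrow> letter list \<Rightarrow> letter pstate" where
  "st p c e r a h out = ((\<lambda>_. 0)(0 := p, 1 := c, 2 := e, 3 := r, 4 := a, 5 := h), out)"

lemma fst_st [simp]:
  "fst (st p c e r a h out) 0 = p" "fst (st p c e r a h out) (Suc 0) = c"
  "fst (st p c e r a h out) 2 = e" "fst (st p c e r a h out) 3 = r"
  "fst (st p c e r a h out) 4 = a" "fst (st p c e r a h out) 5 = h"
  by (simp_all add: st_def)

lemma head_cell_simps [simp]:
  "head_cell w 0 p = word_at w p"
  "0 < i \<Longrightarrow> head_cell w i p = None \<longleftrightarrow> p \<noteq> 0"
  by (simp_all add: head_cell_def)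

lemma run_Cond: "run w (Cond i A p q) t =
    (if head_cell w i (fst t i) \<in> A then run w p t else run w q t)"
  by (cases t) simp

lemma run_st [simp]:
  "run w (Emit x) (st p c e r a h out) = st p c e r a h (out @ [x])"
  "run w (Move 0 d) (st p c e r a h out) = st (p + dir_offset d) c e r a h out"
  "run w (Move (Suc 0) d) (st p c e r a h out) = st p (c + dir_offset d) e r a h out"
  "run w (Move 2 d) (st p c e r a h out) = st p c (e + dir_offset d) r a h out"
  "run w (Move 3 d) (st p c e r a h out) = st p c e (r + dir_offset d) a h out"
  "run w (Move 4 d) (st p c e r a h out) = st p c e r (a + dir_offset d) h out"
  "run w (Move 5 d) (st p c e r a h out) = st p c e r a (h + dir_offset d) out"
  "word_at w p = Some x \<Longrightarrow> run w Copy (st p c e r a h out) = st p c e r a h (out @ [x])"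
  by (auto simp: st_def fun_eq_iff)

lemma run_emit_list [simp]:
  "run w (emit_list xs) (st p c e r a h out) = st p c e r a h (out @ xs)"
  by (induction xs arbitrary: out) auto

lemma run_zeros [simp]:
  "run w (zeros k) (st p c e r a h out) = st p c e r a h (out @ replicate (length w ^ k) Zero)"
proof (induction k arbitrary: out)
  case (Suc k)
  have "(run w (zeros k) ^^ j) (st p c e r a h out) =
    st p c e r a h (out @ replicate (j * length w ^ k) Zero)" for j
  proof (induction j)
    case (Suc j)
    then show ?case by (simp add: \<open>\<And>out. run w (zeros k) _ = _\<close> add.commute flip: replicate_add)
  qed simp
  then show ?case by simp
qed simp

lemma word_at_append [simp]:
  "word_at (u @ v) (int (length u)) = (case v of [] \<Rightarrow> None | x # _ \<Rightarrow> Some x)"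
  "word_at (u @ v) (int (length u) + int k) = word_at v (int k)"
  by (auto simp: word_at_def nth_append nat_add_distrib split: list.splits)

lemma word_at_nth: "k < length v \<Longrightarrow> word_at v (int k) = Some (v ! k)"
  by (simp add: word_at_def)

lemma run_copy_to:
  assumes w: "w = u @ v @ x # z" and x: "x \<notin> set v"
  shows "run w (copy_to x) (st (int (length u)) c e r a h out) =
    st (int (length u + length v)) c e r a h (out @ v)"
proof -
  define s where "s j = st (int (length u) + int j) c e r a h (out @ take j v)" for j
  have at: "word_at w (int (length u) + int j) = Some ((v @ x # z) ! j)" if "j \<le> length v" for j
    using that unfolding w by (simp add: word_at_nth)
  have "run w (copy_to x) (s 0) = s (length v)"
    unfolding copy_to_def
  proof (rule run_while)
    fix j assume j: "j < length v"
    then have "v ! j \<noteq> x" using x by auto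
    then show "head_cell w 0 (fst (s j) 0) \<in> - {Some x} \<and> run w (Copy ;; right) (s j) = s (Suc j)"
      using at[of j] j by (simp add: s_def nth_append take_Suc_conv_app_nth add_ac)
  qed (use at[of "length v"] in \<open>simp_all add: s_def w nth_append\<close>)
  then show ?thesis by (simp add: s_def)
qed

lemma run_skip_to:
  assumes w: "w = u @ v @ x # z" and x: "x \<notin> set v"
  shows "run w (skip_to x) (st (int (length u)) c e r a h out) =
    st (int (length u + length v)) c e r a h out"
proof -
  define s where "s j = st (int (length u) + int j) c e r a h out" for j
  have at: "word_at w (int (length u) + int j) = Some ((v @ x # z) ! j)" if "j \<le> length v" for j
    using that unfolding w by (simp add: word_at_nth)
  have "run w (skip_to x) (s 0) = s (length v)"
    unfolding skip_to_def
  proof (rule run_while)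
    fix j assume j: "j < length v"
    then have "v ! j \<noteq> x" using x by auto
    then show "head_cell w 0 (fst (s j) 0) \<in> - {Some x} \<and> run w right (s j) = s (Suc j)"
      using at[of j] j by (simp add: s_def nth_append add_ac)
  qed (use at[of "length v"] in \<open>simp_all add: s_def w nth_append\<close>)
  then show ?thesis by (simp add: s_def)
qed

text \<open>The head starts on the first letter of \<open>z\<close>; if that were \<open>x\<close>,
  the loop would stop at once.\<close>

lemma run_back_to:
  assumes w: "w = u @ x # v @ z" and x: "x \<notin> set v" and z: "z \<noteq> []" "hd z \<noteq> x"
  shows "run w (back_to x) (st (int (length u + 1 + length v)) c e r a h out) =
    st (int (length u)) c e r a h out"
proof -
  define s where "s j = st (int (length u + 1 + length v) - int j) c e r a h out" for j
  have at: "word_at w (int (length u + 1 + length v) - int j) =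
      Some ((x # v @ z) ! (1 + length v - j))" if "j \<le> 1 + length v" for j
  proof -
    have "int (length u + 1 + length v) - int j = int (length u) + int (1 + length v - j)"
      using that by simp
    then show ?thesis unfolding w using z
      by (simp only: word_at_append) (rule word_at_nth, cases z, auto)
  qed
  have "run w (back_to x) (s 0) = s (1 + length v)"
    unfolding back_to_def
  proof (rule run_while)
    fix j assume j: "j < 1 + length v"
    have "(x # v @ z) ! (1 + length v - j) \<noteq> x"
      using x z j by (cases j; cases z) (auto simp: nth_Cons nth_append split: nat.splits)
    then show "head_cell w 0 (fst (s j) 0) \<in> - {Some x} \<and> run w left (s j) = s (Suc j)"
      using at[of j] j by (simp add: s_def algebra_simps)
  qed (use at[of "1 + length v"] in \<open>simp_all add: s_def w\<close>)
  then show ?thesis by (simp add: s_def)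
qed

text \<open>The input position is kept as a separate argument of \<open>S\<close> because items
  differ in length. Items are nonempty, so there are no more of them than repetitions, and none
  starts with the stop letter.\<close>

lemma run_until_items:
  assumes w: "w = u @ concat (map f xs) @ x # z"
    and item: "\<And>y. y \<in> set xs \<Longrightarrow> f y \<noteq> [] \<and> hd (f y) \<noteq> x"
    and S: "\<And>j p. fst (S j p) 0 = p"
    and body: "\<And>j u' z'. j < length xs \<Longrightarrow> w = u' @ f (xs ! j) @ z' \<Longrightarrow>
      run w body (S j (int (length u'))) = S (Suc j) (int (length u' + length (f (xs ! j))))"
  shows "run w (until x body) (S 0 (int (length u))) =
    S (length xs) (int (length u + length (concat (map f xs))))"
proof -
  define g where "g j = concat (map f (take j xs))" for j
  define s where "s j = S j (int (length (u @ g j)))" for j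
  have g: "w = (u @ g j) @ f (xs ! j) @ concat (map f (drop (Suc j) xs)) @ x # z"
    "g (Suc j) = g j @ f (xs ! j)" if "j < length xs" for j
  proof -
    have "xs = take j xs @ xs ! j # drop (Suc j) xs" using that by (rule id_take_nth_drop)
    then have "concat (map f xs) = g j @ f (xs ! j) @ concat (map f (drop (Suc j) xs))"
      unfolding g_def by (metis concat.simps(2) concat_append list.simps(9) map_append)
    then show "w = (u @ g j) @ f (xs ! j) @ concat (map f (drop (Suc j) xs)) @ x # z"
      using w by simp
    show "g (Suc j) = g j @ f (xs ! j)" using that by (simp add: g_def take_Suc_conv_app_nth)
  qed
  have len: "length ys \<le> length (concat (map f ys))" if "set ys \<subseteq> set xs" for ys
    using that
  proof (induction ys)
    case (Cons y ys)
    then have "1 \<le> length (f y)" using item[of y] by (cases "f y") auto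
    then show ?case using Cons by simp
  qed simp
  have "run w (until x body) (s 0) = s (length xs)"
  proof (rule run_while)
    show "length xs \<le> length w" using len[of xs] unfolding w by simp
    fix j assume j: "j < length xs"
    obtain y ys where y: "f (xs ! j) = y # ys" "y \<noteq> x"
      using item[of "xs ! j"] j by (cases "f (xs ! j)") auto
    have "word_at w (int (length (u @ g j))) = Some y"
      by (subst g(1)[OF j], simp only: word_at_append) (simp add: y)
    moreover have "run w body (s j) = s (Suc j)"
      unfolding s_def using body[OF j g(1)[OF j]] g(2)[OF j] by (simp add: add_ac)
    ultimately show "head_cell w 0 (fst (s j) 0) \<in> - {Some x} \<and> run w body (s j) = s (Suc j)"
      using y by (simp add: s_def S)
  next
    have "w = (u @ g (length xs)) @ x # z" using w by (simp add: g_def)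
    then have "word_at w (int (length (u @ g (length xs)))) = Some x"
      by (metis list.simps(5) word_at_append(1))
    then show "head_cell w 0 (fst (s (length xs)) 0) \<notin> - {Some x}"
      by (simp add: s_def S)
  qed
  then show ?thesis by (simp add: s_def g_def)
qed

lemma run_clear:
  assumes "k \<le> length w"
  shows "run w (while_nonzero 5 (Move 5 Go_Left)) (st p c e r a (int k) out) = st p c e r a 0 out"
    and "run w (while_nonzero 3 (Move 3 Go_Right)) (st p c e (- int k) a h out) = st p c e 0 a h out"
    and "run w (while_nonzero (Suc 0) (Move (Suc 0) Go_Left)) (st p (int k) e r a h out) =
      st p 0 e r a h out"
  using run_while[OF assms, where s = "\<lambda>j. st p c e r a (int k - int j) out"
      and i = 5 and A = "{None}" and p = "Move 5 Go_Left"]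
    run_while[OF assms, where s = "\<lambda>j. st p c e (int j - int k) a h out"
      and i = 3 and A = "{None}" and p = "Move 3 Go_Right"]
    run_while[OF assms, where s = "\<lambda>j. st p (int k - int j) e r a h out"
      and i = "Suc 0" and A = "{None}" and p = "Move (Suc 0) Go_Left"]
  by (auto simp: algebra_simps)

lemma run_flush:
  assumes "k \<le> length w"
  shows "run w (while_nonzero 5 (Emit Zero ;; Move 5 Go_Left)) (st p c e r a (int k) out) =
    st p c e r a 0 (out @ replicate k Zero)"
  using run_while[OF assms, where s = "\<lambda>j. st p c e r a (int k - int j) (out @ replicate j Zero)"
      and i = 5 and A = "{None}" and p = "Emit Zero ;; Move 5 Go_Left"]
  by (auto simp: algebra_simps replicate_append_same)

lemma strip_zeros_split:
  assumes "set xs \<subseteq> {Zero, One}"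
  shows "length (strip_zeros xs) \<le> length xs \<and>
    xs = strip_zeros xs @ replicate (length xs - length (strip_zeros xs)) Zero"
  using assms
proof (induction xs rule: rev_induct)
  case (snoc x xs)
  then show ?case by (auto simp: Suc_diff_le simp flip: replicate_append_same)
qed simp

lemma run_copy_stripped:
  assumes w: "w = u @ v @ Comma # z" and v: "set v \<subseteq> {Zero, One}"
  shows "run w (copy_stripped x) (st (int (length u)) c e r a 0 out) =
    st (int (length u + length v)) c e r a 0
      (out @ map (\<lambda>y. if y = One then x else y) (strip_zeros v))"
proof -
  let ?f = "map (\<lambda>y. if y = One then x else y)"
  \<comment> \<open>The number of trailing zeros among the first \<open>j\<close> letters, which is
    the value of head 5.\<close>
  define t where "t j = length (take j v) - length (strip_zeros (take j v))" for j
  define s where "s j = st (int (length u) + int j) c e r a (int (t j))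
      (out @ ?f (strip_zeros (take j v)))" for j
  have at: "word_at w (int (length u) + int j) = Some ((v @ Comma # z) ! j)" if "j \<le> length v" for j
    using that unfolding w by (simp add: word_at_nth)
  have t_le: "t j \<le> length w" for j unfolding t_def w by simp
  have split: "length (strip_zeros (take j v)) \<le> length (take j v) \<and>
      take j v = strip_zeros (take j v) @ replicate (t j) Zero" for j
    unfolding t_def by (rule strip_zeros_split) (use v in \<open>auto dest: in_set_takeD\<close>)
  have Comma: "v ! j \<noteq> Comma" if "j < length v" for j using v that nth_mem by fastforce
  have "run w (until Comma
       (Cond 0 {Some One} (while_nonzero 5 (Emit Zero ;; Move 5 Go_Left) ;; Emit x)
          (Move 5 Go_Right) ;; right)) (s 0) = s (length v)" (is "run w (until Comma ?body) _ = _")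
  proof (rule run_while)
    fix j assume j: "j < length v"
    have "run w ?body (s j) = s (Suc j)"
    proof (cases "v ! j = One")
      case True
      have "?f (take j v) = ?f (strip_zeros (take j v)) @ replicate (t j) Zero"
        by (subst conjunct2[OF split[of j]]) simp
      then show ?thesis
        using True at[of j] j run_flush[OF t_le[of j]]
        by (simp add: s_def run_Cond nth_append take_Suc_conv_app_nth t_def add_ac)
    next
      case False
      then have "v ! j = Zero" using v j nth_mem by fastforce
      then show ?thesis
        using at[of j] j split[of j]
        by (simp add: s_def run_Cond nth_append take_Suc_conv_app_nth t_def Suc_diff_le add_ac)
    qed
    then show "head_cell w 0 (fst (s j) 0) \<in> - {Some Comma} \<and> run w ?body (s j) = s (Suc j)"
      using at[of j] j Comma[OF j] by (simp add: s_def nth_append)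
  qed (use at[of "length v"] in \<open>simp_all add: s_def w nth_append\<close>)
  then show ?thesis
    using run_clear(1)[OF t_le[of "length v"]] by (simp add: s_def copy_stripped_def t_def)
qed


lemma run_nudge_entry:
  assumes w: "w = u @ enc_rat q @ Comma # z"
  shows "run w nudge_entry (st (int (length u)) c e r a 0 out) =
    st (int (length u + length (enc_rat q))) c e r a 0 (out @ enc_rat (nudge (length w ^ 3) q))"
proof -
  define sg where "sg = (if q < 0 then [Minus] else [])"
  define n where "n = nat \<bar>fst (quotient_of q)\<bar>"
  define A where "A = enc_nat n"
  define D where "D = enc_nat (nat (snd (quotient_of q)))"
  have q: "enc_rat q = sg @ A @ Slash # D" by (simp add: enc_rat_eq sg_def n_def A_def D_def)
  have w': "w = u @ sg @ A @ Slash # D @ Comma # z" using w q by simp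
  have A: "set A \<subseteq> {Zero, One}" and D: "set D \<subseteq> {Zero, One}"
    unfolding A_def D_def by (rule enc_nat_set)+
  obtain x A' where A': "A = x # A'" unfolding A_def using enc_nat_nonempty by (meson neq_Nil_conv)
  have x: "x = Zero \<or> x = One" using A A' by auto
  \<comment> \<open>The leading digit of a positive number is \<open>One\<close>, so that one letter
    decides between the two cases of \<open>enc_rat_nudge\<close>.\<close>
  have x0: "x = Zero \<longleftrightarrow> n = 0"
    using enc_nat_hd[of n] A' A_def by (cases "n = 0") auto
  define p0 where "p0 = int (length (u @ sg))"
  define p1 where "p1 = int (length (u @ sg @ A))"
  define p2 where "p2 = int (length (u @ sg @ A @ [Slash]))"
  define p3 where "p3 = int (length (u @ sg @ A @ Slash # D))"
  define P where "P = (if n = 0 then [] else A @ replicate (length w ^ 3) Zero)"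
  have s0: "run w (Cond 0 {Some Minus} (Copy ;; right) skip) (st (int (length u)) c e r a 0 out) =
      st p0 c e r a 0 (out @ sg)"
    using x unfolding w' by (auto simp: run_Cond sg_def p0_def A')
  have at0: "word_at w p0 = Some x"
    unfolding p0_def w' using word_at_append(1)[of "u @ sg" "A @ Slash # D @ Comma # z"] A' by simp
  have "Slash \<notin> set A" using A by auto
  then have c1: "run w (copy_to Slash) (st p0 c e r a 0 out') = st p1 c e r a 0 (out' @ A)" for out'
    using run_copy_to[of w "u @ sg" A Slash "D @ Comma # z"] w' by (simp add: p0_def p1_def add_ac)
  have s1: "run w (Cond 0 {Some Zero} right (copy_to Slash ;; zeros 3)) (st p0 c e r a 0 (out @ sg)) =
      st p1 c e r a 0 (out @ sg @ P)"
  proof (cases "n = 0")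
    case True
    then have "p1 = p0 + 1" by (simp add: p0_def p1_def A_def)
    then show ?thesis using True x0 by (simp add: run_Cond at0 P_def)
  next
    case False
    then show ?thesis using x0 by (simp add: run_Cond at0 P_def c1)
  qed
  have p12: "p1 + 1 = p2" by (simp add: p1_def p2_def)
  have s2: "run w (copy_stripped y) (st p2 c e r a 0 out') =
      st p3 c e r a 0 (out' @ map (\<lambda>z. if z = One then y else z) (strip_zeros D))" for y out'
    using run_copy_stripped[of w "u @ sg @ A @ [Slash]" D z y] w' D
    by (simp add: p2_def p3_def add_ac)
  have "Slash \<notin> set D" using D by auto
  then have s3: "run w (back_to Slash) (st p3 c e r a 0 out') = st p1 c e r a 0 out'" for out'
    using run_back_to[of w "u @ sg @ A" Slash D "Comma # z"] w'
    by (simp add: p1_def p3_def add_ac)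
  have "Comma \<notin> set D" using D by auto
  then have s4: "run w (copy_to Comma) (st p2 c e r a 0 out') = st p3 c e r a 0 (out' @ D)" for out'
    using run_copy_to[of w "u @ sg @ A @ [Slash]" D Comma z] w' by (simp add: p2_def p3_def add_ac)
  have "set (strip_zeros D) \<subseteq> {Zero, One}"
    using D set_dropWhileD[of _ _ "rev D"] by (fastforce simp: strip_zeros_def)
  then have "map (\<lambda>z. if z = One then Zero else z) (strip_zeros D) =
      replicate (length (strip_zeros D)) Zero"
    by (induction "strip_zeros D" rule: rev_induct; intro nth_equalityI) (auto dest!: nth_mem)
  moreover have "map (\<lambda>z. if z = One then One else z) (strip_zeros D) = strip_zeros D"
    by (rule map_idI) auto
  ultimately have "run w nudge_entry (st (int (length u)) c e r a 0 out) = st p3 c e r a 0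
      (out @ sg @ P @ strip_zeros D @ Slash # D @ replicate (length w ^ 3) Zero @
        replicate (length (strip_zeros D)) Zero)"
    by (simp add: nudge_entry_def s0 s1 s2 s3 s4 p12)
  moreover have "enc_rat (nudge (length w ^ 3) q) =
      sg @ P @ strip_zeros D @ Slash # D @ replicate (length w ^ 3) Zero @
        replicate (length (strip_zeros D)) Zero"
    unfolding enc_rat_nudge by (simp add: sg_def P_def n_def A_def D_def replicate_add)
  moreover have "p3 = int (length u + length (enc_rat q))" by (simp add: p3_def q)
  ultimately show ?thesis by simp
qed

lemma enc_rat_set: "set (enc_rat q) \<subseteq> {Zero, One, Minus, Slash}"
  using enc_nat_set by (fastforce simp: enc_rat_eq)

lemma enc_rat_notin [simp]:
  "Comma \<notin> set (enc_rat q)" "Semicolon \<notin> set (enc_rat q)" "Hash \<notin> set (enc_rat q)"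
  using enc_rat_set[of q] by auto

lemma enc_rat_nonempty [simp]: "enc_rat q \<noteq> []"
  by (simp add: enc_rat_eq)

lemma hd_enc_rat [simp]: "hd (enc_rat q) \<noteq> Semicolon"
  by (metis enc_rat_nonempty enc_rat_notin(2) hd_in_set)

lemma enc_rat_int: "enc_rat (of_int a) = (if a < 0 then [Minus] else []) @ enc_nat (nat \<bar>a\<bar>) @ [Slash, One]"
  by (simp add: enc_rat_def)

lemma enc_rat_0 [simp]: "enc_rat 0 = [Zero, Slash, One]"
  using enc_rat_int[of 0] by simp

lemma enc_rat_power: "enc_rat (2 ^ k) = One # replicate k Zero @ [Slash, One]"
  using enc_rat_int[of "2 ^ k"] enc_nat_shift[of 1 k] by (simp add: nat_power_eq)

lemma enc_rat_16: "enc_rat 16 = [One, Zero, Zero, Zero, Zero, Slash, One]"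
  using enc_rat_power[of 4] by (simp add: numeral_eq_Suc)

lemma enc_vec_eq:
  "enc_vec v = concat (map (\<lambda>i. enc_rat (v $ i) @ [Comma]) [0..<dim_vec v]) @ [Semicolon]"
  by (simp add: enc_vec_def list_of_vec_map comp_def)

lemma enc_vec_set: "Hash \<notin> set (enc_vec v)"
  by (auto simp: enc_vec_eq)

lemma enc_vec_hd: "enc_vec v \<noteq> [] \<and> hd (enc_vec v) \<noteq> Hash"
  using enc_vec_set[of v] by (metis append_is_Nil_conv enc_vec_def hd_in_set not_Cons_self2)

lemma dim_le_length_enc_vec: "dim_vec v \<le> length (enc_vec v)"
proof -
  have "length xs \<le> length (concat (map (\<lambda>i. enc_rat (v $ i) @ [Comma]) xs))" for xs
    by (induction xs) auto
  from this[of "[0..<dim_vec v]"] show ?thesis by (simp add: enc_vec_eq)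
qed

section \<open>The output bases and their computation column by column\<close>

definition lift_basis :: "nat \<Rightarrow> nat \<Rightarrow> rat mat \<Rightarrow> rat vec \<Rightarrow> rat \<Rightarrow> rat mat" where
  "lift_basis K N B t d =
     (let n = dim_row B; m = dim_col B in
      mat (n + 1) (n + 1) (\<lambda>(i, j).
        if j = n then (if i = n then d else t $ i)
        else if i = n then 0
        else if j < m then (if i = j then nudge K (B $$ (i, j)) else B $$ (i, j))
        else if i = j then 2 ^ N else 0))"

lemma run_load_column_index:
  assumes "j \<le> length w"
  shows "run w load_column_index (st p (int j) e 0 0 h out) = st p (int j) e (int j) 0 h out"
proof -
  have "run w (while_nonzero (Suc 0) (Move (Suc 0) Go_Left ;; Move 3 Go_Right ;; Move 4 Go_Right))
      (st p (int j) e 0 0 h out) = st p 0 e (int j) (int j) h out"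
    using run_while[OF assms, where s = "\<lambda>k. st p (int j - int k) e (int k) (int k) h out"
      and i = "Suc 0" and A = "{None}"
      and p = "Move (Suc 0) Go_Left ;; Move 3 Go_Right ;; Move 4 Go_Right"]
    by (auto simp: algebra_simps)
  moreover have "run w (while_nonzero 4 (Move 4 Go_Left ;; Move (Suc 0) Go_Right))
      (st p 0 e (int j) (int j) h out) = st p (int j) e (int j) 0 h out"
    using run_while[OF assms, where s = "\<lambda>k. st p (int k) e (int j) (int j - int k) h out"
      and i = 4 and A = "{None}" and p = "Move 4 Go_Left ;; Move (Suc 0) Go_Right"]
    by (auto simp: algebra_simps)
  ultimately show ?thesis by (simp add: load_column_index_def)
qed

lemma run_finish_column:
  assumes "j \<le> n" "n \<le> length w"
  shows "run w finish_column (st p (int j) e (int j - int n) a h out) =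
    st p (int (Suc j)) (e - 1) 0 a h (out @ [Zero, Slash, One, Comma, Semicolon])"
  using run_clear(2)[of "n - j" w p "int j" e a h] assms
  by (simp add: finish_column_def of_nat_diff add_ac)

lemma enc_lift_col:
  assumes "j < dim_row B"
  shows "enc_vec (col (lift_basis K N B t d) j) =
    concat (map (\<lambda>i. enc_rat (lift_basis K N B t d $$ (i, j)) @ [Comma]) [0..<dim_row B]) @
    [Zero, Slash, One, Comma, Semicolon]"
proof -
  let ?M = "lift_basis K N B t d"
  have M: "dim_row ?M = Suc (dim_row B)" "dim_col ?M = Suc (dim_row B)"
    by (simp_all add: lift_basis_def Let_def)
  have "?M $$ (dim_row B, j) = 0" using assms by (simp add: lift_basis_def Let_def)
  then show ?thesis using assms
    by (auto simp: enc_vec_eq M upt_Suc intro!: arg_cong[of _ _ concat])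
qed

lemma run_column:
  assumes w: "w = u @ enc_vec (col B j) @ z" and j: "j < dim_col B" "dim_col B \<le> dim_row B"
  shows "run w (load_column_index ;; until Semicolon entry ;; right ;; finish_column)
      (st (int (length u)) (int j) e 0 0 0 out) =
    st (int (length u + length (enc_vec (col B j)))) (int (Suc j)) (e - 1) 0 0 0
      (out @ enc_vec (col (lift_basis (length w ^ 3) N B t d) j))"
proof -
  let ?n = "dim_row B"
  define M where "M = lift_basis (length w ^ 3) N B t d"
  define f where "f i = enc_rat (B $$ (i, j)) @ [Comma]" for i
  define g where "g i = enc_rat (M $$ (i, j)) @ [Comma]" for i
  have col: "enc_vec (col B j) = concat (map f [0..<?n]) @ [Semicolon]"
    using j by (auto simp: enc_vec_eq f_def intro!: arg_cong[of _ _ concat])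
  have n: "?n \<le> length w" using dim_le_length_enc_vec[of "col B j"] unfolding w by simp
  define S where "S i p = st p (int j) e (int j - int i) 0 0 (out @ concat (map g [0..<i]))" for i p
  have "run w (until Semicolon entry) (S 0 (int (length u))) =
      S (length [0..<?n]) (int (length u + length (concat (map f [0..<?n]))))"
  proof (rule run_until_items[where f = f])
    show "w = u @ concat (map f [0..<?n]) @ Semicolon # z" using w col by simp
    show "f y \<noteq> [] \<and> hd (f y) \<noteq> Semicolon" for y
      by (simp add: f_def)
    show "fst (S i p) 0 = p" for i p by (simp add: S_def)
    fix i u' z' assume i: "i < length [0..<?n]" and w': "w = u' @ f ([0..<?n] ! i) @ z'"
    let ?q = "B $$ (i, j)"
    have w': "w = u' @ enc_rat ?q @ Comma # z'" using w' i by (simp add: f_def)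
    let ?p = "int (length u' + length (enc_rat ?q))"
    have at: "word_at w ?p = Some Comma"
      using word_at_append(1)[of "u' @ enc_rat ?q" "Comma # z'"] w' by simp
    have M: "M $$ (i, j) = (if i = j then nudge (length w ^ 3) ?q else ?q)"
      using i j by (simp add: M_def lift_basis_def Let_def)
    have "run w (Cond 3 {None} (copy_to Comma) nudge_entry) (S i (int (length u'))) =
        st ?p (int j) e (int j - int i) 0 0 (out @ concat (map g [0..<i]) @ enc_rat (M $$ (i, j)))"
      using run_nudge_entry[OF w'] run_copy_to[OF w'] M by (simp add: S_def run_Cond)
    then show "run w entry (S i (int (length u'))) =
        S (Suc i) (int (length u' + length (f ([0..<?n] ! i))))"
      using i at by (simp add: entry_def S_def g_def f_def upt_Suc add_ac diff_diff_eq)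
  qed
  moreover have "length (enc_vec (col B j)) = length (concat (map f [0..<?n])) + 1"
    by (simp add: col)
  moreover have "enc_vec (col M j) = concat (map g [0..<?n]) @ [Zero, Slash, One, Comma, Semicolon]"
    using enc_lift_col[of j B "length w ^ 3" N t d] j by (simp add: M_def g_def[abs_def])
  ultimately show ?thesis
    using run_load_column_index[of j w] run_finish_column[of j ?n w] n j unfolding M_def[symmetric]
    by (simp add: S_def add_ac)
qed

lemma run_columns:
  assumes w: "w = concat (map (\<lambda>j. enc_vec (col B j)) [0..<dim_col B]) @ Hash # z"
    and mn: "dim_col B \<le> dim_row B"
  shows "run w columns (st 0 0 0 0 0 0 out) =
    st (int (length (concat (map (\<lambda>j. enc_vec (col B j)) [0..<dim_col B])))) (int (dim_col B))
      (- int (dim_col B)) 0 0 0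
      (out @ concat (map (\<lambda>j. enc_vec (col (lift_basis (length w ^ 3) N B t d) j)) [0..<dim_col B]))"
proof -
  define f where "f j = enc_vec (col B j)" for j
  define S where "S j p = st p (int j) (- int j) 0 0 0
      (out @ concat (map (\<lambda>j. enc_vec (col (lift_basis (length w ^ 3) N B t d) j)) [0..<j]))" for j p
  have "run w columns (S 0 (int (length ([] :: letter list)))) =
      S (length [0..<dim_col B]) (int (length ([] :: letter list) + length (concat (map f [0..<dim_col B]))))"
    unfolding columns_def
  proof (rule run_until_items[where f = f and S = S])
    show "w = [] @ concat (map f [0..<dim_col B]) @ Hash # z" using w by (simp add: f_def[abs_def])
    show "f y \<noteq> [] \<and> hd (f y) \<noteq> Hash" for y using enc_vec_hd by (simp add: f_def)
    show "fst (S i p) 0 = p" for i p by (simp add: S_def)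
    fix j u' z' assume j: "j < length [0..<dim_col B]" and w': "w = u' @ f ([0..<dim_col B] ! j) @ z'"
    then have w': "w = u' @ enc_vec (col B j) @ z'" by (simp add: f_def)
    show "run w (load_column_index ;; until Semicolon entry ;; right ;; finish_column)
        (S j (int (length u'))) = S (Suc j) (int (length u' + length (f ([0..<dim_col B] ! j))))"
      using run_column[OF w', of "- int j" _ N t d] j mn by (simp add: S_def f_def upt_Suc minus_diff_commute[of "int j"])
  qed
  then show ?thesis by (simp add: S_def f_def[abs_def])
qed

text \<open>Shared by all passes that treat the target entry by entry: counting rows, writing an
  extra column, writing the zero column.\<close>

lemma run_scan_target:
  assumes w: "w = u @ Hash # enc_vec t @ z"
    and S: "\<And>j p. fst (S j p) 0 = p"
    and body: "\<And>j u' z'. j < dim_vec t \<Longrightarrow> w = u' @ (enc_rat (t $ j) @ [Comma]) @ z' \<Longrightarrow>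
      run w body (S j (int (length u'))) =
        S (Suc j) (int (length u' + length (enc_rat (t $ j) @ [Comma])))"
  shows "run w (until Semicolon body) (S 0 (int (length u) + 1)) =
    S (dim_vec t) (int (length u) + int (length (enc_vec t)))"
proof -
  define f where "f i = enc_rat (t $ i) @ [Comma]" for i
  have t: "enc_vec t = concat (map f [0..<dim_vec t]) @ [Semicolon]"
    by (simp add: enc_vec_eq f_def[abs_def])
  have "run w (until Semicolon body) (S 0 (int (length (u @ [Hash])))) =
      S (length [0..<dim_vec t]) (int (length (u @ [Hash]) + length (concat (map f [0..<dim_vec t]))))"
  proof (rule run_until_items[where f = f])
    show "w = (u @ [Hash]) @ concat (map f [0..<dim_vec t]) @ Semicolon # z" using w t by simp
    show "f y \<noteq> [] \<and> hd (f y) \<noteq> Semicolon" for y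
      by (simp add: f_def)
    show "fst (S i p) 0 = p" for i p by (rule S)
    fix i u' z' assume i: "i < length [0..<dim_vec t]" and w': "w = u' @ f ([0..<dim_vec t] ! i) @ z'"
    then show "run w body (S i (int (length u'))) =
        S (Suc i) (int (length u' + length (f ([0..<dim_vec t] ! i))))"
      using body[of i u' z'] by (simp add: f_def)
  qed
  then show ?thesis by (simp add: t add_ac)
qed

lemma run_skip_entry:
  assumes w: "w = u' @ (enc_rat q @ [Comma]) @ z'"
  shows "run w (skip_to Comma) (st (int (length u')) c e r a h out) =
    st (int (length u' + length (enc_rat q))) c e r a h out"
  using run_skip_to[of w u' "enc_rat q" Comma z'] w by simp

lemma run_back_to_Hash:
  assumes w: "w = u @ Hash # enc_vec t @ z"
  shows "run w (back_to Hash) (st (int (length u) + int (length (enc_vec t))) c e r a h out) =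
    st (int (length u)) c e r a h out"
proof -
  let ?v = "concat (map (\<lambda>i. enc_rat (t $ i) @ [Comma]) [0..<dim_vec t])"
  have t: "enc_vec t = ?v @ [Semicolon]" by (rule enc_vec_eq)
  have "Hash \<notin> set ?v" by auto
  then show ?thesis using run_back_to[of w u Hash ?v "Semicolon # z"] w t by (simp add: add_ac)
qed

lemma run_count_rows:
  assumes w: "w = u @ Hash # enc_vec t @ z"
  shows "run w count_rows (st (int (length u)) c e r a h out) =
    st (int (length u)) c (e + int (dim_vec t)) r a h out"
proof -
  define S where "S j p = st p c (e + int j) r a h out" for j p
  have "run w (until Semicolon (skip_to Comma ;; right ;; Move 2 Go_Right)) (S 0 (int (length u) + 1)) =
    S (dim_vec t) (int (length u) + int (length (enc_vec t)))"
    by (rule run_scan_target[OF w]) (simp_all add: S_def run_skip_entry add_ac)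
  then show ?thesis using run_back_to_Hash[OF w] by (simp add: count_rows_def S_def)
qed

lemma run_extra_column:
  assumes w: "w = u @ Hash # enc_vec t @ z" and t: "dim_vec t = dim_row B"
    and j: "dim_col B \<le> j" "j < dim_row B"
  shows "run w (load_column_index ;; right ;; until Semicolon extra_entry ;; back_to Hash ;; finish_column)
      (st (int (length u)) (int j) e 0 0 0 out) =
    st (int (length u)) (int (Suc j)) (e - 1) 0 0 0
      (out @ enc_vec (col (lift_basis K (length w ^ 5) B t' d) j))"
proof -
  let ?n = "dim_row B"
  define M where "M = lift_basis K (length w ^ 5) B t' d"
  define g where "g i = enc_rat (M $$ (i, j)) @ [Comma]" for i
  have n: "?n \<le> length w" using dim_le_length_enc_vec[of t] t unfolding w by simp
  define S where "S i p = st p (int j) e (int j - int i) 0 0 (out @ concat (map g [0..<i]))" for i p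
  have M: "M $$ (i, j) = (if i = j then 2 ^ (length w ^ 5) else 0)" if "i < ?n" for i
    using that j by (simp add: M_def lift_basis_def Let_def)
  have "run w (until Semicolon extra_entry) (S 0 (int (length u) + 1)) =
    S (dim_vec t) (int (length u) + int (length (enc_vec t)))"
  proof (rule run_scan_target[OF w])
    show "fst (S i p) 0 = p" for i p by (simp add: S_def)
    fix i u' z' assume i: "i < dim_vec t" and w': "w = u' @ (enc_rat (t $ i) @ [Comma]) @ z'"
    show "run w extra_entry (S i (int (length u'))) =
        S (Suc i) (int (length u' + length (enc_rat (t $ i) @ [Comma])))"
      using M[of i] i t
      by (simp add: extra_entry_def S_def run_Cond run_skip_entry[OF w'] g_def enc_rat_power upt_Suc add_ac diff_diff_eq)
  qed
  moreover have "enc_vec (col M j) = concat (map g [0..<?n]) @ [Zero, Slash, One, Comma, Semicolon]"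
    using enc_lift_col[of j B K "length w ^ 5" t' d] j by (simp add: M_def g_def[abs_def])
  ultimately show ?thesis
    using run_load_column_index[of j w] run_finish_column[of j ?n w] n j run_back_to_Hash[OF w] t
    unfolding M_def[symmetric] by (simp add: S_def)
qed

text \<open>The first \<open>n\<close> columns of a lifted basis do not involve the last column, so
  \<open>t'\<close> is arbitrary and the statement serves both output bases.\<close>

lemma run_common_basis:
  assumes w: "w = enc_basis B @ enc_vec t @ z" and t: "dim_vec t = dim_row B"
    and mn: "dim_col B \<le> dim_row B"
  shows "run w common_basis (st 0 0 0 0 0 0 out) =
    st (int (length (enc_basis B)) - 1) (int (dim_row B)) 0 0 0 0
      (out @ concat (map (\<lambda>j. enc_vec (col (lift_basis (length w ^ 3) (length w ^ 5) B t' d) j))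
        [0..<dim_row B]))"
proof -
  let ?m = "dim_col B" and ?n = "dim_row B"
  define u where "u = concat (map (\<lambda>j. enc_vec (col B j)) [0..<?m])"
  define g where "g j = enc_vec (col (lift_basis (length w ^ 3) (length w ^ 5) B t' d) j)" for j
  have basis: "enc_basis B = u @ [Hash]" by (simp add: enc_basis_def u_def cols_def comp_def)
  have w': "w = u @ Hash # enc_vec t @ z" using w basis by simp
  have n: "?n \<le> length w" using dim_le_length_enc_vec[of t] t unfolding w by simp
  define s where "s j = st (int (length u)) (int (?m + j)) (int (?n - ?m) - int j) 0 0 0
      (out @ concat (map g [0..<?m]) @ concat (map g [?m..<?m + j]))" for j
  have "run w extra_columns (s 0) = s (?n - ?m)"
    unfolding extra_columns_def
  proof (rule run_while)
    fix j assume j: "j < ?n - ?m"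
    then show "head_cell w 2 (fst (s j) 2) \<in> {None} \<and>
        run w (load_column_index ;; right ;; until Semicolon extra_entry ;; back_to Hash ;; finish_column)
          (s j) = s (Suc j)"
      using run_extra_column[OF w' t, of "?m + j" _ _ "length w ^ 3" t' d]
      by (simp add: s_def g_def upt_Suc algebra_simps)
  qed (use n in \<open>simp_all add: s_def\<close>)
  moreover have "concat (map g [0..<?m]) @ concat (map g [?m..<?n]) = concat (map g [0..<?n])"
    using mn by (metis concat_append map_append upt_add_eq_append zero_le le_add_diff_inverse add_0)
  ultimately have 3: "run w extra_columns (s 0) =
      st (int (length u)) (int ?n) 0 0 0 0 (out @ concat (map g [0..<?n]))"
    using mn by (simp add: s_def)
  have "run w columns (st 0 0 0 0 0 0 out) =
      st (int (length u)) (int ?m) (- int ?m) 0 0 0 (out @ concat (map g [0..<?m]))"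
    unfolding u_def g_def by (rule run_columns) (use w' mn in \<open>simp_all add: u_def\<close>)
  moreover have "run w count_rows (st (int (length u)) (int ?m) (- int ?m) 0 0 0 (out @ concat (map g [0..<?m]))) = s 0"
    using run_count_rows[OF w'] t mn by (simp add: s_def)
  ultimately show ?thesis using 3 by (simp add: common_basis_def basis g_def[abs_def])
qed

lemma run_last_column:
  assumes w: "w = u @ Hash # enc_vec t @ z"
    and p: "run w p (st (int (length u) + 1) c e r a h out) =
      st (int (length u) + int (length (enc_vec t))) c e r a h out'"
  shows "run w (last_column p) (st (int (length u)) c e r a h out) =
    st (int (length w)) c e r a h (out' @ z @ [Comma, Semicolon, Hash])"
proof -
  define v where "v = u @ Hash # enc_vec t"
  define s where "s j = st (int (length v) + int j) c e r a h (out' @ take j z)" for j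
  have w: "w = v @ z" using w by (simp add: v_def)
  have at: "word_at w (int (length v) + int j) = (if j < length z then Some (z ! j) else None)" for j
    unfolding w by (simp only: word_at_append(2)) (simp add: word_at_def)
  have "run w (while 0 (- {None}) (Copy ;; right)) (s 0) = s (length z)"
  proof (rule run_while)
    fix j assume j: "j < length z"
    then show "head_cell w 0 (fst (s j) 0) \<in> - {None} \<and> run w (Copy ;; right) (s j) = s (Suc j)"
      using at[of j] by (simp add: s_def take_Suc_conv_app_nth add_ac)
  qed (use at[of "length z"] w in \<open>simp_all add: s_def\<close>)
  moreover have "s 0 = st (int (length u) + int (length (enc_vec t)) + 1) c e r a h out'"
    by (simp add: s_def v_def add_ac)
  ultimately show ?thesis using p by (simp add: last_column_def s_def w)
qed

lemma run_restart:
  assumes "n \<le> length w"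
  shows "run w restart (st (int (length w)) (int n) e r a h out) = st 0 0 e r a h out"
proof -
  define s where "s j = st (int (length w) - 1 - int j) (int n) e r a h out" for j
  have "run w (while 0 (- {None}) left) (s 0) = s (length w)"
    by (rule run_while) (auto simp: s_def word_at_def)
  then show ?thesis using run_clear(3)[OF assms] by (simp add: restart_def s_def)
qed

lemma enc_lift_basis:
  assumes "dim_vec t = dim_row B"
  shows "enc_basis (lift_basis K N B t d) =
    concat (map (\<lambda>j. enc_vec (col (lift_basis K N B t d) j)) [0..<dim_row B]) @
    concat (map (\<lambda>i. enc_rat (t $ i) @ [Comma]) [0..<dim_row B]) @ enc_rat d @
    [Comma, Semicolon, Hash]"
proof -
  let ?M = "lift_basis K N B t d" and ?n = "dim_row B"
  have M: "dim_row ?M = Suc ?n" "dim_col ?M = Suc ?n" by (simp_all add: lift_basis_def Let_def)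
  have "?M $$ (i, ?n) = (if i = ?n then d else t $ i)" if "i < Suc ?n" for i
    using that by (simp add: lift_basis_def Let_def)
  then have "enc_vec (col ?M ?n) =
      concat (map (\<lambda>i. enc_rat (t $ i) @ [Comma]) [0..<?n]) @ enc_rat d @ [Comma, Semicolon]"
    using M by (auto simp: enc_vec_eq upt_Suc intro!: arg_cong[of _ _ concat])
  then show ?thesis by (simp add: enc_basis_def cols_def comp_def M upt_Suc)
qed

theorem reduction_correct:
  assumes t: "dim_vec t = dim_row B" and mn: "dim_col B \<le> dim_row B"
    and w: "w = enc_cvp B t d"
  shows "program_fun reduction w =
    enc_ldp (lift_basis (length w ^ 3) (length w ^ 5) B (0\<^sub>v (dim_row B)) d)
      (lift_basis (length w ^ 3) (length w ^ 5) B t d) 16"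
proof -
  let ?n = "dim_row B"
  let ?M = "\<lambda>t. lift_basis (length w ^ 3) (length w ^ 5) B t d"
  define u where "u = butlast (enc_basis B)"
  have basis: "enc_basis B = u @ [Hash]" by (simp add: u_def enc_basis_def)
  have w1: "w = enc_basis B @ enc_vec t @ enc_rat d" using w by (simp add: enc_cvp_def)
  have w2: "w = u @ Hash # enc_vec t @ enc_rat d" using w1 basis by simp
  have n: "?n \<le> length w" using dim_le_length_enc_vec[of t] t unfolding w1 by simp
  define g where "g t' = concat (map (\<lambda>j. enc_vec (col (?M t') j)) [0..<?n])" for t'
  define e where "e t' = concat (map (\<lambda>i. enc_rat (t' $ i) @ [Comma]) [0..<?n])" for t'
  have common: "run w common_basis (st 0 0 0 0 0 0 out) =
      st (int (length u)) (int ?n) 0 0 0 0 (out @ g t')" for out t'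
    using run_common_basis[OF w1 t mn] by (simp add: g_def basis)
  have zero: "run w (last_column
        (until Semicolon (emit_list [Zero, Slash, One, Comma] ;; skip_to Comma ;; right)))
        (st (int (length u)) (int ?n) 0 0 0 0 out) =
      st (int (length w)) (int ?n) 0 0 0 0 (out @ e (0\<^sub>v ?n) @ enc_rat d @ [Comma, Semicolon, Hash])" for out
  proof -
    define S where "S j p = st p (int ?n) 0 0 0 0
        (out @ concat (map (\<lambda>i. [Zero, Slash, One, Comma]) [0..<j]))" for j p
    have "run w (until Semicolon (emit_list [Zero, Slash, One, Comma] ;; skip_to Comma ;; right))
        (S 0 (int (length u) + 1)) = S (dim_vec t) (int (length u) + int (length (enc_vec t)))"
      by (rule run_scan_target[OF w2])
        (simp_all add: S_def run_skip_entry upt_Suc add_ac del: emit_list.simps)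
    moreover have "e (0\<^sub>v ?n) = concat (map (\<lambda>i. [Zero, Slash, One, Comma]) [0..<?n])"
      by (auto simp: e_def intro!: arg_cong[of _ _ concat])
    ultimately show ?thesis using run_last_column[OF w2] t by (simp add: S_def)
  qed
  have target: "run w (last_column (copy_to Semicolon)) (st (int (length u)) (int ?n) 0 0 0 0 out) =
      st (int (length w)) (int ?n) 0 0 0 0 (out @ e t @ enc_rat d @ [Comma, Semicolon, Hash])" for out
  proof -
    have et: "enc_vec t = e t @ [Semicolon]" by (simp add: enc_vec_eq e_def t)
    have "Semicolon \<notin> set (e t)" by (auto simp: e_def)
    then have "run w (copy_to Semicolon) (st (int (length u) + 1) (int ?n) 0 0 0 0 out) =
      st (int (length u) + int (length (enc_vec t))) (int ?n) 0 0 0 0 (out @ e t)"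
      using run_copy_to[of w "u @ [Hash]" "e t" Semicolon "enc_rat d"] w2 et by (simp add: add_ac)
    then show ?thesis using run_last_column[OF w2] by simp
  qed
  \<comment> \<open>Both are the output of one and the same run, so no comparison of matrices is
    needed.\<close>
  have g0: "g (0\<^sub>v ?n) = g t"
    using common[of "[]" "0\<^sub>v ?n"] common[of "[]" t] by (simp add: st_def)
  have init: "(\<lambda>_. 0, []) = st 0 0 0 0 0 0 []" by (auto simp: st_def)
  have "run w reduction (\<lambda>_. 0, []) = st (int (length w)) (int ?n) 0 0 0 0
     (g (0\<^sub>v ?n) @ e (0\<^sub>v ?n) @ enc_rat d @ [Comma, Semicolon, Hash] @
      g t @ e t @ enc_rat d @ [Comma, Semicolon, Hash] @ enc_rat 16)"
    unfolding init reduction_def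
    using g0 by (simp add: common[of _ "0\<^sub>v ?n"] zero run_restart[OF n] target enc_rat_16
      del: emit_list.simps)
  then show ?thesis
    using enc_lift_basis[of "0\<^sub>v ?n" B "length w ^ 3" "length w ^ 5" d]
      enc_lift_basis[OF t, of "length w ^ 3" "length w ^ 5" d]
    by (simp add: program_fun_def st_def enc_ldp_def g_def e_def)
qed


section \<open>Euclidean norm and operator norm\<close>

lemma vnorm_L2_set: "vnorm v = L2_set (($) v) {0..<dim_vec v}"
  by (simp add: vnorm_def L2_set_def scalar_prod_def power2_eq_square)

lemma vnorm_nonneg [simp]: "0 \<le> vnorm v"
  by (simp add: vnorm_L2_set)

lemma vnorm_zero [simp]: "vnorm (0\<^sub>v n) = 0"
  by (simp add: vnorm_L2_set L2_set_def)

lemma vnorm_eq_0: "vnorm v = 0 \<longleftrightarrow> v = 0\<^sub>v (dim_vec v)"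
proof
  assume "vnorm v = 0"
  then show "v = 0\<^sub>v (dim_vec v)" by (intro eq_vecI) (auto simp: vnorm_L2_set L2_set_eq_0_iff)
next
  assume "v = 0\<^sub>v (dim_vec v)"
  then show "vnorm v = 0" by (metis vnorm_zero)
qed

lemma vnorm_triangle:
  assumes "dim_vec u = dim_vec v"
  shows "vnorm (u + v) \<le> vnorm u + vnorm v"
proof -
  have "vnorm (u + v) = L2_set (\<lambda>i. u $ i + v $ i) {0..<dim_vec v}"
    unfolding vnorm_L2_set by (rule L2_set_cong) auto
  then show ?thesis using L2_set_triangle_ineq[of "($) u" "($) v" "{0..<dim_vec v}"] assms
    by (simp add: vnorm_L2_set)
qed

lemma vnorm_smult: "vnorm (c \<cdot>\<^sub>v v) = \<bar>c\<bar> * vnorm v"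
proof -
  have "(c \<cdot>\<^sub>v v) \<bullet> (c \<cdot>\<^sub>v v) = c\<^sup>2 * (v \<bullet> v)"
    by (simp add: scalar_prod_def sum_distrib_left power2_eq_square algebra_simps)
  then show ?thesis by (simp add: vnorm_def real_sqrt_mult)
qed

lemma abs_le_vnorm:
  assumes "i < dim_vec v"
  shows "\<bar>v $ i\<bar> \<le> vnorm v"
proof -
  have "\<bar>v $ i\<bar> \<le> L2_set (\<lambda>i. \<bar>v $ i\<bar>) {0..<dim_vec v}"
    by (rule member_le_L2_set) (use assms in auto)
  then show ?thesis by (simp add: vnorm_L2_set L2_set_def)
qed

lemma vnorm_le_sum: "vnorm v \<le> (\<Sum>i<dim_vec v. \<bar>v $ i\<bar>)"
  using L2_set_le_sum_abs[of "($) v" "{0..<dim_vec v}"]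
  by (simp add: vnorm_L2_set lessThan_atLeast0)

lemma vnorm_unit [simp]: "i < n \<Longrightarrow> vnorm (unit_vec n i) = 1"
  by (simp add: vnorm_def)

lemma vnorm_le_append:
  assumes "dim_vec u \<le> dim_vec v" "\<And>i. i < dim_vec u \<Longrightarrow> u $ i = v $ i"
  shows "vnorm u \<le> vnorm v"
proof -
  have "u \<bullet> u = (\<Sum>i\<in>{0..<dim_vec u}. v $ i * v $ i)"
    unfolding scalar_prod_def by (rule sum.cong) (use assms in auto)
  also have "\<dots> \<le> v \<bullet> v"
    unfolding scalar_prod_def by (rule sum_mono2) (use assms in auto)
  finally show ?thesis by (simp add: vnorm_def)
qed

lemma index_mult_mat_vec_sum:
  assumes "A \<in> carrier_mat n m" "x \<in> carrier_vec m" "i < n"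
  shows "(A *\<^sub>v x) $ i = (\<Sum>j<m. A $$ (i, j) * x $ j)"
  using assms by (simp add: scalar_prod_def lessThan_atLeast0)

text \<open>The supremum in \<open>op_norm\<close> says something only for a bounded set. The sum of
  the absolute values of all entries is a bound, as no coordinate of a unit vector exceeds
  1.\<close>

lemma op_norm_bdd:
  assumes A: "A \<in> carrier_mat n n"
  shows "bdd_above {vnorm (A *\<^sub>v x) | x. x \<in> carrier_vec (dim_col A) \<and> vnorm x = 1}"
proof (rule bdd_aboveI)
  fix y assume "y \<in> {vnorm (A *\<^sub>v x) | x. x \<in> carrier_vec (dim_col A) \<and> vnorm x = 1}"
  then obtain x where x: "x \<in> carrier_vec n" "vnorm x = 1" and y: "y = vnorm (A *\<^sub>v x)"
    using A by auto
  have "\<bar>(A *\<^sub>v x) $ i\<bar> \<le> (\<Sum>j<n. \<bar>A $$ (i, j)\<bar>)" if i: "i < n" for i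
  proof -
    have "\<bar>(A *\<^sub>v x) $ i\<bar> \<le> (\<Sum>j<n. \<bar>A $$ (i, j) * x $ j\<bar>)"
      unfolding index_mult_mat_vec_sum[OF A x(1) i] by (rule sum_abs)
    also have "\<dots> \<le> (\<Sum>j<n. \<bar>A $$ (i, j)\<bar>)"
    proof (rule sum_mono)
      fix j assume "j \<in> {..<n}"
      then have "\<bar>x $ j\<bar> \<le> 1" using abs_le_vnorm[of j x] x by auto
      then show "\<bar>A $$ (i, j) * x $ j\<bar> \<le> \<bar>A $$ (i, j)\<bar>"
        by (simp add: abs_mult mult_left_le)
    qed
    finally show ?thesis .
  qed
  then have "(\<Sum>i<n. \<bar>(A *\<^sub>v x) $ i\<bar>) \<le> (\<Sum>i<n. \<Sum>j<n. \<bar>A $$ (i, j)\<bar>)"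
    by (intro sum_mono) auto
  then show "y \<le> (\<Sum>i<n. \<Sum>j<n. \<bar>A $$ (i, j)\<bar>)"
    unfolding y using vnorm_le_sum[of "A *\<^sub>v x"] A by simp
qed

lemma vnorm_mult_le:
  assumes A: "A \<in> carrier_mat n n" and x: "x \<in> carrier_vec n"
  shows "vnorm (A *\<^sub>v x) \<le> op_norm A * vnorm x"
proof (cases "vnorm x = 0")
  case True
  then have "x = 0\<^sub>v n" using x by (simp add: vnorm_eq_0)
  moreover have "A *\<^sub>v 0\<^sub>v n = 0\<^sub>v n" using A by (auto simp: scalar_prod_def)
  ultimately show ?thesis by simp
next
  case False
  then have pos: "vnorm x > 0" using vnorm_nonneg[of x] by linarith
  let ?y = "(1 / vnorm x) \<cdot>\<^sub>v x"
  have "vnorm (A *\<^sub>v ?y) \<le> op_norm A"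
    unfolding op_norm_def
    by (rule cSup_upper[OF _ op_norm_bdd[OF A]]) (use A x pos in \<open>auto simp: vnorm_smult\<close>)
  moreover have "A *\<^sub>v ?y = (1 / vnorm x) \<cdot>\<^sub>v (A *\<^sub>v x)"
    using A x by (rule mult_mat_vec)
  ultimately show ?thesis using pos by (simp add: vnorm_smult field_simps)
qed

lemma op_norm_le:
  assumes A: "A \<in> carrier_mat n n" and n: "0 < n"
    and le: "\<And>x. x \<in> carrier_vec n \<Longrightarrow> vnorm x = 1 \<Longrightarrow> vnorm (A *\<^sub>v x) \<le> c"
  shows "op_norm A \<le> c"
  unfolding op_norm_def
proof (rule cSup_least)
  show "{vnorm (A *\<^sub>v x) | x. x \<in> carrier_vec (dim_col A) \<and> vnorm x = 1} \<noteq> {}"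
    using A n vnorm_unit[OF n] by (auto intro!: exI[of _ "unit_vec n 0"])
qed (use A le in auto)

lemma op_norm_nonneg:
  assumes A: "A \<in> carrier_mat n n" and n: "0 < n"
  shows "0 \<le> op_norm A"
  using vnorm_mult_le[OF A, of "unit_vec n 0"] vnorm_nonneg[of "A *\<^sub>v unit_vec n 0"] n
  by (simp del: vnorm_nonneg)

section \<open>Determinant bounds\<close>

text \<open>Expanding the product of the column sums gives one term for every function on the
  indices; the Leibniz formula uses only the permutations among them.\<close>

lemma abs_det_le:
  fixes A :: "real mat"
  assumes A: "A \<in> carrier_mat n n"
  shows "\<bar>det A\<bar> \<le> (\<Prod>j<n. \<Sum>i<n. \<bar>A $$ (i, j)\<bar>)"
proof -
  let ?P = "{p. p permutes {0..<n}}"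
  have fin: "finite ?P" by (simp add: finite_permutations)
  have "\<bar>det A\<bar> \<le> (\<Sum>p\<in>?P. \<bar>signof p * (\<Prod>j<n. A $$ (p j, j))\<bar>)"
    unfolding det_col[OF A] by (rule sum_abs)
  also have "\<dots> = (\<Sum>p\<in>?P. \<Prod>j<n. \<bar>A $$ (p j, j)\<bar>)"
    by (rule sum.cong) (auto simp: abs_mult abs_prod sign_def)
  also have "\<dots> = (\<Sum>f\<in>(\<lambda>p. restrict p {..<n}) ` ?P. \<Prod>j<n. \<bar>A $$ (f j, j)\<bar>)"
  proof (subst sum.reindex)
    show "inj_on (\<lambda>p. restrict p {..<n}) ?P"
    proof (rule inj_onI)
      fix p q assume pq: "p \<in> ?P" "q \<in> ?P" "restrict p {..<n} = restrict q {..<n}"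
      show "p = q"
      proof
        fix x
        show "p x = q x"
        proof (cases "x < n")
          case True
          then show ?thesis using fun_cong[OF pq(3), of x] by simp
        next
          case False
          then show ?thesis using pq(1,2) by (simp add: permutes_def)
        qed
      qed
    qed
  qed (simp add: comp_def)
  also have "\<dots> \<le> (\<Sum>f\<in>{..<n} \<rightarrow>\<^sub>E {..<n}. \<Prod>j<n. \<bar>A $$ (f j, j)\<bar>)"
  proof (rule sum_mono2)
    show "(\<lambda>p. restrict p {..<n}) ` ?P \<subseteq> {..<n} \<rightarrow>\<^sub>E {..<n}"
    proof
      fix f assume "f \<in> (\<lambda>p. restrict p {..<n}) ` ?P"
      then obtain p where p: "p permutes {0..<n}" and f: "f = restrict p {..<n}" by auto
      then show "f \<in> {..<n} \<rightarrow>\<^sub>E {..<n}"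
        using permutes_in_image[OF p] by (auto simp: PiE_def)
    qed
  qed (auto intro: finite_PiE prod_nonneg)
  also have "\<dots> = (\<Prod>j<n. \<Sum>i<n. \<bar>A $$ (i, j)\<bar>)"
    by (rule prod_sum_PiE[symmetric]) auto
  finally show ?thesis .
qed

lemma mat_entry_unit:
  fixes A :: "real mat"
  assumes "A \<in> carrier_mat n n" "i < n" "j < n"
  shows "A $$ (i, j) = (A *\<^sub>v unit_vec n j) $ i"
  using assms by simp

text \<open>If the norm were \<open>s < 1\<close>, the entries of \<open>S ^\<^sub>m k\<close> would
  be at most \<open>s ^ k\<close> and its determinant would tend to 0, although its absolute value
  is always 1. Passing to powers absorbs the factor \<open>n ^ n\<close> that the crude determinant
  bound loses, so neither singular values nor Hadamard's inequality are involved.\<close>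

lemma op_norm_ge_1_of_det:
  fixes S :: "real mat"
  assumes S: "S \<in> carrier_mat n n" and n: "0 < n" and det: "\<bar>det S\<bar> = 1"
  shows "1 \<le> op_norm S"
proof (rule ccontr)
  assume "\<not> 1 \<le> op_norm S"
  then have s: "op_norm S < 1" "0 \<le> op_norm S" using op_norm_nonneg[OF S n] by auto
  let ?s = "op_norm S"
  have pow: "vnorm ((S ^\<^sub>m k) *\<^sub>v x) \<le> ?s ^ k * vnorm x" if "x \<in> carrier_vec n" for k x
    using that
  proof (induction k arbitrary: x)
    case (Suc k)
    have "(S ^\<^sub>m Suc k) *\<^sub>v x = (S ^\<^sub>m k) *\<^sub>v (S *\<^sub>v x)"
      using S Suc.prems by (simp add: assoc_mult_mat_vec[of _ n n _ n])
    also have "vnorm \<dots> \<le> ?s ^ k * vnorm (S *\<^sub>v x)" using Suc S by simp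
    also have "\<dots> \<le> ?s ^ k * (?s * vnorm x)"
      using vnorm_mult_le[OF S Suc.prems] s by (intro mult_left_mono) auto
    finally show ?case by (simp add: algebra_simps)
  qed (use S in simp)
  have det_pow: "\<bar>det (S ^\<^sub>m k)\<bar> = 1" for k
  proof (induction k)
    case (Suc k)
    have "det (S ^\<^sub>m Suc k) = det (S ^\<^sub>m k) * det S" using S by (simp add: det_mult[of _ n])
    then show ?case using Suc det by (simp add: abs_mult)
  qed (use S in simp)
  \<comment> \<open>Every column sum of the \<open>k\<close>-th power is then below 1.\<close>
  obtain k where k: "?s ^ k < 1 / real n"
    using real_arch_pow_inv[of "1 / real n" ?s] s n by auto
  have Sk: "S ^\<^sub>m k \<in> carrier_mat n n" using S by simp
  have entry: "\<bar>(S ^\<^sub>m k) $$ (i, j)\<bar> \<le> ?s ^ k" if "i < n" "j < n" for i j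
  proof -
    have "(S ^\<^sub>m k) $$ (i, j) = ((S ^\<^sub>m k) *\<^sub>v unit_vec n j) $ i"
      by (rule mat_entry_unit[OF Sk that])
    also have "\<bar>\<dots>\<bar> \<le> vnorm ((S ^\<^sub>m k) *\<^sub>v unit_vec n j)"
      by (rule abs_le_vnorm) (use S that in simp)
    also have "\<dots> \<le> ?s ^ k" using pow[of "unit_vec n j" k] that by simp
    finally show ?thesis .
  qed
  have "1 = \<bar>det (S ^\<^sub>m k)\<bar>" by (simp add: det_pow)
  also have "\<dots> \<le> (\<Prod>j<n. \<Sum>i<n. \<bar>(S ^\<^sub>m k) $$ (i, j)\<bar>)" by (rule abs_det_le[OF Sk])
  also have "\<dots> \<le> (\<Prod>j<n. \<Sum>i<n. ?s ^ k)"
    by (intro prod_mono conjI sum_nonneg sum_mono) (auto intro: entry)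
  also have "\<dots> = (real n * ?s ^ k) ^ n" by simp
  also have "\<dots> < 1" using k n s by (intro power_less_one_iff[THEN iffD2]) (auto simp: field_simps)
  finally show False by simp
qed

text \<open>\<open>D ^ m * det A\<close> is a nonzero integer, so the denominator in Cramer's rule
  is at least \<open>1 / D ^ m\<close> in absolute value; the numerator is bounded by its column
  sums.\<close>

lemma cramer_bound:
  fixes A :: "real mat" and D :: nat
  assumes A: "A \<in> carrier_mat m m" and det: "det A \<noteq> 0" and D: "0 < D"
    and int: "\<And>i j. i < m \<Longrightarrow> j < m \<Longrightarrow> real D * A $$ (i, j) \<in> \<int>"
    and E: "1 \<le> E" "\<And>i j. i < m \<Longrightarrow> j < m \<Longrightarrow> \<bar>A $$ (i, j)\<bar> \<le> E"
    and x: "x \<in> carrier_vec m" and Y: "\<And>i. i < m \<Longrightarrow> \<bar>(A *\<^sub>v x) $ i\<bar> \<le> Y"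
    and k: "k < m"
  shows "\<bar>x $ k\<bar> \<le> real D ^ m * (real m * E) ^ m * Y"
proof -
  have Y0: "0 \<le> Y" using Y[OF k] by linarith
  define Z where "Z = mat m m (\<lambda>(i, j). \<lfloor>real D * A $$ (i, j)\<rfloor>)"
  have "map_mat real_of_int Z = real D \<cdot>\<^sub>m A"
    using A int by (intro eq_matI) (auto simp: Z_def of_int_floor_cancel)
  then have "real_of_int (det Z) = det (real D \<cdot>\<^sub>m A)" by (metis of_int_hom.hom_det)
  also have "\<dots> = real D ^ m * det A" using A by simp
  finally have Zdet: "real_of_int (det Z) = real D ^ m * det A" .
  then have "det Z \<noteq> 0" using det D by auto
  then have "1 \<le> \<bar>real_of_int (det Z)\<bar>" by linarith
  then have det_ge: "1 \<le> real D ^ m * \<bar>det A\<bar>" by (simp add: Zdet abs_mult)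
  let ?R = "replace_col A (A *\<^sub>v x) k"
  have R: "?R \<in> carrier_mat m m" using A by (simp add: replace_col_def)
  have "\<bar>x $ k * det A\<bar> = \<bar>det ?R\<bar>" using cramer_lemma_mat[OF A x k] by simp
  also have "\<dots> \<le> (\<Prod>j<m. \<Sum>i<m. \<bar>?R $$ (i, j)\<bar>)" by (rule abs_det_le[OF R])
  \<comment> \<open>The replaced column has entries up to \<open>Y\<close>. The weaker bound
    \<open>E * Y\<close> gives every column the same factor \<open>m * E\<close>.\<close>
  also have "\<dots> \<le> (\<Prod>j<m. if j = k then real m * E * Y else real m * E)"
  proof (rule prod_mono, intro conjI sum_nonneg)
    fix j assume j: "j \<in> {..<m}"
    have "(\<Sum>i<m. \<bar>?R $$ (i, j)\<bar>) \<le> (\<Sum>i<m. if j = k then E * Y else E)"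
    proof (rule sum_mono)
      fix i assume i: "i \<in> {..<m}"
      have "Y \<le> E * Y" using E Y0 by (simp add: mult_le_cancel_right1)
      then show "\<bar>?R $$ (i, j)\<bar> \<le> (if j = k then E * Y else E)"
        using i j A E(2)[of i j] Y[of i] by (auto simp: replace_col_def)
    qed
    then show "(\<Sum>i<m. \<bar>?R $$ (i, j)\<bar>) \<le> (if j = k then real m * E * Y else real m * E)"
      by (simp split: if_splits)
  qed simp
  also have "\<dots> = real m * E * Y * (\<Prod>j\<in>{..<m} - {k}. real m * E)"
    using k by (subst prod.remove[of _ k]) auto
  also have "\<dots> = (real m * E) ^ m * Y"
    using k by (simp add: card_Diff_singleton_if power_eq_if)
  finally have "\<bar>x $ k\<bar> * \<bar>det A\<bar> \<le> (real m * E) ^ m * Y" by (simp add: abs_mult)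
  then have "real D ^ m * (\<bar>x $ k\<bar> * \<bar>det A\<bar>) \<le> real D ^ m * ((real m * E) ^ m * Y)"
    by (rule mult_left_mono) simp
  moreover have "\<bar>x $ k\<bar> * 1 \<le> \<bar>x $ k\<bar> * (real D ^ m * \<bar>det A\<bar>)"
    using det_ge by (intro mult_left_mono) auto
  ultimately show ?thesis by (simp add: algebra_simps)
qed

text \<open>After scaling row \<open>i\<close> by \<open>2\<^bsup>e i\<^esup> D\<close> the matrix is integral and congruent modulo \<open>2\<^sup>K\<close> to a
  diagonal matrix with entries \<open>\<plusminus>D\<close>, so that its determinant is congruent to \<open>\<plusminus>D\<^sup>m\<close>.\<close>

lemma det_perturbed_diagonal_neq_0:
  fixes A :: "real mat" and b :: "nat \<Rightarrow> nat \<Rightarrow> real" and D :: nat and \<sigma> :: "nat \<Rightarrow> int"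
  assumes A: "A \<in> carrier_mat m m" and D: "0 < D" "D ^ m < 2 ^ K"
    and entries: "\<And>i j. i < m \<Longrightarrow> j < m \<Longrightarrow>
      A $$ (i, j) = b i j + (if i = j then real_of_int (\<sigma> i) / 2 ^ e i else 0)"
    and int: "\<And>i j. i < m \<Longrightarrow> j < m \<Longrightarrow> real D * b i j \<in> \<int>"
    and \<sigma>: "\<And>i. \<bar>\<sigma> i\<bar> = 1" and e: "\<And>i. i < m \<Longrightarrow> K \<le> e i"
  shows "det A \<noteq> 0"
proof
  assume "det A = 0"
  define Z where "Z = mat m m (\<lambda>(i, j). 2 ^ e i * \<lfloor>real D * b i j\<rfloor> + (if i = j then \<sigma> i * int D else 0))"
  define W where "W = mat m m (\<lambda>(i, j). if i = j then \<sigma> i * int D else 0)"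
  let ?P = "{p. p permutes {0..<m}}"
  have perm: "p i < m" if "p \<in> ?P" "i < m" for p i
    using that permutes_in_image[of p "{0..<m}" i] by simp
  have Z: "Z \<in> carrier_mat m m" and W: "W \<in> carrier_mat m m" by (simp_all add: Z_def W_def)
  have Zr: "map_mat real_of_int Z \<in> carrier_mat m m" using Z by simp
  have scaled: "map_mat real_of_int Z $$ (i, j) = (2 ^ e i * real D) * A $$ (i, j)"
    if "i < m" "j < m" for i j
    using that int[OF that] entries[OF that] by (auto simp: Z_def of_int_floor_cancel field_simps)
  have "real_of_int (det Z) = det (map_mat real_of_int Z)" by simp
  also have "\<dots> = (\<Sum>p\<in>?P. signof p * (\<Prod>i = 0..<m. (2 ^ e i * real D) * A $$ (i, p i)))"
    unfolding det_def'[OF Zr]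
  proof (rule sum.cong[OF refl])
    fix p assume p: "p \<in> ?P"
    have "(\<Prod>i = 0..<m. map_mat real_of_int Z $$ (i, p i)) =
        (\<Prod>i = 0..<m. (2 ^ e i * real D) * A $$ (i, p i))"
    proof (rule prod.cong[OF refl])
      fix i assume "i \<in> {0..<m}"
      then have "i < m" by simp
      then show "map_mat real_of_int Z $$ (i, p i) = (2 ^ e i * real D) * A $$ (i, p i)"
        using scaled[of i "p i"] perm[OF p] by simp
    qed
    then show "signof p * (\<Prod>i = 0..<m. map_mat real_of_int Z $$ (i, p i)) =
        signof p * (\<Prod>i = 0..<m. (2 ^ e i * real D) * A $$ (i, p i))"
      by (rule arg_cong)
  qed
  also have "\<dots> = (\<Prod>i = 0..<m. 2 ^ e i * real D) * det A"
    unfolding det_def'[OF A] by (simp only: prod.distrib sum_distrib_left mult.left_commute)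
  finally have "det Z = 0" using \<open>det A = 0\<close> by simp
  have cong: "(2::int) ^ K dvd Z $$ (i, j) - W $$ (i, j)" if "i < m" "j < m" for i j
    using that le_imp_power_dvd[OF e[OF that(1)], of "2::int"] by (simp add: Z_def W_def)
  have prod_dvd: "c dvd (\<Prod>i\<in>I. f i) - (\<Prod>i\<in>I. g i)"
    if "finite I" "\<And>i. i \<in> I \<Longrightarrow> c dvd f i - g i" for c :: int and f g and I :: "nat set"
    using that
  proof (induction I rule: finite_induct)
    case (insert i I)
    have "(\<Prod>i\<in>insert i I. f i) - (\<Prod>i\<in>insert i I. g i) =
      (f i - g i) * prod f I + g i * (prod f I - prod g I)"
      using insert by (simp add: algebra_simps)
    then show ?case using insert by simp
  qed simp
  have "det Z - det W =
      (\<Sum>p\<in>?P. signof p * ((\<Prod>i = 0..<m. Z $$ (i, p i)) - (\<Prod>i = 0..<m. W $$ (i, p i))))"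
    unfolding det_def'[OF Z] det_def'[OF W] by (simp only: sum_subtractf right_diff_distrib)
  also have "2 ^ K dvd \<dots>"
  proof (rule dvd_sum, rule dvd_mult, rule prod_dvd)
    fix p i assume "p \<in> ?P" "i \<in> {0..<m}"
    then show "2 ^ K dvd Z $$ (i, p i) - W $$ (i, p i)" using cong[of i "p i"] perm[of p i] by simp
  qed simp
  finally have "2 ^ K dvd det W" using \<open>det Z = 0\<close> by simp
  moreover have "\<bar>det W\<bar> = int (D ^ m)"
  proof -
    have "det W = prod_list (diag_mat W)"
      by (rule det_upper_triangular[OF _ W]) (simp add: W_def upper_triangular_def)
    also have "diag_mat W = map (\<lambda>i. \<sigma> i * int D) [0..<m]"
      by (simp add: diag_mat_def W_def)
    finally have "det W = prod_list (map (\<lambda>i. \<sigma> i * int D) [0..<m])" .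
    moreover have "\<bar>prod_list (map (\<lambda>i. \<sigma> i * int D) [0..<k])\<bar> = int (D ^ k)" for k
      by (induction k) (simp_all add: upt_Suc abs_mult \<sigma>)
    ultimately show ?thesis by simp
  qed
  ultimately have "2 ^ K dvd int (D ^ m)" by (metis dvd_abs_iff)
  then have "2 ^ K \<le> int (D ^ m)" by (rule zdvd_imp_le) (use D in simp)
  also have "\<dots> < 2 ^ K" using D(2) by (metis of_nat_less_iff of_nat_numeral of_nat_power)
  finally show False by simp
qed

text \<open>With more columns than rows, padding by zero rows gives a square matrix. In its
  transpose some column sum is 0, so the determinant bound gives 0 and yields a kernel
  vector.\<close>

lemma lin_indep_cols_le:
  assumes B: "B \<in> carrier_mat n m" and li: "lin_indep_cols B"
  shows "m \<le> n"
proof (rule ccontr)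
  assume mn: "\<not> m \<le> n"
  define A where "A = mat m m (\<lambda>(i, j). if i < n then B $$ (i, j) else 0)"
  have A: "A \<in> carrier_mat m m" by (simp add: A_def)
  have "det A = 0"
  proof -
    have "\<bar>det (transpose_mat A)\<bar> \<le> (\<Prod>j<m. \<Sum>i<m. \<bar>transpose_mat A $$ (i, j)\<bar>)"
      by (rule abs_det_le) (use A in simp)
    also have "\<dots> = 0"
      by (rule prod_zero) (use mn in \<open>auto simp: A_def intro!: bexI[of _ n]\<close>)
    finally show ?thesis using det_transpose[OF A] by simp
  qed
  then obtain v where v: "v \<in> carrier_vec m" "v \<noteq> 0\<^sub>v m" "A *\<^sub>v v = 0\<^sub>v m"
    using det_0_iff_vec_prod_zero[OF A] by auto
  have "(B *\<^sub>v v) $ i = 0" if "i < n" for i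
  proof -
    have "(B *\<^sub>v v) $ i = (A *\<^sub>v v) $ i"
      using index_mult_mat_vec_sum[OF A v(1), of i] index_mult_mat_vec_sum[OF B v(1), of i] that mn
      by (simp add: A_def)
    then show ?thesis using v that mn by simp
  qed
  then have "B *\<^sub>v v = 0\<^sub>v n" using B by auto
  then show False using li B v unfolding lin_indep_cols_def by auto
qed

text \<open>A rectangular \<open>B\<close> is handled through its Gram matrix, which is nonsingular
  because its quadratic form at \<open>v\<close> is the squared length of
  \<open>B *\<^sub>v v\<close>. Passing to it squares the common denominator and the entry
  bound.\<close>

lemma gram_bound:
  fixes B :: "real mat" and D :: nat
  assumes B: "B \<in> carrier_mat n m" and li: "lin_indep_cols B" and D: "0 < D" and n: "0 < n"
    and int: "\<And>i j. i < n \<Longrightarrow> j < m \<Longrightarrow> real D * B $$ (i, j) \<in> \<int>"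
    and E: "1 \<le> E" "\<And>i j. i < n \<Longrightarrow> j < m \<Longrightarrow> \<bar>B $$ (i, j)\<bar> \<le> E"
    and x: "x \<in> carrier_vec m" and Y: "\<And>i. i < n \<Longrightarrow> \<bar>(B *\<^sub>v x) $ i\<bar> \<le> Y"
    and k: "k < m"
  shows "\<bar>x $ k\<bar> \<le> real (D ^ 2) ^ m * (real m * (real n * E\<^sup>2)) ^ m * (real n * E * Y)"
proof -
  let ?G = "transpose_mat B * B"
  have G: "?G \<in> carrier_mat m m" using B by simp
  have entry: "?G $$ (i, j) = (\<Sum>l<n. B $$ (l, i) * B $$ (l, j))" if "i < m" "j < m" for i j
    using that B by (simp add: scalar_prod_def lessThan_atLeast0)
  have Gv: "?G *\<^sub>v v = transpose_mat B *\<^sub>v (B *\<^sub>v v)" if "v \<in> carrier_vec m" for v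
    using B that by (intro assoc_mult_mat_vec[of _ m n _ m]) auto
  have "det ?G \<noteq> 0"
  proof
    assume "det ?G = 0"
    then obtain v where v: "v \<in> carrier_vec m" "v \<noteq> 0\<^sub>v m" "?G *\<^sub>v v = 0\<^sub>v m"
      using det_0_iff_vec_prod_zero[OF G] by auto
    have "0 = (transpose_mat B *\<^sub>v (B *\<^sub>v v)) \<bullet> v" using v Gv[OF v(1)] by simp
    also have "\<dots> = (B *\<^sub>v v) \<bullet> (B *\<^sub>v v)"
      using B v by (subst transpose_vec_mult_scalar[of B n m]) auto
    finally have "vnorm (B *\<^sub>v v) = 0" by (simp add: vnorm_def)
    then have "B *\<^sub>v v = 0\<^sub>v n" using B by (simp add: vnorm_eq_0)
    then show False using li B v unfolding lin_indep_cols_def by auto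
  qed
  then show ?thesis
  proof (rule cramer_bound[OF G])
    show "0 < D ^ 2" using D by simp
    show "1 \<le> real n * E\<^sup>2" using E n by (simp add: mult_ge1_I one_le_power)
    show "real (D ^ 2) * ?G $$ (i, j) \<in> \<int>" if "i < m" "j < m" for i j
    proof -
      have "real (D ^ 2) * ?G $$ (i, j) =
        (\<Sum>l<n. (real D * B $$ (l, i)) * (real D * B $$ (l, j)))"
        unfolding entry[OF that] by (simp add: sum_distrib_left power2_eq_square algebra_simps)
      also have "\<dots> \<in> \<int>" by (rule Ints_sum, rule Ints_mult; rule int) (use that in auto)
      finally show ?thesis .
    qed
    show "\<bar>?G $$ (i, j)\<bar> \<le> real n * E\<^sup>2" if "i < m" "j < m" for i j
    proof -
      have "\<bar>?G $$ (i, j)\<bar> \<le> (\<Sum>l<n. \<bar>B $$ (l, i)\<bar> * \<bar>B $$ (l, j)\<bar>)"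
        unfolding entry[OF that] by (rule order_trans[OF sum_abs]) (simp add: abs_mult)
      also have "\<dots> \<le> (\<Sum>l<n. E * E)"
        using E that by (intro sum_mono mult_mono) auto
      finally show ?thesis by (simp add: power2_eq_square)
    qed
    show "\<bar>(?G *\<^sub>v x) $ i\<bar> \<le> real n * E * Y" if "i < m" for i
    proof -
      have "(?G *\<^sub>v x) $ i = (\<Sum>l<n. B $$ (l, i) * (B *\<^sub>v x) $ l)"
        unfolding Gv[OF x] using B x that
        by (subst index_mult_mat_vec_sum[of _ m n]) (auto intro!: sum.cong)
      also have "\<bar>\<dots>\<bar> \<le> (\<Sum>l<n. \<bar>B $$ (l, i)\<bar> * \<bar>(B *\<^sub>v x) $ l\<bar>)"
        by (rule order_trans[OF sum_abs]) (simp add: abs_mult)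
      also have "\<dots> \<le> (\<Sum>l<n. E * Y)"
        using E Y that by (intro sum_mono mult_mono) auto
      finally show ?thesis by simp
    qed
  qed (use x k in auto)
qed


section \<open>Distortion between lifted lattices\<close>

text \<open>Real counterpart of \<open>lift_basis\<close>, with the completed square basis already
  given as \<open>M\<close>.\<close>

definition lift_mat :: "real mat \<Rightarrow> real vec \<Rightarrow> real \<Rightarrow> real mat" where
  "lift_mat M t d = (let n = dim_row M in
     mat (n + 1) (n + 1) (\<lambda>(i, j).
       if j = n then (if i = n then d else t $ i) else if i = n then 0 else M $$ (i, j)))"

lemma lift_mat_carrier [simp]: "M \<in> carrier_mat n n \<Longrightarrow> lift_mat M t d \<in> carrier_mat (n + 1) (n + 1)"
  by (simp add: lift_mat_def Let_def)

lemmas lift_mat_carrier_Suc [simp] = lift_mat_carrier[simplified]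

lemma lift_mat_mult:
  assumes M: "M \<in> carrier_mat n n" and z: "z \<in> carrier_vec (n + 1)"
  shows "lift_mat M t d *\<^sub>v z =
    vec (n + 1) (\<lambda>i. if i = n then d * z $ n else (\<Sum>j<n. M $$ (i, j) * z $ j) + z $ n * t $ i)"
proof (rule eq_vecI)
  fix i assume "i < dim_vec (vec (n + 1) (\<lambda>i. if i = n then d * z $ n
    else (\<Sum>j<n. M $$ (i, j) * z $ j) + z $ n * t $ i))"
  then have i: "i < n + 1" by simp
  have n: "dim_row M = n" using M by simp
  show "(lift_mat M t d *\<^sub>v z) $ i = vec (n + 1) (\<lambda>i. if i = n then d * z $ n
    else (\<Sum>j<n. M $$ (i, j) * z $ j) + z $ n * t $ i) $ i"
    unfolding index_mult_mat_vec_sum[OF lift_mat_carrier[OF M] z i]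
    using i by (simp add: lift_mat_def Let_def n)
qed (use M in \<open>simp add: lift_mat_def Let_def\<close>)

text \<open>In the expansion along the last row only the entry \<open>d\<close> survives, and its
  minor omits the column that contains \<open>t\<close>.\<close>

lemma det_lift_mat:
  assumes M: "M \<in> carrier_mat n n"
  shows "det (lift_mat M t d) = det (lift_mat M t' d)"
proof -
  have n: "dim_row M = n" using M by simp
  have "det (lift_mat M t d) = d * cofactor (lift_mat M t d) n n" for t
    unfolding laplace_expansion_row[OF lift_mat_carrier[OF M], of n, simplified]
    by (simp add: lift_mat_def Let_def n)
  moreover have "mat_delete (lift_mat M t d) n n = mat_delete (lift_mat M t' d) n n"
    by (rule eq_matI) (auto simp: mat_delete_def lift_mat_def Let_def n)
  ultimately show ?thesis by (simp add: cofactor_def)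
qed

lemma lift_mat_kernel:
  assumes M: "M \<in> carrier_mat n n" and d: "0 < d"
    and inj: "\<And>y. y \<in> carrier_vec n \<Longrightarrow> M *\<^sub>v y = 0\<^sub>v n \<Longrightarrow> y = 0\<^sub>v n"
    and z: "z \<in> carrier_vec (n + 1)" and 0: "lift_mat M t d *\<^sub>v z = 0\<^sub>v (n + 1)"
  shows "z = 0\<^sub>v (n + 1)"
proof -
  have "(lift_mat M t d *\<^sub>v z) $ n = 0" using 0 by simp
  then have zn: "z $ n = 0" using d by (simp add: lift_mat_mult[OF M z])
  define y where "y = vec n (($) z)"
  have y: "y \<in> carrier_vec n" by (simp add: y_def)
  have "M *\<^sub>v y = 0\<^sub>v n"
  proof (rule eq_vecI)
    fix i assume "i < dim_vec (0\<^sub>v n :: real vec)"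
    then have i: "i < n" by simp
    have "(lift_mat M t d *\<^sub>v z) $ i = 0" using 0 i by simp
    then show "(M *\<^sub>v y) $ i = 0\<^sub>v n $ i"
      unfolding index_mult_mat_vec_sum[OF M y i] using i zn by (simp add: lift_mat_mult[OF M z] y_def)
  qed (use M in simp)
  then have y0: "y = 0\<^sub>v n" by (rule inj[OF y])
  show ?thesis
  proof (rule eq_vecI)
    fix i assume "i < dim_vec (0\<^sub>v (n + 1) :: real vec)"
    then show "z $ i = 0\<^sub>v (n + 1) $ i"
      using zn arg_cong[OF y0, of "\<lambda>v. v $ i"] by (cases "i = n") (auto simp: y_def)
  qed (use z in simp)
qed

section \<open>Shears along the last coordinate\<close>

definition shear :: "nat \<Rightarrow> real vec \<Rightarrow> real mat" where
  "shear n u = mat (n + 1) (n + 1)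
     (\<lambda>(i, j). (if i = j then 1 else 0) + (if j = n \<and> i < n then u $ i else 0))"

lemma shear_carrier [simp]: "shear n u \<in> carrier_mat (n + 1) (n + 1)"
  by (simp add: shear_def)

lemmas shear_carrier_Suc [simp] = shear_carrier[simplified]

lemma shear_mult:
  assumes z: "z \<in> carrier_vec (n + 1)"
  shows "shear n u *\<^sub>v z = vec (n + 1) (\<lambda>i. z $ i + (if i < n then z $ n * u $ i else 0))"
proof (rule eq_vecI)
  fix i assume "i < dim_vec (vec (n + 1) (\<lambda>i. z $ i + (if i < n then z $ n * u $ i else 0)))"
  then have i: "i < n + 1" by simp
  have "(shear n u *\<^sub>v z) $ i = (\<Sum>j<n + 1. ((if i = j then 1 else 0) +
      (if j = n \<and> i < n then u $ i else 0)) * z $ j)"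
    unfolding index_mult_mat_vec_sum[OF shear_carrier z i] using i by (simp add: shear_def)
  also have "\<dots> = (\<Sum>j<n + 1. if j = i then z $ j else 0) +
      (\<Sum>j<n + 1. if j = n then (if i < n then u $ i * z $ j else 0) else 0)"
    unfolding sum.distrib[symmetric] by (rule sum.cong) (auto simp: algebra_simps)
  also have "\<dots> = z $ i + (if i < n then z $ n * u $ i else 0)"
    using i by (subst (1 2) sum.delta) auto
  finally show "(shear n u *\<^sub>v z) $ i =
      vec (n + 1) (\<lambda>i. z $ i + (if i < n then z $ n * u $ i else 0)) $ i"
    using i by simp
qed (simp add: shear_def)

lemma inverts_shear:
  assumes u: "u \<in> carrier_vec n"
  shows "inverts_mat (shear n u) (shear n (- u))"
proof -
  have "shear n u * shear n (- u) = 1\<^sub>m (n + 1)"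
  proof (rule eq_matI)
    fix i j assume "i < dim_row (1\<^sub>m (n + 1) :: real mat)" "j < dim_col (1\<^sub>m (n + 1) :: real mat)"
    then have ij: "i < n + 1" "j < n + 1" by auto
    let ?c = "col (shear n (- u)) j"
    have c: "?c \<in> carrier_vec (n + 1)" using ij by (simp add: shear_def)
    have "(shear n u * shear n (- u)) $$ (i, j) = (shear n u *\<^sub>v ?c) $ i"
      using ij by (simp add: shear_def)
    then show "(shear n u * shear n (- u)) $$ (i, j) = 1\<^sub>m (n + 1) $$ (i, j)"
      unfolding shear_mult[OF c] using ij u by (auto simp: shear_def)
  qed (simp_all add: shear_def)
  then show ?thesis by (simp add: inverts_mat_def shear_def)
qed

lemma op_norm_shear_le:
  assumes u: "u \<in> carrier_vec n" and le: "vnorm u \<le> c"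
  shows "op_norm (shear n u) \<le> 1 + c"
proof (rule op_norm_le[OF shear_carrier])
  fix z :: "real vec" assume z: "z \<in> carrier_vec (n + 1)" "vnorm z = 1"
  define w where "w = vec (n + 1) (\<lambda>i. if i < n then u $ i else 0)"
  have "vnorm w = vnorm u"
    using u by (simp add: vnorm_def scalar_prod_def w_def)
  moreover have "\<bar>z $ n\<bar> \<le> 1" using abs_le_vnorm[of n z] z by simp
  moreover have "shear n u *\<^sub>v z = z + z $ n \<cdot>\<^sub>v w"
    unfolding shear_mult[OF z(1)] using z by (auto simp: w_def)
  moreover have "vnorm (z + z $ n \<cdot>\<^sub>v w) \<le> vnorm z + vnorm (z $ n \<cdot>\<^sub>v w)"
    by (rule vnorm_triangle) (use z in \<open>simp add: w_def\<close>)
  ultimately have "vnorm (shear n u *\<^sub>v z) \<le> 1 + \<bar>z $ n\<bar> * vnorm u"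
    using z by (simp add: vnorm_smult)
  also have "\<dots> \<le> 1 + 1 * c"
    using \<open>\<bar>z $ n\<bar> \<le> 1\<close> le by (intro add_left_mono mult_mono) auto
  finally show "vnorm (shear n u *\<^sub>v z) \<le> 1 + c" by simp
qed simp

text \<open>On coefficient vectors the shear subtracts \<open>z $ n\<close> times \<open>y\<close>
  from the first \<open>n\<close> coordinates. For integral \<open>y\<close> this is unimodular,
  which makes the shear a bijection between the two lattices.\<close>

lemma shear_lift_mat:
  assumes M: "M \<in> carrier_mat n n" and t: "t \<in> carrier_vec n" and y: "y \<in> carrier_vec n"
    and d: "0 < d" and z: "z \<in> carrier_vec (n + 1)"
  shows "shear n ((1 / d) \<cdot>\<^sub>v (t - M *\<^sub>v y)) *\<^sub>v (lift_mat M (0\<^sub>v n) d *\<^sub>v z) =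
    lift_mat M t d *\<^sub>v vec (n + 1) (\<lambda>i. if i < n then z $ i - z $ n * y $ i else z $ n)"
    (is "shear n ?u *\<^sub>v ?w = _ *\<^sub>v ?z")
proof -
  have w: "?w \<in> carrier_vec (n + 1)"
    using M by (intro carrier_vecI) (simp add: lift_mat_def Let_def)
  have z': "?z \<in> carrier_vec (n + 1)" by simp
  show ?thesis
  proof (rule eq_vecI)
    fix i assume "i < dim_vec (lift_mat M t d *\<^sub>v ?z)"
    then consider "i = n" | "i < n" using M by (fastforce simp: lift_mat_def Let_def)
    then show "(shear n ?u *\<^sub>v ?w) $ i = (lift_mat M t d *\<^sub>v ?z) $ i"
    proof cases
      case 1
      then show ?thesis
        by (simp only: shear_mult[OF w] lift_mat_mult[OF M z'])
          (simp add: lift_mat_mult[OF M z])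
    next
      case 2
      have u: "d * ?u $ i = t $ i - (\<Sum>j<n. M $$ (i, j) * y $ j)"
        using 2 M t d by (simp add: index_mult_mat_vec_sum[OF M y 2, symmetric])
      have "(\<Sum>j<n. M $$ (i, j) * ?z $ j) = (\<Sum>j<n. M $$ (i, j) * z $ j - z $ n * (M $$ (i, j) * y $ j))"
        by (rule sum.cong) (auto simp: algebra_simps)
      also have "\<dots> = (\<Sum>j<n. M $$ (i, j) * z $ j) - z $ n * (\<Sum>j<n. M $$ (i, j) * y $ j)"
        by (simp add: sum_subtractf sum_distrib_left)
      finally have "(lift_mat M t d *\<^sub>v ?z) $ i = (\<Sum>j<n. M $$ (i, j) * z $ j) + z $ n * (d * ?u $ i)"
        unfolding u lift_mat_mult[OF M z'] using 2 by (simp add: algebra_simps)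
      then show ?thesis
        using 2 by (simp only: shear_mult[OF w]) (simp add: lift_mat_mult[OF M z] algebra_simps)
    qed
  qed (use M in \<open>simp add: shear_def lift_mat_def Let_def\<close>)
qed

lemma shear_image:
  fixes y :: "int vec"
  assumes M: "M \<in> carrier_mat n n" and t: "t \<in> carrier_vec n" and y: "y \<in> carrier_vec n"
    and d: "0 < d"
  shows "(\<lambda>v. shear n ((1 / d) \<cdot>\<^sub>v (t - M *\<^sub>v map_vec real_of_int y)) *\<^sub>v v) ` lat (lift_mat M (0\<^sub>v n) d) =
    lat (lift_mat M t d)" (is "(\<lambda>v. ?S *\<^sub>v v) ` _ = _")
proof -
  let ?y = "map_vec real_of_int y"
  have y': "?y \<in> carrier_vec n" using y by simp
  have dim: "dim_col (lift_mat M s d) = n + 1" for s using M by (simp add: lift_mat_def Let_def)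
  note eq = shear_lift_mat[OF M t y' d]
  show ?thesis
  proof (intro subset_antisym subsetI)
    fix v assume "v \<in> (\<lambda>v. ?S *\<^sub>v v) ` lat (lift_mat M (0\<^sub>v n) d)"
    then obtain z where z: "z \<in> carrier_vec (n + 1)"
      and v: "v = ?S *\<^sub>v (lift_mat M (0\<^sub>v n) d *\<^sub>v map_vec real_of_int z)"
      by (auto simp: lat_def dim)
    let ?z = "vec (n + 1) (\<lambda>i. if i < n then z $ i - z $ n * y $ i else z $ n)"
    have "v = lift_mat M t d *\<^sub>v map_vec real_of_int ?z"
      unfolding v using z y
      by (subst eq) (auto simp: less_Suc_eq intro!: arg_cong[of _ _ "(*\<^sub>v) _"] eq_vecI)
    then show "v \<in> lat (lift_mat M t d)" by (auto simp: lat_def dim intro!: exI[of _ ?z])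
  next
    fix v assume "v \<in> lat (lift_mat M t d)"
    then obtain z where z: "z \<in> carrier_vec (n + 1)" and v: "v = lift_mat M t d *\<^sub>v map_vec real_of_int z"
      by (auto simp: lat_def dim)
    let ?z = "vec (n + 1) (\<lambda>i. if i < n then z $ i + z $ n * y $ i else z $ n)"
    have "v = ?S *\<^sub>v (lift_mat M (0\<^sub>v n) d *\<^sub>v map_vec real_of_int ?z)"
      unfolding v using z y
      by (subst eq) (auto simp: less_Suc_eq intro!: arg_cong[of _ _ "(*\<^sub>v) _"] eq_vecI)
    moreover have "lift_mat M (0\<^sub>v n) d *\<^sub>v map_vec real_of_int ?z \<in> lat (lift_mat M (0\<^sub>v n) d)"
      by (auto simp: lat_def dim intro!: exI[of _ ?z])
    ultimately show "v \<in> (\<lambda>v. ?S *\<^sub>v v) ` lat (lift_mat M (0\<^sub>v n) d)" by blast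
  qed
qed

section \<open>Upper and lower bounds for the distortion\<close>

definition lat_maps :: "nat \<Rightarrow> real vec set \<Rightarrow> real vec set \<Rightarrow> (real mat \<times> real mat) set" where
  "lat_maps n L1 L2 = {(T, S). T \<in> carrier_mat n n \<and> S \<in> carrier_mat n n \<and>
     inverts_mat T S \<and> inverts_mat S T \<and> (\<lambda>v. T *\<^sub>v v) ` L1 = L2}"

lemma lat_distortion_eq:
  "lat_distortion n L1 L2 = Inf ((\<lambda>(T, S). op_norm T * op_norm S) ` lat_maps n L1 L2)"
  unfolding lat_distortion_def lat_maps_def by (rule arg_cong[of _ _ Inf]) auto

lemma shear_lat_maps:
  fixes y :: "int vec"
  assumes M: "M \<in> carrier_mat n n" and t: "t \<in> carrier_vec n" and y: "y \<in> carrier_vec n"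
    and d: "0 < d" and u: "u = (1 / d) \<cdot>\<^sub>v (t - M *\<^sub>v map_vec real_of_int y)"
  shows "(shear n u, shear n (- u)) \<in> lat_maps (n + 1) (lat (lift_mat M (0\<^sub>v n) d)) (lat (lift_mat M t d))"
proof -
  have uc: "u \<in> carrier_vec n" unfolding u using M t by (intro carrier_vecI) simp
  have "- (- u) = u" by auto
  then show ?thesis
    using inverts_shear[OF uc] inverts_shear[of "- u" n] uc shear_image[OF M t y d] u
    by (simp add: lat_maps_def)
qed

text \<open>The inverse of a shear is the shear by the negative vector, so the same norm bound
  \<open>1 + c\<close> applies to both factors.\<close>

lemma lat_distortion_lift_le:
  fixes y :: "int vec"
  assumes M: "M \<in> carrier_mat n n" and t: "t \<in> carrier_vec n" and y: "y \<in> carrier_vec n"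
    and d: "0 < d" and le: "vnorm (t - M *\<^sub>v map_vec real_of_int y) \<le> c * d"
  shows "lat_distortion (n + 1) (lat (lift_mat M (0\<^sub>v n) d)) (lat (lift_mat M t d)) \<le> (1 + c)\<^sup>2"
proof -
  define u where "u = (1 / d) \<cdot>\<^sub>v (t - M *\<^sub>v map_vec real_of_int y)"
  have u: "u \<in> carrier_vec n" unfolding u_def using M t by (intro carrier_vecI) simp
  have c: "vnorm u \<le> c" using le d by (simp add: u_def vnorm_smult field_simps)
  then have c0: "0 \<le> c" using vnorm_nonneg[of u] by linarith
  have "vnorm (- u) = vnorm u" using u by (simp add: vnorm_def)
  then have norms: "op_norm (shear n u) \<le> 1 + c" "op_norm (shear n (- u)) \<le> 1 + c"
    using op_norm_shear_le[OF u c] op_norm_shear_le[of "- u" n c] u c by auto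
  have "lat_distortion (n + 1) (lat (lift_mat M (0\<^sub>v n) d)) (lat (lift_mat M t d)) \<le>
      op_norm (shear n u) * op_norm (shear n (- u))"
    unfolding lat_distortion_eq
  proof (rule cInf_lower)
    show "op_norm (shear n u) * op_norm (shear n (- u)) \<in> (\<lambda>(T, S). op_norm T * op_norm S) `
        lat_maps (n + 1) (lat (lift_mat M (0\<^sub>v n) d)) (lat (lift_mat M t d))"
      using shear_lat_maps[OF M t y d u_def] by force
    show "bdd_below ((\<lambda>(T, S). op_norm T * op_norm S) `
        lat_maps (n + 1) (lat (lift_mat M (0\<^sub>v n) d)) (lat (lift_mat M t d)))"
      by (rule bdd_belowI[of _ 0]) (auto simp: lat_maps_def intro!: mult_nonneg_nonneg op_norm_nonneg)
  qed
  also have "\<dots> \<le> (1 + c) * (1 + c)"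
    using norms c0 op_norm_nonneg[OF shear_carrier] by (intro mult_mono) auto
  finally show ?thesis by (simp add: power2_eq_square)
qed

text \<open>The images of the columns of \<open>A\<close> are integral combinations of the columns
  of \<open>B\<close>, that is \<open>P * A = B * V\<close> with integral \<open>V\<close>. The
  equal determinants cancel.\<close>

lemma det_lattice_map_int:
  fixes A B P :: "real mat"
  assumes A: "A \<in> carrier_mat n n" and B: "B \<in> carrier_mat n n" and P: "P \<in> carrier_mat n n"
    and maps: "\<And>v. v \<in> lat A \<Longrightarrow> P *\<^sub>v v \<in> lat B" and det: "det A = det B" "det B \<noteq> 0"
  shows "det P \<in> \<int>"
proof -
  have "\<exists>x. x \<in> carrier_vec n \<and> P *\<^sub>v col A j = B *\<^sub>v map_vec real_of_int x" if j: "j < n" for j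
  proof -
    have "map_vec real_of_int (unit_vec n j) = unit_vec n j"
      by (intro eq_vecI) (auto simp: unit_vec_def)
    then have "A *\<^sub>v unit_vec n j \<in> lat A"
      using A by (auto simp: lat_def intro!: exI[of _ "unit_vec n j"])
    moreover have "A *\<^sub>v unit_vec n j = col A j"
      using A j by (auto intro!: eq_vecI)
    ultimately show ?thesis using maps[of "col A j"] B by (auto simp: lat_def)
  qed
  then obtain x where x: "\<And>j. j < n \<Longrightarrow> x j \<in> carrier_vec n"
    "\<And>j. j < n \<Longrightarrow> P *\<^sub>v col A j = B *\<^sub>v map_vec real_of_int (x j)" by metis
  define V where "V = mat n n (\<lambda>(i, j). x j $ i)"
  have V: "map_mat real_of_int V \<in> carrier_mat n n" by (simp add: V_def)
  have "P * A = B * map_mat real_of_int V"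
  proof (rule eq_matI)
    fix i j assume "i < dim_row (B * map_mat real_of_int V)" "j < dim_col (B * map_mat real_of_int V)"
    then have ij: "i < n" "j < n" using B by (auto simp: V_def)
    have "col (map_mat real_of_int V) j = map_vec real_of_int (x j)"
      using ij x(1)[OF ij(2)] by (auto simp: V_def)
    then show "(P * A) $$ (i, j) = (B * map_mat real_of_int V) $$ (i, j)"
      using ij A B P V arg_cong[OF x(2)[OF ij(2)], of "\<lambda>v. v $ i"] by simp
  qed (use A B P V in auto)
  then have "det P * det A = det B * real_of_int (det V)"
    using det_mult[OF P A] det_mult[OF B V] by simp
  then have "det P = real_of_int (det V)" using det by simp
  then show ?thesis by simp
qed

text \<open>The determinants of a map and of its inverse are both integers and multiply to 1. This
  excludes rescaling, which could otherwise make the norm of the inverse small and void the lower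
  bound \<open>r / d\<close> for the norm of the map.\<close>

lemma lat_distortion_lift_ge:
  assumes M: "M \<in> carrier_mat n n" and t: "t \<in> carrier_vec n" and d: "0 < d"
    and inj: "\<And>y. y \<in> carrier_vec n \<Longrightarrow> M *\<^sub>v y = 0\<^sub>v n \<Longrightarrow> y = 0\<^sub>v n"
    and far: "\<And>z :: int vec. z \<in> carrier_vec (n + 1) \<Longrightarrow> z \<noteq> 0\<^sub>v (n + 1) \<Longrightarrow>
      r \<le> vnorm (lift_mat M t d *\<^sub>v map_vec real_of_int z)"
    and r: "0 \<le> r"
  shows "r / d \<le> lat_distortion (n + 1) (lat (lift_mat M (0\<^sub>v n) d)) (lat (lift_mat M t d))"
  unfolding lat_distortion_eq
proof (rule cInf_greatest)
  let ?A = "lift_mat M (0\<^sub>v n) d" and ?B = "lift_mat M t d" and ?n = "n + 1"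
  \<comment> \<open>The infimum of an empty set would be unspecified; the shear with
    \<open>y = 0\<close> shows that some map exists.\<close>
  show "(\<lambda>(T, S). op_norm T * op_norm S) ` lat_maps ?n (lat ?A) (lat ?B) \<noteq> {}"
    using shear_lat_maps[OF M t zero_carrier_vec d refl] by blast
  have A: "?A \<in> carrier_mat ?n ?n" and B: "?B \<in> carrier_mat ?n ?n" using M by auto
  have det: "det ?A = det ?B" by (rule det_lift_mat[OF M])
  have "det ?B \<noteq> 0"
    using det_0_iff_vec_prod_zero[OF B] lift_mat_kernel[OF M d inj] by blast
  fix c assume "c \<in> (\<lambda>(T, S). op_norm T * op_norm S) ` lat_maps ?n (lat ?A) (lat ?B)"
  then obtain T S where c: "c = op_norm T * op_norm S" and T: "T \<in> carrier_mat ?n ?n"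
    and S: "S \<in> carrier_mat ?n ?n" and inv: "inverts_mat T S" "inverts_mat S T"
    and img: "(\<lambda>v. T *\<^sub>v v) ` lat ?A = lat ?B"
    by (auto simp: lat_maps_def)
  have ST: "S * T = 1\<^sub>m ?n" "T * S = 1\<^sub>m ?n" using inv T S by (auto simp: inverts_mat_def)
  have lat_carrier: "v \<in> carrier_vec ?n" if "v \<in> lat ?A" for v
    using that A by (auto simp: lat_def)
  have cancel: "S *\<^sub>v (T *\<^sub>v v) = v" if "v \<in> carrier_vec ?n" for v
    using assoc_mult_mat_vec[OF S T that] ST that by simp
  have "det T \<in> \<int>"
    by (rule det_lattice_map_int[OF A B T]) (use img det \<open>det ?B \<noteq> 0\<close> in auto)
  moreover have "det S \<in> \<int>"
  proof (rule det_lattice_map_int[OF B A S])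
    fix v assume "v \<in> lat ?B"
    then obtain u where "u \<in> lat ?A" "v = T *\<^sub>v u" using img by auto
    then show "S *\<^sub>v v \<in> lat ?A" using cancel lat_carrier by simp
  qed (use det \<open>det ?B \<noteq> 0\<close> in auto)
  moreover have "det S * det T = 1" using det_mult[OF S T] ST by simp
  ultimately have "\<bar>det S\<bar> = 1"
    by (auto elim!: Ints_cases simp flip: of_int_mult of_int_abs)
      (metis abs_zmult_eq_1 abs_one)
  then have S1: "1 \<le> op_norm S" by (intro op_norm_ge_1_of_det[OF S]) simp_all
  define e where "e = ?A *\<^sub>v map_vec real_of_int (unit_vec ?n n)"
  have e_eq: "e = d \<cdot>\<^sub>v unit_vec ?n n"
    unfolding e_def by (subst lift_mat_mult[OF M]) (auto intro!: eq_vecI)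
  have e: "e \<in> lat ?A" "vnorm e = d" "e \<in> carrier_vec ?n"
  proof -
    show "e \<in> lat ?A" using A by (auto simp: e_def lat_def intro!: exI[of _ "unit_vec ?n n"])
    show "vnorm e = d" "e \<in> carrier_vec ?n" using d by (simp_all add: e_eq vnorm_smult)
  qed
  then have "T *\<^sub>v e \<in> lat ?B" using img by auto
  then obtain z where z: "z \<in> carrier_vec ?n" and Te: "T *\<^sub>v e = ?B *\<^sub>v map_vec real_of_int z"
    using B by (auto simp: lat_def)
  have "z \<noteq> 0\<^sub>v ?n"
  proof
    assume "z = 0\<^sub>v ?n"
    then have "map_vec real_of_int z = 0\<^sub>v ?n" by auto
    then have "T *\<^sub>v e = 0\<^sub>v ?n" using Te B by (auto simp: scalar_prod_def)
    then have "e = S *\<^sub>v 0\<^sub>v ?n" using cancel[OF e(3)] by simp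
    then have "e = 0\<^sub>v ?n" using S by (auto simp: scalar_prod_def)
    then show False using e(2) d by simp
  qed
  from far[OF z this] have "r \<le> op_norm T * d"
    using vnorm_mult_le[OF T e(3)] Te e(2) by simp
  then have "r / d \<le> op_norm T" using d by (simp add: field_simps)
  also have "\<dots> \<le> op_norm T * op_norm S"
    using S1 op_norm_nonneg[OF T] by (simp add: mult_le_cancel_left1)
  finally show "r / d \<le> c" by (simp add: c)
qed

section \<open>Perturbing a basis into a full-rank one\<close>

text \<open>Two forms of quantitative injectivity. The factor \<kappa> belongs to the unperturbed
  \<open>B\<close> with all its rows and does not get worse as the nudges shrink. The factor
  \<kappa>' belongs to the perturbed top block, whose unperturbed form may be singular, so it may be
  huge; it only has to be outweighed by \<open>N\<close>.\<close>

locale nudged_basis =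
  fixes n m :: nat and B M :: "real mat" and \<eta> :: "nat \<Rightarrow> real" and E \<epsilon> \<kappa> \<kappa>' N :: real
  assumes dims: "0 < m" "m \<le> n" and B: "B \<in> carrier_mat n m" and M: "M \<in> carrier_mat n n"
    and M_left: "\<And>i j. i < n \<Longrightarrow> j < m \<Longrightarrow> M $$ (i, j) = B $$ (i, j) + (if i = j then \<eta> i else 0)"
    and M_right: "\<And>i j. i < n \<Longrightarrow> m \<le> j \<Longrightarrow> j < n \<Longrightarrow> M $$ (i, j) = (if i = j then N else 0)"
    and \<eta>: "\<And>i. i < m \<Longrightarrow> \<bar>\<eta> i\<bar> \<le> \<epsilon>"
    and B_le: "\<And>i j. i < n \<Longrightarrow> j < m \<Longrightarrow> \<bar>B $$ (i, j)\<bar> \<le> E"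
    and pos: "0 < N" "0 \<le> E" "0 \<le> \<epsilon>" "0 \<le> \<kappa>" "0 \<le> \<kappa>'"
    and inj_B: "\<And>x Y j. x \<in> carrier_vec m \<Longrightarrow> (\<And>i. i < n \<Longrightarrow> \<bar>(B *\<^sub>v x) $ i\<bar> \<le> Y) \<Longrightarrow>
      j < m \<Longrightarrow> \<bar>x $ j\<bar> \<le> \<kappa> * Y"
    and inj_top: "\<And>x Y j. x \<in> carrier_vec m \<Longrightarrow>
      (\<And>i. i < m \<Longrightarrow> \<bar>(B *\<^sub>v x) $ i + \<eta> i * x $ i\<bar> \<le> Y) \<Longrightarrow> j < m \<Longrightarrow> \<bar>x $ j\<bar> \<le> \<kappa>' * Y"
begin

lemma M_mult:
  assumes y: "y \<in> carrier_vec n" and i: "i < n"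
  shows "(M *\<^sub>v y) $ i = (B *\<^sub>v vec m (($) y)) $ i + (if i < m then \<eta> i * y $ i else N * y $ i)"
proof -
  have "(M *\<^sub>v y) $ i = (\<Sum>j<n. M $$ (i, j) * y $ j)"
    by (rule index_mult_mat_vec_sum[OF M y i])
  also have "{..<n} = {..<m} \<union> {m..<n}" using dims by auto
  also have "(\<Sum>j\<in>{..<m} \<union> {m..<n}. M $$ (i, j) * y $ j) =
      (\<Sum>j<m. M $$ (i, j) * y $ j) + (\<Sum>j=m..<n. M $$ (i, j) * y $ j)"
    by (rule sum.union_disjoint) auto
  also have "(\<Sum>j<m. M $$ (i, j) * y $ j) =
      (\<Sum>j<m. B $$ (i, j) * y $ j) + (\<Sum>j<m. if j = i then \<eta> i * y $ j else 0)"
    unfolding sum.distrib[symmetric] using i by (intro sum.cong) (auto simp: M_left algebra_simps)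
  also have "(\<Sum>j=m..<n. M $$ (i, j) * y $ j) = (\<Sum>j=m..<n. if j = i then N * y $ j else 0)"
    using i by (intro sum.cong) (auto simp: M_right)
  also have "(\<Sum>j<m. B $$ (i, j) * y $ j) = (B *\<^sub>v vec m (($) y)) $ i"
    by (subst index_mult_mat_vec_sum[OF B _ i]) auto
  finally show ?thesis using i by (simp add: sum.delta)
qed

text \<open>\<open>inj_top\<close> with \<open>Y = 0\<close> makes the first \<open>m\<close>
  coordinates vanish; each remaining row then reads \<open>N * y $ i = 0\<close>.\<close>

lemma M_inj:
  assumes y: "y \<in> carrier_vec n" and 0: "M *\<^sub>v y = 0\<^sub>v n"
  shows "y = 0\<^sub>v n"
proof (rule eq_vecI)
  let ?x = "vec m (($) y)"
  have eq: "(B *\<^sub>v ?x) $ i + (if i < m then \<eta> i * y $ i else N * y $ i) = 0" if "i < n" for i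
    using M_mult[OF y that] 0 that by simp
  have "\<bar>?x $ j\<bar> \<le> \<kappa>' * 0" if "j < m" for j
  proof (rule inj_top[OF _ _ that])
    fix i assume "i < m"
    then show "\<bar>(B *\<^sub>v ?x) $ i + \<eta> i * ?x $ i\<bar> \<le> 0" using eq[of i] dims by simp
  qed simp
  then have x: "y $ j = 0" if "j < m" for j using that by fastforce
  then have "?x = 0\<^sub>v m" by auto
  then have "(B *\<^sub>v ?x) $ i = 0" if "i < n" for i using B that by (simp add: scalar_prod_def)
  then show "y $ i = 0\<^sub>v n $ i" if "i < dim_vec (0\<^sub>v n :: real vec)" for i
    using x[of i] eq[of i] that pos by (cases "i < m") auto
qed (use y in simp)

text \<open>The displacement of the lattice vector with coefficients \<open>x\<close> that is caused
  by the perturbation.\<close>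

definition shift_vec :: "real vec \<Rightarrow> real vec" where
  "shift_vec x = vec n (\<lambda>i. if i < m then \<eta> i * x $ i else 0)"

lemma vnorm_shift_vec_le:
  assumes "\<And>j. j < m \<Longrightarrow> \<bar>x $ j\<bar> \<le> X" and X: "0 \<le> X"
  shows "vnorm (shift_vec x) \<le> real m * (\<epsilon> * X)"
proof -
  have "vnorm (shift_vec x) \<le> (\<Sum>i<n. if i < m then \<epsilon> * X else 0)"
    using vnorm_le_sum[of "shift_vec x"]
  proof (rule order_trans)
    show "(\<Sum>i<dim_vec (shift_vec x). \<bar>shift_vec x $ i\<bar>) \<le> (\<Sum>i<n. if i < m then \<epsilon> * X else 0)"
      using assms \<eta> pos by (auto simp: shift_vec_def abs_mult intro!: sum_mono mult_mono)
  qed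
  also have "\<dots> = (\<Sum>i\<in>{..<n} \<inter> {i. i < m}. \<epsilon> * X)" by (simp add: sum.If_cases)
  also have "{..<n} \<inter> {i. i < m} = {..<m}" using dims by auto
  finally show ?thesis by simp
qed

lemma M_mult_padded:
  assumes x: "x \<in> carrier_vec m" and y: "y \<in> carrier_vec n"
    and "\<And>j. j < m \<Longrightarrow> y $ j = x $ j" "\<And>j. m \<le> j \<Longrightarrow> j < n \<Longrightarrow> y $ j = 0"
  shows "M *\<^sub>v y = B *\<^sub>v x + shift_vec x"
proof (rule eq_vecI)
  have "vec m (($) y) = x" using assms by auto
  then show "(M *\<^sub>v y) $ i = (B *\<^sub>v x + shift_vec x) $ i" if "i < dim_vec (B *\<^sub>v x + shift_vec x)" for i
    using that assms M_mult[OF y, of i] B by (auto simp: shift_vec_def not_less)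
qed (use M B in \<open>auto simp: shift_vec_def\<close>)

text \<open>A lattice vector within \<open>2 * d\<close> of the target has entries of size at most
  \<open>E + 2 * d\<close>, hence bounded coefficients, so that the perturbation moves it by at most
  \<open>d\<close>.\<close>

lemma nudged_close:
  fixes x :: "int vec"
  assumes t: "t \<in> carrier_vec n" and t_le: "\<And>i. i < n \<Longrightarrow> \<bar>t $ i\<bar> \<le> E" and d: "0 < d"
    and x: "x \<in> carrier_vec m" and close: "vnorm (t - B *\<^sub>v map_vec real_of_int x) \<le> 2 * d"
    and small: "real m * (\<epsilon> * (\<kappa> * (E + 2 * d))) \<le> d"
  obtains y :: "int vec" where "y \<in> carrier_vec n" "vnorm (t - M *\<^sub>v map_vec real_of_int y) \<le> 3 * d"
proof
  let ?x = "map_vec real_of_int x"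
  define y where "y = vec n (\<lambda>i. if i < m then x $ i else 0)"
  have x': "?x \<in> carrier_vec m" using x by simp
  show y: "y \<in> carrier_vec n" by (simp add: y_def)
  have My: "M *\<^sub>v map_vec real_of_int y = B *\<^sub>v ?x + shift_vec ?x"
    by (rule M_mult_padded) (use x dims in \<open>auto simp: y_def\<close>)
  have "\<bar>(B *\<^sub>v ?x) $ i\<bar> \<le> E + 2 * d" if i: "i < n" for i
  proof -
    have "\<bar>(t - B *\<^sub>v ?x) $ i\<bar> \<le> 2 * d"
      using abs_le_vnorm[of i "t - B *\<^sub>v ?x"] close i B by simp
    then show ?thesis using t_le[OF i] t B i by simp
  qed
  then have "\<bar>?x $ j\<bar> \<le> \<kappa> * (E + 2 * d)" if "j < m" for j using inj_B[OF x' _ that] by blast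
  then have "vnorm (shift_vec ?x) \<le> d"
    using vnorm_shift_vec_le[of ?x "\<kappa> * (E + 2 * d)"] small pos d by simp
  moreover have "t - (B *\<^sub>v ?x + shift_vec ?x) = (t - B *\<^sub>v ?x) + (-1) \<cdot>\<^sub>v shift_vec ?x"
    using t B by (auto simp: shift_vec_def)
  moreover have "vnorm ((t - B *\<^sub>v ?x) + (-1) \<cdot>\<^sub>v shift_vec ?x) \<le>
      vnorm (t - B *\<^sub>v ?x) + vnorm ((-1) \<cdot>\<^sub>v shift_vec ?x)"
    by (rule vnorm_triangle) (use B in \<open>simp add: shift_vec_def\<close>)
  ultimately show "vnorm (t - M *\<^sub>v map_vec real_of_int y) \<le> 3 * d"
    using close unfolding My by (simp add: vnorm_smult)
qed

text \<open>Suppose the vector is shorter than \<open>R / 2\<close>. The bound on \<open>k\<close>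
  limits the share of the target, so \<open>M *\<^sub>v y\<close> has entries at most
  \<open>Y\<close>. A crude bound through \<kappa>' shows that the extra columns do not occur;
  without them \<kappa> gives a sharp bound, by which the perturbation displaces the vector by at
  most \<open>R / 2\<close>. Undoing it contradicts \<open>far\<close>.\<close>

lemma nudged_far:
  fixes y :: "int vec" and k :: int
  assumes t: "t \<in> carrier_vec n" and t_le: "\<And>i. i < n \<Longrightarrow> \<bar>t $ i\<bar> \<le> E" and d: "0 < d" and R: "0 < R"
    and far: "\<And>(k::int) (x::int vec). x \<in> carrier_vec m \<Longrightarrow> k \<noteq> 0 \<or> x \<noteq> 0\<^sub>v m \<Longrightarrow>
      R < vnorm (real_of_int k \<cdot>\<^sub>v t + B *\<^sub>v map_vec real_of_int x)"
    and small: "2 * real m * \<epsilon> * \<kappa> * (1 + E / d) \<le> 1"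
    and N_large: "R / 2 * (1 + E / d) * (1 + real m * E * \<kappa>') < N"
    and y: "y \<in> carrier_vec n" and ky: "k \<noteq> 0 \<or> y \<noteq> 0\<^sub>v n"
    and kd: "\<bar>real_of_int k\<bar> * d < R / 2"
  shows "R / 2 \<le> vnorm (real_of_int k \<cdot>\<^sub>v t + M *\<^sub>v map_vec real_of_int y)"
proof (rule ccontr)
  let ?k = "real_of_int k" and ?y = "map_vec real_of_int y"
  assume "\<not> R / 2 \<le> vnorm (?k \<cdot>\<^sub>v t + M *\<^sub>v ?y)"
  then have lt: "vnorm (?k \<cdot>\<^sub>v t + M *\<^sub>v ?y) < R / 2" by simp
  define Y where "Y = R / 2 * (1 + E / d)"
  have Y0: "0 < Y" unfolding Y_def using R d pos by (simp add: add_pos_nonneg)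
  define x where "x = vec m (($) y)"
  let ?x = "map_vec real_of_int x"
  have x: "x \<in> carrier_vec m" and x': "?x \<in> carrier_vec m" by (simp_all add: x_def)
  have y': "?y \<in> carrier_vec n" using y by simp
  have x_eq: "vec m (($) ?y) = ?x" using y dims by (auto simp: x_def)
  have kE: "\<bar>?k\<bar> * E \<le> R / 2 * (E / d)"
  proof -
    have "\<bar>?k\<bar> \<le> R / 2 / d" using kd d by (simp add: field_simps)
    then have "\<bar>?k\<bar> * E \<le> R / 2 / d * E" using pos by (intro mult_right_mono) auto
    then show ?thesis by simp
  qed
  have My: "\<bar>(M *\<^sub>v ?y) $ i\<bar> \<le> Y" if i: "i < n" for i
  proof -
    have "\<bar>?k * t $ i + (M *\<^sub>v ?y) $ i\<bar> < R / 2"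
      using abs_le_vnorm[of i "?k \<cdot>\<^sub>v t + M *\<^sub>v ?y"] lt i t M by simp
    moreover have "\<bar>?k * t $ i\<bar> \<le> \<bar>?k\<bar> * E"
      using t_le[OF i] by (simp add: abs_mult mult_left_mono)
    ultimately have "\<bar>(M *\<^sub>v ?y) $ i\<bar> \<le> R / 2 + R / 2 * (E / d)" using kE by linarith
    then show ?thesis by (simp add: Y_def algebra_simps)
  qed
  have x_bound: "\<bar>?x $ j\<bar> \<le> \<kappa>' * Y" if "j < m" for j
  proof (rule inj_top[OF x' _ that])
    fix i assume "i < m"
    then show "\<bar>(B *\<^sub>v ?x) $ i + \<eta> i * ?x $ i\<bar> \<le> Y"
      using My[of i] M_mult[OF y', of i] dims x_eq y by (simp add: x_def)
  qed
  \<comment> \<open>A nonzero integer coefficient of an extra column contributes at least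
    \<open>N\<close>, more than the other columns and the bound \<open>Y\<close> can
    balance.\<close>
  have y_zero: "y $ i = 0" if i: "m \<le> i" "i < n" for i
  proof (rule ccontr)
    assume "y $ i \<noteq> 0"
    then have "1 \<le> \<bar>real_of_int (y $ i)\<bar>" by linarith
    then have "N * 1 \<le> N * \<bar>real_of_int (y $ i)\<bar>" using pos by (intro mult_left_mono) auto
    also have "\<dots> = \<bar>(M *\<^sub>v ?y) $ i - (B *\<^sub>v ?x) $ i\<bar>"
      using M_mult[OF y' i(2)] i y x_eq pos by (simp add: abs_mult)
    also have "\<dots> \<le> Y + \<bar>(B *\<^sub>v ?x) $ i\<bar>" using My[OF i(2)] by linarith
    also have "\<bar>(B *\<^sub>v ?x) $ i\<bar> \<le> (\<Sum>j<m. \<bar>B $$ (i, j)\<bar> * \<bar>?x $ j\<bar>)"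
      unfolding index_mult_mat_vec_sum[OF B x' i(2)]
      by (rule order_trans[OF sum_abs]) (simp add: abs_mult)
    also have "\<dots> \<le> (\<Sum>j<m. E * (\<kappa>' * Y))"
      using B_le[OF i(2)] x_bound pos by (intro sum_mono mult_mono) auto
    also have "Y + (\<Sum>j<m. E * (\<kappa>' * Y)) = Y * (1 + real m * E * \<kappa>')" by (simp add: algebra_simps)
    also have "\<dots> < N" using N_large by (simp add: Y_def)
    finally show False by simp
  qed
  have Mx: "M *\<^sub>v ?y = B *\<^sub>v ?x + shift_vec ?x"
    by (rule M_mult_padded[OF x' y']) (use y dims y_zero in \<open>auto simp: x_def\<close>)
  \<comment> \<open>The bound for \<open>B *\<^sub>v x\<close> involves the largest coefficient
    \<open>X\<close> itself through the perturbation. As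
    \<open>2 * (\<epsilon> * \<kappa>) \<le> 1\<close>, that term is absorbed and
    \<open>X \<le> 2 * \<kappa> * Y\<close> remains, in which \<kappa>' no longer occurs.\<close>
  define X where "X = Max ((\<lambda>j. \<bar>?x $ j\<bar>) ` {..<m})"
  have X: "\<bar>?x $ j\<bar> \<le> X" if "j < m" for j unfolding X_def using that by (intro Max_ge) auto
  have "X \<in> (\<lambda>j. \<bar>?x $ j\<bar>) ` {..<m}" unfolding X_def using dims by (intro Max_in) auto
  then obtain j where j: "j < m" "X = \<bar>?x $ j\<bar>" by auto
  have X0: "0 \<le> X" using j by simp
  have "\<bar>(B *\<^sub>v ?x) $ i\<bar> \<le> Y + \<epsilon> * X" if i: "i < n" for i
  proof -
    have "\<bar>shift_vec ?x $ i\<bar> \<le> \<epsilon> * X"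
      using i X \<eta> pos X0 by (auto simp: shift_vec_def abs_mult intro!: mult_mono)
    moreover have "(M *\<^sub>v ?y) $ i = (B *\<^sub>v ?x) $ i + shift_vec ?x $ i"
      unfolding Mx using i B by (simp add: shift_vec_def)
    ultimately show ?thesis using My[OF i] by linarith
  qed
  then have "X \<le> \<kappa> * (Y + \<epsilon> * X)" unfolding j(2) using inj_B[OF x' _ j(1)] j(2) by blast
  moreover have "2 * (\<epsilon> * \<kappa>) \<le> 1"
  proof -
    have "1 * 1 \<le> real m * (1 + E / d)" using dims pos d by (intro mult_mono) auto
    then have "2 * (\<epsilon> * \<kappa>) * 1 \<le> 2 * (\<epsilon> * \<kappa>) * (real m * (1 + E / d))"
      using pos by (intro mult_left_mono) auto
    then show ?thesis using small by (simp add: algebra_simps)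
  qed
  then have "2 * (\<epsilon> * \<kappa>) * X \<le> 1 * X" using X0 by (rule mult_right_mono)
  ultimately have X_le: "X \<le> 2 * \<kappa> * Y" by (simp add: algebra_simps)
  have "vnorm (shift_vec ?x) \<le> real m * (\<epsilon> * X)" by (rule vnorm_shift_vec_le[OF X X0])
  also have "\<dots> \<le> real m * (\<epsilon> * (2 * \<kappa> * Y))"
    using X_le pos by (intro mult_left_mono) auto
  also have "\<dots> = R / 2 * (2 * real m * \<epsilon> * \<kappa> * (1 + E / d))" by (simp add: Y_def algebra_simps)
  also have "\<dots> \<le> R / 2 * 1" using small R by (intro mult_left_mono) auto
  finally have shift: "vnorm (shift_vec ?x) \<le> R / 2" by simp
  have "?k \<cdot>\<^sub>v t + B *\<^sub>v ?x = (?k \<cdot>\<^sub>v t + M *\<^sub>v ?y) + (-1) \<cdot>\<^sub>v shift_vec ?x"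
    unfolding Mx using t B by (auto simp: shift_vec_def)
  moreover have "vnorm ((?k \<cdot>\<^sub>v t + M *\<^sub>v ?y) + (-1) \<cdot>\<^sub>v shift_vec ?x) \<le>
      vnorm (?k \<cdot>\<^sub>v t + M *\<^sub>v ?y) + vnorm ((-1) \<cdot>\<^sub>v shift_vec ?x)"
    by (rule vnorm_triangle) (use M in \<open>simp add: shift_vec_def\<close>)
  ultimately have "vnorm (?k \<cdot>\<^sub>v t + B *\<^sub>v ?x) \<le> R" using lt shift by (simp add: vnorm_smult)
  moreover have "k \<noteq> 0 \<or> x \<noteq> 0\<^sub>v m"
  proof (rule ccontr)
    assume "\<not> (k \<noteq> 0 \<or> x \<noteq> 0\<^sub>v m)"
    then have "k = 0" "x = 0\<^sub>v m" by auto
    then have "y $ i = 0" if "i < n" for i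
    proof (cases "i < m")
      case True
      then show ?thesis using arg_cong[OF \<open>x = 0\<^sub>v m\<close>, of "\<lambda>v. v $ i"] by (simp add: x_def)
    qed (use that y_zero in simp)
    then have "y = 0\<^sub>v n" using y by auto
    then show False using ky \<open>k = 0\<close> by simp
  qed
  ultimately show False using far[OF x, of k] by simp
qed

end


section \<open>Sizes of encoded instances\<close>

text \<open>Numerator and denominator are below 2 to the number of their digits, so the length of an
  encoding bounds a rational from above and, if positive, away from 0.\<close>

lemma quotient_of_bounds:
  assumes "quotient_of q = (a, b)"
  shows "0 < b" "length (enc_nat (nat b)) \<le> length (enc_rat q)" "b \<le> 2 ^ length (enc_nat (nat b))"
    "\<bar>q\<bar> \<le> 2 ^ length (enc_rat q)" "0 < q \<Longrightarrow> 1 \<le> q * 2 ^ length (enc_rat q)"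
proof -
  show b: "0 < b" by (rule quotient_of_denom_pos[OF assms])
  have q: "q = of_int a / of_int b" by (rule quotient_of_div[OF assms])
  show len: "length (enc_nat (nat b)) \<le> length (enc_rat q)" by (simp add: enc_rat_eq assms)
  have "nat b < 2 ^ length (enc_nat (nat b))" by (rule less_two_power_enc_nat)
  then show b_le: "b \<le> 2 ^ length (enc_nat (nat b))" using b by (simp add: zless_nat_eq_int_zless)
  have "nat \<bar>a\<bar> < 2 ^ length (enc_nat (nat \<bar>a\<bar>))" by (rule less_two_power_enc_nat)
  then have "\<bar>a\<bar> \<le> 2 ^ length (enc_nat (nat \<bar>a\<bar>))" by (simp add: zless_nat_eq_int_zless)
  also have "\<dots> \<le> 2 ^ length (enc_rat q)" by (rule power_increasing) (simp_all add: enc_rat_eq assms)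
  finally have a: "(of_int \<bar>a\<bar> :: rat) \<le> of_int (2 ^ length (enc_rat q))" by (simp only: of_int_le_iff)
  have "\<bar>q\<bar> \<le> of_int \<bar>a\<bar>"
    unfolding q using b by (simp add: abs_divide divide_le_eq mult_le_cancel_left1)
  then show "\<bar>q\<bar> \<le> 2 ^ length (enc_rat q)" using a by simp
  show "1 \<le> q * 2 ^ length (enc_rat q)" if "0 < q"
  proof -
    have "b \<le> 2 ^ length (enc_rat q)"
      by (rule order_trans[OF b_le power_increasing[OF len]]) simp
    then have "(of_int b :: rat) \<le> of_int (2 ^ length (enc_rat q))" by (simp only: of_int_le_iff)
    then have "q * of_int b \<le> q * 2 ^ length (enc_rat q)" using that by (intro mult_left_mono) auto
    moreover have "1 \<le> a" using that b unfolding q by (simp add: zero_less_divide_iff)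
    then have "1 \<le> q * of_int b" unfolding q using b by simp
    ultimately show ?thesis by linarith
  qed
qed

definition denom :: "rat \<Rightarrow> nat" where
  "denom q = nat (snd (quotient_of q))"

lemma denom_pos: "0 < denom q"
  using quotient_of_bounds(1)[of q] by (cases "quotient_of q") (simp add: denom_def)

lemma denom_le: "denom q \<le> 2 ^ length (enc_rat q)"
proof -
  have "denom q < 2 ^ length (enc_nat (denom q))" by (rule less_two_power_enc_nat)
  also have "\<dots> \<le> 2 ^ length (enc_rat q)"
    by (rule power_increasing) (simp_all add: enc_rat_eq denom_def)
  finally show ?thesis by simp
qed

lemma denom_mult_Ints: "real (denom q) * of_rat q \<in> \<int>"
proof -
  obtain a b where ab: "quotient_of q = (a, b)" by fastforce
  have "real (denom q) = of_int b" using quotient_of_bounds(1)[OF ab] by (simp add: denom_def ab)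
  moreover have "q = of_int a / of_int b" "0 < b"
    using quotient_of_div[OF ab] quotient_of_bounds(1)[OF ab] by auto
  ultimately have "real (denom q) * of_rat q = of_int a" by (simp add: of_rat_divide)
  then show ?thesis by simp
qed

lemma of_rat_nudge:
  "real_of_rat (nudge K q) =
    real_of_rat q + real_of_int (if q < 0 then -1 else 1) / 2 ^ (K + length (enc_nat (denom q)))"
  by (simp add: nudge_def of_rat_add of_rat_divide of_rat_power of_rat_minus denom_def)

lemma length_enc_vec: "length (enc_vec v) = Suc (\<Sum>i<dim_vec v. Suc (length (enc_rat (v $ i))))"
  by (simp add: enc_vec_eq length_concat comp_def lessThan_atLeast0 interv_sum_list_conv_sum_set_nat)

lemma length_enc_basis: "length (enc_basis B) = Suc (\<Sum>j<dim_col B. length (enc_vec (col B j)))"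
  by (simp add: enc_basis_def cols_def length_concat comp_def lessThan_atLeast0
      interv_sum_list_conv_sum_set_nat)

lemma enc_rat_length_ge: "3 \<le> length (enc_rat q)"
proof -
  have "1 \<le> length (enc_nat k)" for k using enc_nat_nonempty[of k] by (cases "enc_nat k") auto
  from this[of "nat \<bar>fst (quotient_of q)\<bar>"] this[of "nat (snd (quotient_of q))"]
  show ?thesis by (simp add: enc_rat_eq)
qed

section \<open>The reduction is correct\<close>

locale cvp_input =
  fixes n :: nat and B :: "rat mat" and t :: "rat vec" and d :: rat
  assumes inst: "cvp_instance n B t d"
begin

definition "m = dim_col B"
definition "len = length (enc_cvp B t d)"
text \<open>A common denominator of all entries. The plain product suffices: lengths add up over the
  encoding, so it stays below \<open>2 ^ len\<close>.\<close>

definition "D = (\<Prod>j<m. \<Prod>i<n. denom (B $$ (i, j)))"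
definition "e i = len ^ 3 + length (enc_nat (denom (B $$ (i, i))))"
definition sgn_at :: "nat \<Rightarrow> int" where "sgn_at i = (if B $$ (i, i) < 0 then -1 else 1)"
definition "nudge_at i = real_of_int (sgn_at i) / 2 ^ e i"
definition "M = mat n n (\<lambda>(i, j).
  if j < m then real_of_rat (B $$ (i, j)) + (if i = j then nudge_at i else 0)
  else if i = j then 2 ^ len ^ 5 else 0)"
text \<open>The factors of \<open>gram_bound\<close> with \<open>E = 2 ^ len\<close>, and below
  those of \<open>cramer_bound\<close> for the perturbed top block, with entries up to
  \<open>2 ^ (len + 1)\<close> and a denominator that also clears the nudges.\<close>

definition "gram_const = real (D ^ 2) ^ m * (real m * (real n * (2 ^ len)\<^sup>2)) ^ m * (real n * 2 ^ len)"
definition "top_const = real (D * 2 ^ (len ^ 3 + len)) ^ m * (real m * 2 ^ (len + 1)) ^ m"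

lemma input_dims: "dim_row B = n" "dim_col B = m" "0 < m" "lin_indep_cols (real_mat B)"
    "t \<in> carrier_vec n" "0 < d" "real_mat B \<in> carrier_mat n m"
  using inst by (auto simp: cvp_instance_def m_def real_mat_def)

lemma m_le_n: "m \<le> n"
  using lin_indep_cols_le input_dims by blast

lemma n_pos: "0 < n"
  using m_le_n input_dims by simp

lemma real_mat_entry [simp]: "i < n \<Longrightarrow> j < m \<Longrightarrow> real_mat B $$ (i, j) = real_of_rat (B $$ (i, j))"
  using input_dims by (simp add: real_mat_def)

lemma length_eq: "len = length (enc_basis B) + length (enc_vec t) + length (enc_rat d)"
  by (simp add: len_def enc_cvp_def)

section \<open>Size bounds for the input data\<close>

lemma sum_lengths:
  "(\<Sum>j<m. \<Sum>i<n. length (enc_rat (B $$ (i, j)))) \<le> len"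
proof -
  have "(\<Sum>j<m. \<Sum>i<n. length (enc_rat (B $$ (i, j)))) \<le> (\<Sum>j<m. length (enc_vec (col B j)))"
  proof (rule sum_mono)
    fix j assume "j \<in> {..<m}"
    then have "(\<Sum>i<n. length (enc_rat (B $$ (i, j)))) \<le> (\<Sum>i<n. Suc (length (enc_rat (col B j $ i))))"
      using input_dims by (intro sum_mono) auto
    then show "(\<Sum>i<n. length (enc_rat (B $$ (i, j)))) \<le> length (enc_vec (col B j))"
      using input_dims by (simp add: length_enc_vec)
  qed
  then show ?thesis by (simp add: length_eq length_enc_basis input_dims)
qed

lemma entry_length:
  assumes "i < n" "j < m"
  shows "length (enc_rat (B $$ (i, j))) \<le> len"
proof -
  have "length (enc_rat (B $$ (i, j))) \<le> (\<Sum>i<n. length (enc_rat (B $$ (i, j))))"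
    using assms by (intro member_le_sum) auto
  also have "\<dots> \<le> (\<Sum>j<m. \<Sum>i<n. length (enc_rat (B $$ (i, j))))"
    using assms by (intro member_le_sum[where f = "\<lambda>j. \<Sum>i<n. length (enc_rat (B $$ (i, j)))"]) auto
  also note sum_lengths
  finally show ?thesis .
qed

lemma target_length:
  assumes "i < n"
  shows "length (enc_rat (t $ i)) \<le> len"
proof -
  have "Suc (length (enc_rat (t $ i))) \<le> (\<Sum>i<n. Suc (length (enc_rat (t $ i))))"
    using assms by (intro member_le_sum[where f = "\<lambda>i. Suc (length (enc_rat (t $ i)))"]) auto
  then show ?thesis using input_dims by (simp add: length_eq length_enc_vec)
qed

text \<open>A rational takes at least 3 letters, a vector 5, a basis 6. The resulting 14 is large
  enough to compare the polynomial exponents that occur.\<close>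

lemma len_ge: "14 \<le> len"
proof -
  have vec: "5 \<le> length (enc_vec v)" if "dim_vec v = n" for v
  proof -
    have "(\<Sum>i<n. 4 :: nat) \<le> (\<Sum>i<n. Suc (length (enc_rat (v $ i))))"
    proof (rule sum_mono)
      show "4 \<le> Suc (length (enc_rat (v $ i)))" for i using enc_rat_length_ge[of "v $ i"] by linarith
    qed
    then show ?thesis using n_pos that by (simp add: length_enc_vec)
  qed
  have "length (enc_vec (col B 0)) \<le> (\<Sum>j<m. length (enc_vec (col B j)))"
    using input_dims by (intro member_le_sum) auto
  then have "6 \<le> length (enc_basis B)" using vec[of "col B 0"] input_dims by (simp add: length_enc_basis)
  then show ?thesis using vec[of t] input_dims enc_rat_length_ge[of d] by (simp add: length_eq)
qed

lemma n_le: "n \<le> len"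
  using dim_le_length_enc_vec[of t] input_dims by (simp add: length_eq)

lemma nm_le: "real n \<le> 2 ^ len" "real m \<le> 2 ^ len"
proof -
  have "real len \<le> 2 ^ len" using of_nat_less_two_power[of len, where 'a = real] by simp
  then show "real n \<le> 2 ^ len" "real m \<le> 2 ^ len" using n_le m_le_n by linarith+
qed

lemma of_rat_abs_le: "\<bar>q\<bar> \<le> 2 ^ k \<Longrightarrow> \<bar>real_of_rat q\<bar> \<le> 2 ^ k"
  by (metis abs_of_rat of_rat_less_eq of_rat_numeral_eq of_rat_power)

lemma of_rat_bound: "length (enc_rat q) \<le> len \<Longrightarrow> \<bar>real_of_rat q\<bar> \<le> 2 ^ len"
proof -
  assume le: "length (enc_rat q) \<le> len"
  obtain a b where "quotient_of q = (a, b)" by fastforce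
  then have "\<bar>q\<bar> \<le> 2 ^ length (enc_rat q)" by (rule quotient_of_bounds)
  also have "\<dots> \<le> 2 ^ len" using le by (intro power_increasing) auto
  finally show ?thesis by (rule of_rat_abs_le)
qed

lemma d_length: "length (enc_rat d) \<le> len"
  by (simp add: length_eq)

lemma d_bounds: "0 < real_of_rat d" "real_of_rat d \<le> 2 ^ len" "1 \<le> real_of_rat d * 2 ^ len"
proof -
  show pos: "0 < real_of_rat d" using input_dims by simp
  show "real_of_rat d \<le> 2 ^ len" using of_rat_bound[OF d_length] by linarith
  obtain a b where "quotient_of d = (a, b)" by fastforce
  then have "1 \<le> d * 2 ^ length (enc_rat d)" using input_dims by (intro quotient_of_bounds) auto
  then have "real_of_rat 1 \<le> real_of_rat (d * 2 ^ length (enc_rat d))" by (simp only: of_rat_less_eq)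
  then have "1 \<le> real_of_rat d * 2 ^ length (enc_rat d)" by (simp add: of_rat_mult of_rat_power)
  also have "\<dots> \<le> real_of_rat d * 2 ^ len"
    using pos d_length by (intro mult_left_mono power_increasing) auto
  finally show "1 \<le> real_of_rat d * 2 ^ len" .
qed

lemma D_bounds: "0 < D" "D \<le> 2 ^ len" "real D \<le> 2 ^ len"
proof -
  show "0 < D" by (simp add: D_def denom_pos)
  have "D \<le> (\<Prod>j<m. \<Prod>i<n. 2 ^ length (enc_rat (B $$ (i, j))))"
    unfolding D_def by (intro prod_mono) (auto intro: denom_le prod_mono)
  also have "\<dots> = 2 ^ (\<Sum>j<m. \<Sum>i<n. length (enc_rat (B $$ (i, j))))"
    by (simp add: power_sum)
  also have "\<dots> \<le> 2 ^ len" by (rule power_increasing[OF sum_lengths]) simp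
  finally show "D \<le> 2 ^ len" .
  then show "real D \<le> 2 ^ len" by (metis of_nat_le_iff of_nat_numeral of_nat_power)
qed

lemma D_mult_Ints:
  assumes "i < n" "j < m"
  shows "real D * real_of_rat (B $$ (i, j)) \<in> \<int>"
proof -
  have "denom (B $$ (i, j)) dvd (\<Prod>i<n. denom (B $$ (i, j)))"
    using assms by (intro dvd_prodI) auto
  also have "\<dots> dvd D"
    unfolding D_def using assms by (intro dvd_prodI[where f = "\<lambda>j. \<Prod>i<n. denom (B $$ (i, j))"]) auto
  finally obtain c where "D = denom (B $$ (i, j)) * c" by blast
  then have "real D * real_of_rat (B $$ (i, j)) =
      real c * (real (denom (B $$ (i, j))) * real_of_rat (B $$ (i, j)))" by simp
  also have "\<dots> \<in> \<int>" by (intro Ints_mult denom_mult_Ints) simp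
  finally show ?thesis .
qed

lemma e_bounds: "len ^ 3 \<le> e i" "i < m \<Longrightarrow> e i \<le> len ^ 3 + len"
proof -
  show "len ^ 3 \<le> e i" by (simp add: e_def)
  show "e i \<le> len ^ 3 + len" if "i < m"
  proof -
    have "length (enc_nat (denom (B $$ (i, i)))) \<le> length (enc_rat (B $$ (i, i)))"
      by (simp add: enc_rat_eq denom_def)
    also have "\<dots> \<le> len" using entry_length that m_le_n by simp
    finally show ?thesis by (simp add: e_def)
  qed
qed

lemma abs_nudge_at: "\<bar>nudge_at i\<bar> = 1 / 2 ^ e i"
  by (simp add: nudge_at_def sgn_at_def)

lemma nudge_at_le: "\<bar>nudge_at i\<bar> \<le> 1 / 2 ^ len ^ 3"
  unfolding abs_nudge_at by (intro divide_left_mono power_increasing e_bounds) auto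

lemma l_powers: "14 * len \<le> len ^ 2" "14 * len ^ 2 \<le> len ^ 3" "14 * len ^ 3 \<le> len ^ 4" "14 * len ^ 4 \<le> len ^ 5"
proof -
  have *: "14 * len ^ k \<le> len ^ (k + 1)" for k using len_ge by simp
  show "14 * len \<le> len ^ 2" using len_ge by (simp add: power2_eq_square)
  show "14 * len ^ 2 \<le> len ^ 3" using *[of 2] by simp
  show "14 * len ^ 3 \<le> len ^ 4" using *[of 3] by simp
  show "14 * len ^ 4 \<le> len ^ 5" using *[of 4] by simp
qed

text \<open>The three comparisons behind the exponents 3 and 5: the nudges against
  \<open>gram_const\<close>, the extra columns against \<open>top_const\<close>, and the power of 2
  in the 2-adic argument against \<open>D ^ m\<close>.\<close>

lemma exponent_bounds:
  "6 * len ^ 2 + 5 * len + 2 \<le> len ^ 3" "len ^ 4 + 4 * len ^ 2 + 7 * len + 2 < len ^ 5" "len ^ 2 < len ^ 3"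
  using l_powers len_ge by linarith+

lemma gram_const_le: "gram_const \<le> 2 ^ (6 * len ^ 2 + 2 * len)"
proof -
  have m: "m \<le> len" using m_le_n n_le by simp
  have "real (D ^ 2) \<le> 2 ^ (2 * len)"
    using power_mono[OF D_bounds(3), of 2] by (simp add: power_mult[symmetric] mult.commute)
  then have "real (D ^ 2) ^ m \<le> (2 ^ (2 * len)) ^ m" by (rule power_mono) simp
  also have "\<dots> \<le> (2 ^ (2 * len)) ^ len" by (rule power_increasing[OF m]) simp
  finally have 1: "real (D ^ 2) ^ m \<le> 2 ^ (2 * len ^ 2)"
    by (simp only: power_mult[symmetric] power2_eq_square mult.assoc)
  have "real m * (real n * (2 ^ len)\<^sup>2) \<le> 2 ^ len * (2 ^ len * (2 ^ len)\<^sup>2)"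
    using nm_le by (intro mult_mono) auto
  also have "\<dots> = 2 ^ (4 * len)"
    unfolding power_add[symmetric] power_mult[symmetric] by (rule arg_cong[of _ _ "(^) 2"]) simp
  finally have "(real m * (real n * (2 ^ len)\<^sup>2)) ^ m \<le> (2 ^ (4 * len)) ^ m" by (rule power_mono) simp
  also have "\<dots> \<le> (2 ^ (4 * len)) ^ len" by (rule power_increasing[OF m]) simp
  finally have 2: "(real m * (real n * (2 ^ len)\<^sup>2)) ^ m \<le> 2 ^ (4 * len ^ 2)"
    by (simp only: power_mult[symmetric] power2_eq_square mult.assoc)
  have 3: "real n * 2 ^ len \<le> 2 ^ len * 2 ^ len" using nm_le by (intro mult_right_mono) auto
  have "gram_const \<le> 2 ^ (2 * len ^ 2) * 2 ^ (4 * len ^ 2) * (2 ^ len * 2 ^ len)"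
    unfolding gram_const_def by (intro mult_mono 1 2 3) auto
  also have "\<dots> = 2 ^ (6 * len ^ 2 + 2 * len)" 
    unfolding power_add[symmetric] by (rule arg_cong[of _ _ "(^) 2"]) simp
  finally show ?thesis .
qed

lemma top_const_le: "top_const \<le> 2 ^ (len ^ 4 + 4 * len ^ 2 + len)"
proof -
  have m: "m \<le> len" using m_le_n n_le by simp
  have "real (D * 2 ^ (len ^ 3 + len)) \<le> 2 ^ len * 2 ^ (len ^ 3 + len)"
    using D_bounds(3) by (simp add: mult_right_mono)
  also have "\<dots> = 2 ^ (len ^ 3 + 2 * len)"
    unfolding power_add[symmetric] by (rule arg_cong[of _ _ "(^) 2"]) simp
  finally have "real (D * 2 ^ (len ^ 3 + len)) ^ m \<le> (2 ^ (len ^ 3 + 2 * len)) ^ m" by (rule power_mono) simp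
  also have "\<dots> \<le> (2 ^ (len ^ 3 + 2 * len)) ^ len" by (rule power_increasing[OF m]) simp
  also have "\<dots> = 2 ^ ((len ^ 3 + 2 * len) * len)" by (simp only: power_mult)
  also have "(len ^ 3 + 2 * len) * len = len ^ 4 + 2 * len ^ 2"
    using power_Suc2[of len 3] by (simp add: algebra_simps power2_eq_square)
  finally have 1: "real (D * 2 ^ (len ^ 3 + len)) ^ m \<le> 2 ^ (len ^ 4 + 2 * len ^ 2)" .
  have "real m * 2 ^ (len + 1) \<le> 2 ^ len * 2 ^ (len + 1)" using nm_le by (intro mult_right_mono) auto
  also have "\<dots> = 2 ^ (2 * len + 1)"
    unfolding power_add[symmetric] by (rule arg_cong[of _ _ "(^) 2"]) simp
  finally have "(real m * 2 ^ (len + 1)) ^ m \<le> (2 ^ (2 * len + 1)) ^ m" by (rule power_mono) simp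
  also have "\<dots> \<le> (2 ^ (2 * len + 1)) ^ len" by (rule power_increasing[OF m one_le_power]) simp
  also have "\<dots> = 2 ^ ((2 * len + 1) * len)" by (simp only: power_mult)
  also have "(2 * len + 1) * len = 2 * len ^ 2 + len" by (simp add: algebra_simps power2_eq_square)
  finally have 2: "(real m * 2 ^ (len + 1)) ^ m \<le> 2 ^ (2 * len ^ 2 + len)" .
  have "top_const \<le> 2 ^ (len ^ 4 + 2 * len ^ 2) * 2 ^ (2 * len ^ 2 + len)"
    unfolding top_const_def by (intro mult_mono 1 2) auto
  also have "\<dots> = 2 ^ (len ^ 4 + 4 * len ^ 2 + len)"
    unfolding power_add[symmetric] by (rule arg_cong[of _ _ "(^) 2"]) simp
  finally show ?thesis .
qed

lemma consts_nonneg: "0 \<le> gram_const" "0 \<le> top_const"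
  by (simp_all add: gram_const_def top_const_def)

sublocale nudged_basis n m "real_mat B" M nudge_at "2 ^ len" "1 / 2 ^ len ^ 3" gram_const top_const "2 ^ len ^ 5"
proof
  show "M \<in> carrier_mat n n" by (simp add: M_def)
  show "\<bar>real_mat B $$ (i, j)\<bar> \<le> 2 ^ len" if "i < n" "j < m" for i j
    using that of_rat_bound[OF entry_length] by simp
  show "\<bar>x $ j\<bar> \<le> gram_const * Y"
    if "x \<in> carrier_vec m" "\<And>i. i < n \<Longrightarrow> \<bar>(real_mat B *\<^sub>v x) $ i\<bar> \<le> Y" "j < m" for x Y j
    using gram_bound[OF input_dims(7,4) D_bounds(1) n_pos _ _ _ that(1) that(2) that(3), of "2 ^ len"]
      D_mult_Ints of_rat_bound[OF entry_length]
    by (simp add: gram_const_def mult.assoc)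
  \<comment> \<open>The perturbed top block: nonsingular by the 2-adic argument, so that Cramer's
    rule yields \<open>top_const\<close>.\<close>
  define A where "A = mat m m (\<lambda>(i, j). M $$ (i, j))"
  have A: "A \<in> carrier_mat m m" by (simp add: A_def)
  have A_entry: "A $$ (i, j) = real_of_rat (B $$ (i, j)) + (if i = j then nudge_at i else 0)"
    if "i < m" "j < m" for i j
    using that m_le_n by (simp add: A_def M_def)
  have Dm: "D ^ m < 2 ^ len ^ 3"
  proof -
    have "D ^ m \<le> (2 ^ len) ^ m" using D_bounds by (intro power_mono) auto
    also have "\<dots> \<le> (2 ^ len) ^ len" using m_le_n n_le by (intro power_increasing) auto
    also have "\<dots> = 2 ^ (len ^ 2)" by (simp only: power2_eq_square power_mult)
    also have "\<dots> < 2 ^ len ^ 3" by (intro power_strict_increasing exponent_bounds) simp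
    finally show ?thesis .
  qed
  have detA: "det A \<noteq> 0"
  proof (rule det_perturbed_diagonal_neq_0[OF A D_bounds(1) Dm])
    show "A $$ (i, j) = real_of_rat (B $$ (i, j)) + (if i = j then real_of_int (sgn_at i) / 2 ^ e i else 0)"
      if "i < m" "j < m" for i j using A_entry[OF that] by (simp add: nudge_at_def)
    show "real D * real_of_rat (B $$ (i, j)) \<in> \<int>" if "i < m" "j < m" for i j
      using D_mult_Ints that m_le_n by simp
  qed (auto simp: sgn_at_def e_bounds)
  \<comment> \<open>Every nudge exponent \<open>e i\<close> is at most \<open>len ^ 3 + len\<close>,
    so one power of 2 clears all of them.\<close>
  have A_int: "real (D * 2 ^ (len ^ 3 + len)) * A $$ (i, j) \<in> \<int>" if "i < m" "j < m" for i j
  proof -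
    have "real (D * 2 ^ (len ^ 3 + len)) * A $$ (i, j) =
        2 ^ (len ^ 3 + len) * (real D * real_of_rat (B $$ (i, j))) +
        (if i = j then real_of_int (int D * sgn_at i) * (2 ^ (len ^ 3 + len) / 2 ^ e i) else 0)"
      unfolding A_entry[OF that] by (simp add: nudge_at_def algebra_simps)
    also have "(2::real) ^ (len ^ 3 + len) / 2 ^ e i = 2 ^ (len ^ 3 + len - e i)"
      using e_bounds(2)[OF that(1)] by (simp add: power_diff)
    also have "2 ^ (len ^ 3 + len) * (real D * real_of_rat (B $$ (i, j))) +
        (if i = j then real_of_int (int D * sgn_at i) * 2 ^ (len ^ 3 + len - e i) else 0) \<in> \<int>"
      using D_mult_Ints[of i j] that m_le_n by (auto intro!: Ints_add Ints_mult Ints_power)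
    finally show ?thesis .
  qed
  have A_le: "\<bar>A $$ (i, j)\<bar> \<le> 2 ^ (len + 1)" if "i < m" "j < m" for i j
  proof -
    have "\<bar>real_of_rat (B $$ (i, j))\<bar> \<le> 2 ^ len" using of_rat_bound[OF entry_length] that m_le_n by simp
    moreover have "\<bar>nudge_at i\<bar> \<le> 2 ^ len"
      unfolding abs_nudge_at by (rule order_trans[of _ 1]) (auto simp: divide_le_eq)
    then have "\<bar>if i = j then nudge_at i else 0\<bar> \<le> 2 ^ len" by (cases "i = j") auto
    ultimately show ?thesis
      unfolding A_entry[OF that] power_add power_one_right by linarith
  qed
  show "\<bar>x $ j\<bar> \<le> top_const * Y"
    if x: "x \<in> carrier_vec m" and le: "\<And>i. i < m \<Longrightarrow> \<bar>(real_mat B *\<^sub>v x) $ i + nudge_at i * x $ i\<bar> \<le> Y"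
      and j: "j < m" for x Y j
  proof -
    have "(A *\<^sub>v x) $ i = (real_mat B *\<^sub>v x) $ i + nudge_at i * x $ i" if i: "i < m" for i
    proof -
      have "(A *\<^sub>v x) $ i = (\<Sum>j<m. real_of_rat (B $$ (i, j)) * x $ j + (if j = i then nudge_at i * x $ j else 0))"
        unfolding index_mult_mat_vec_sum[OF A x i]
        by (rule sum.cong) (use i in \<open>auto simp: A_entry algebra_simps\<close>)
      also have "\<dots> = (\<Sum>j<m. real_of_rat (B $$ (i, j)) * x $ j) + nudge_at i * x $ i"
        using i by (simp add: sum.distrib)
      also have "(\<Sum>j<m. real_of_rat (B $$ (i, j)) * x $ j) = (real_mat B *\<^sub>v x) $ i"
        using i m_le_n by (subst index_mult_mat_vec_sum[OF input_dims(7) x]) auto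
      finally show ?thesis .
    qed
    then have Ax: "\<bar>(A *\<^sub>v x) $ i\<bar> \<le> Y" if "i < m" for i using le[OF that] that by simp
    have pos: "0 < D * 2 ^ (len ^ 3 + len)" using D_bounds(1) by simp
    have one: "(1::real) \<le> 2 ^ (len + 1)" by (rule one_le_power) simp
    show ?thesis
      unfolding top_const_def by (rule cramer_bound[OF A detA pos A_int one A_le x Ax j])
  qed
qed (use input_dims m_le_n nudge_at_le consts_nonneg in \<open>auto simp: M_def\<close>)

section \<open>YES and NO instances are preserved\<close>

lemma lift_basis_eq:
  assumes "s \<in> carrier_vec n"
  shows "real_mat (lift_basis (len ^ 3) (len ^ 5) B s d) = lift_mat M (real_vec s) (real_of_rat d)"
  using input_dims assms
  by (intro eq_matI)
    (auto simp: real_mat_def lift_basis_def lift_mat_def Let_def M_def real_vec_def of_rat_nudge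
      nudge_at_def sgn_at_def e_def of_rat_power)

lemma lin_indep_lift:
  assumes "s \<in> carrier_vec n"
  shows "lin_indep_cols (real_mat (lift_basis (len ^ 3) (len ^ 5) B s d))"
  unfolding lift_basis_eq[OF assms] lin_indep_cols_def carrier_matD[OF lift_mat_carrier[OF M]]
  by (intro ballI impI) (rule lift_mat_kernel[OF M d_bounds(1) M_inj])

lemma ldp_instance:
  "ldp_instance (n + 1) (lift_basis (len ^ 3) (len ^ 5) B (0\<^sub>v n) d) (lift_basis (len ^ 3) (len ^ 5) B t d) 16"
proof -
  have "lift_basis (len ^ 3) (len ^ 5) B s d \<in> carrier_mat (n + 1) (n + 1)" for s
    by (simp add: lift_basis_def Let_def input_dims)
  then show ?thesis
    unfolding ldp_instance_def by (intro conjI lin_indep_lift input_dims zero_carrier_vec) simp_all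
qed

lemma program_output:
  "program_fun reduction (enc_cvp B t d) =
    enc_ldp (lift_basis (len ^ 3) (len ^ 5) B (0\<^sub>v n) d) (lift_basis (len ^ 3) (len ^ 5) B t d) 16"
  using reduction_correct[of t B "enc_cvp B t d" d] input_dims m_le_n by (simp add: len_def)

abbreviation "distortion \<equiv> lat_distortion (n + 1)
  (lat (real_mat (lift_basis (len ^ 3) (len ^ 5) B (0\<^sub>v n) d)))
  (lat (real_mat (lift_basis (len ^ 3) (len ^ 5) B t d)))"

lemma distortion_eq: "distortion = lat_distortion (n + 1)
  (lat (lift_mat M (0\<^sub>v n) (real_of_rat d))) (lat (lift_mat M (real_vec t) (real_of_rat d)))"
proof -
  have "real_vec (0\<^sub>v n) = 0\<^sub>v n" by (auto simp: real_vec_def)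
  then show ?thesis using lift_basis_eq[of t] lift_basis_eq[of "0\<^sub>v n"] input_dims by simp
qed

lemma real_t: "real_vec t \<in> carrier_vec n" "i < n \<Longrightarrow> \<bar>real_vec t $ i\<bar> \<le> 2 ^ len"
  using input_dims of_rat_bound[OF target_length] by (auto simp: real_vec_def)

lemma yes_instance:
  assumes "lat_dist (real_vec t) (lat (real_mat B)) \<le> of_rat d"
  shows "distortion \<le> 16"
proof -
  let ?d = "real_of_rat d"
  \<comment> \<open>The slack factor 2 provides a lattice vector although the infimum is not known
    to be attained.\<close>
  have "lat_dist (real_vec t) (lat (real_mat B)) < 2 * ?d" using assms d_bounds by linarith
  moreover have "{vnorm (real_vec t - v) | v. v \<in> lat (real_mat B)} \<noteq> {}"
    using zero_carrier_vec[of "dim_col (real_mat B)"] unfolding lat_def by blast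
  ultimately have "\<exists>r\<in>{vnorm (real_vec t - v) | v. v \<in> lat (real_mat B)}. r < 2 * ?d"
    unfolding lat_dist_def by (intro cInf_lessD)
  then obtain v where "v \<in> lat (real_mat B)" and v: "vnorm (real_vec t - v) < 2 * ?d" by blast
  then obtain x where x: "x \<in> carrier_vec m" "v = real_mat B *\<^sub>v map_vec real_of_int x"
    unfolding lat_def carrier_matD[OF input_dims(7)] by blast
  have "real m * (1 / 2 ^ len ^ 3 * (gram_const * (2 ^ len + 2 * ?d))) \<le> ?d"
  proof -
    have "real m * (gram_const * (2 ^ len + 2 * ?d)) \<le>
        2 ^ len * (2 ^ (6 * len ^ 2 + 2 * len) * (2 ^ (len + 2)))"
    proof (intro mult_mono nm_le gram_const_le)
      have "(2::real) ^ (len + 2) = 4 * 2 ^ len" by (simp add: power_add)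
      then show "2 ^ len + 2 * ?d \<le> 2 ^ (len + 2)" using d_bounds(1,2) by linarith
    qed (use d_bounds(1) consts_nonneg in simp_all)
    also have "\<dots> = 2 ^ (6 * len ^ 2 + 4 * len + 2)"
      unfolding power_add[symmetric] by (rule arg_cong[of _ _ "(^) 2"]) simp
    \<comment> \<open>A positive rational with this encoding satisfies
      \<open>1 \<le> d * 2 ^ len\<close>, which brings in the factor \<open>d\<close> of the goal at
      the cost of \<open>2 ^ len\<close>.\<close>
    also have "\<dots> \<le> 2 ^ (6 * len ^ 2 + 4 * len + 2) * (?d * 2 ^ len)"
      using d_bounds(3) by (intro mult_le_cancel_left1[THEN iffD2]) simp
    also have "\<dots> = ?d * (2 ^ (6 * len ^ 2 + 4 * len + 2) * 2 ^ len)" by simp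
    also have "(2::real) ^ (6 * len ^ 2 + 4 * len + 2) * 2 ^ len = 2 ^ (6 * len ^ 2 + 5 * len + 2)"
      unfolding power_add[symmetric] by (rule arg_cong[of _ _ "(^) 2"]) simp
    also have "?d * 2 ^ (6 * len ^ 2 + 5 * len + 2) \<le> ?d * 2 ^ len ^ 3"
      using d_bounds(1) by (intro mult_left_mono power_increasing exponent_bounds) simp_all
    finally have "real m * (gram_const * (2 ^ len + 2 * ?d)) / 2 ^ len ^ 3 \<le> ?d"
      by (simp add: pos_divide_le_eq)
    then show ?thesis by simp
  qed
  from nudged_close[OF real_t d_bounds(1) x(1) _ this] v x(2)
  obtain y :: "int vec" where "y \<in> carrier_vec n"
    "vnorm (real_vec t - M *\<^sub>v map_vec real_of_int y) \<le> 3 * ?d" by (metis less_imp_le)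
  from lat_distortion_lift_le[OF M real_t(1) this(1) d_bounds(1) this(2)]
  show ?thesis unfolding distortion_eq by simp
qed

lemma no_instance:
  assumes g: "1 \<le> g"
    and far: "\<And>k::int. k \<noteq> 0 \<Longrightarrow>
      lat_dist (real_of_int k \<cdot>\<^sub>v real_vec t) (lat (real_mat B)) > g * of_rat d"
    and short: "of_rat d < 1 / g * lambda1 (lat (real_mat B))"
  shows "g / 2 \<le> distortion"
proof -
  let ?d = "real_of_rat d" and ?B = "real_mat B" and ?t = "real_vec t"
  define R where "R = g * ?d"
  have R: "0 < R" "R < lambda1 (lat ?B)"
  proof -
    show "0 < R" unfolding R_def using g d_bounds(1) by (intro mult_pos_pos) auto
    have "g * ?d < g * (1 / g * lambda1 (lat ?B))"
      using short g by (intro mult_strict_left_mono) auto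
    then show "R < lambda1 (lat ?B)" using g by (simp add: R_def)
  qed
  have in_lat: "?B *\<^sub>v map_vec real_of_int x \<in> lat ?B" if "x \<in> carrier_vec m" for x
    using that input_dims by (auto simp: lat_def)
  have lambda: "lambda1 (lat ?B) \<le> vnorm (?B *\<^sub>v map_vec real_of_int x)"
    if x: "x \<in> carrier_vec m" "x \<noteq> 0\<^sub>v m" for x
    unfolding lambda1_def
  proof (rule cInf_lower)
    have "map_vec real_of_int x \<noteq> 0\<^sub>v m"
    proof
      assume 0: "map_vec real_of_int x = 0\<^sub>v m"
      have "x $ i = 0" if "i < m" for i using arg_cong[OF 0, of "\<lambda>v. v $ i"] that x by simp
      then have "x = 0\<^sub>v m" by (intro eq_vecI) (use x in auto)
      then show False using x by simp
    qed
    moreover have "map_vec real_of_int x \<in> carrier_vec m" using x by simp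
    ultimately have "?B *\<^sub>v map_vec real_of_int x \<noteq> 0\<^sub>v n"
      using input_dims(4) carrier_matD[OF input_dims(7)] unfolding lin_indep_cols_def by metis
    then show "vnorm (?B *\<^sub>v map_vec real_of_int x) \<in> {vnorm v | v. v \<in> lat ?B \<and> v \<noteq> 0\<^sub>v (dim_vec v)}"
      using in_lat[OF x(1)] carrier_matD[OF input_dims(7)] by auto
  qed (auto intro!: bdd_belowI[of _ 0])
  \<comment> \<open>The two promises of a NO instance join here: \<open>lambda1\<close> covers
    \<open>k = 0\<close>, the distances of the multiples of the target cover the rest.\<close>
  have far': "R < vnorm (real_of_int k \<cdot>\<^sub>v ?t + ?B *\<^sub>v map_vec real_of_int x)"
    if x: "x \<in> carrier_vec m" and kx: "k \<noteq> 0 \<or> x \<noteq> 0\<^sub>v m" for k :: int and x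
  proof (cases "k = 0")
    case True
    then have "real_of_int k \<cdot>\<^sub>v ?t + ?B *\<^sub>v map_vec real_of_int x = ?B *\<^sub>v map_vec real_of_int x"
      using real_t input_dims by auto
    then show ?thesis using lambda[OF x] kx True R by simp
  next
    case False
    have "lat_dist (real_of_int k \<cdot>\<^sub>v ?t) (lat ?B) \<le>
        vnorm (real_of_int k \<cdot>\<^sub>v ?t - ?B *\<^sub>v map_vec real_of_int (- x))"
      unfolding lat_dist_def
    proof (rule cInf_lower)
      show "vnorm (real_of_int k \<cdot>\<^sub>v ?t - ?B *\<^sub>v map_vec real_of_int (- x)) \<in>
          {vnorm (real_of_int k \<cdot>\<^sub>v ?t - v) | v. v \<in> lat ?B}"
        using in_lat[of "- x"] x by auto
    qed (auto intro!: bdd_belowI[of _ 0])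
    moreover have "real_of_int k \<cdot>\<^sub>v ?t - ?B *\<^sub>v map_vec real_of_int (- x) =
        real_of_int k \<cdot>\<^sub>v ?t + ?B *\<^sub>v map_vec real_of_int x"
    proof (rule eq_vecI)
      fix i assume "i < dim_vec (real_of_int k \<cdot>\<^sub>v ?t + ?B *\<^sub>v map_vec real_of_int x)"
      then have i: "i < n" using input_dims by simp
      have "(?B *\<^sub>v map_vec real_of_int (- x)) $ i = - (?B *\<^sub>v map_vec real_of_int x) $ i"
        using x by (subst (1 2) index_mult_mat_vec_sum[OF input_dims(7) _ i]) (auto simp: sum_negf)
      then show "(real_of_int k \<cdot>\<^sub>v ?t - ?B *\<^sub>v map_vec real_of_int (- x)) $ i =
          (real_of_int k \<cdot>\<^sub>v ?t + ?B *\<^sub>v map_vec real_of_int x) $ i"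
        using i input_dims real_t by simp
    qed (use input_dims in simp)
    ultimately show ?thesis using far[OF False] by (simp add: R_def)
  qed
  \<comment> \<open>The gap factor \<open>g\<close> is an arbitrary real number, so its product with
    \<open>d\<close> has no bound in terms of the input length by itself. It is below
    \<open>lambda1\<close>, hence below the length of the first basis vector.\<close>
  have R_le: "R \<le> 2 ^ (2 * len)"
  proof -
    have e: "unit_vec m 0 \<in> carrier_vec m" "unit_vec m 0 \<noteq> (0\<^sub>v m :: int vec)"
      using input_dims by auto
    have "R \<le> vnorm (?B *\<^sub>v map_vec real_of_int (unit_vec m 0))" using lambda[OF e] R by simp
    also have "?B *\<^sub>v map_vec real_of_int (unit_vec m 0) = col ?B 0"
    proof -
      have "map_vec real_of_int (unit_vec m 0) = unit_vec m 0"
        by (intro eq_vecI) (auto simp: unit_vec_def)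
      then show ?thesis using input_dims by (auto intro!: eq_vecI)
    qed
    also have "vnorm (col ?B 0) \<le> (\<Sum>i<n. \<bar>col ?B 0 $ i\<bar>)"
      using vnorm_le_sum[of "col ?B 0"] input_dims by simp
    also have "\<dots> \<le> (\<Sum>i<n. 2 ^ len)"
    proof (rule sum_mono)
      fix i assume "i \<in> {..<n}"
      then show "\<bar>col ?B 0 $ i\<bar> \<le> 2 ^ len" using B_le[of i 0] input_dims by simp
    qed
    also have "\<dots> \<le> 2 ^ len * 2 ^ len" using nm_le by (simp add: mult_right_mono)
    finally show ?thesis unfolding power_add[symmetric] mult_2 .
  qed
  have quot: "1 + 2 ^ len / ?d \<le> 2 ^ (2 * len + 1)"
  proof -
    have "1 / ?d \<le> 2 ^ len"
      using d_bounds(1,3) by (subst pos_divide_le_eq) (simp_all only: mult.commute)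
    then have "2 ^ len * (1 / ?d) \<le> 2 ^ len * 2 ^ len" by (intro mult_left_mono) auto
    moreover have "(1::real) \<le> 2 ^ len * 2 ^ len" by (simp only: power_add[symmetric] one_le_power one_le_numeral)
    moreover have "(2::real) ^ (2 * len + 1) = 2 * (2 ^ len * 2 ^ len)"
      by (simp only: power_add power_one_right mult_2[of len] mult_ac)
    moreover have "2 ^ len / ?d = 2 ^ len * (1 / ?d)" by simp
    ultimately show ?thesis by linarith
  qed
  have small: "2 * real m * (1 / 2 ^ len ^ 3) * gram_const * (1 + 2 ^ len / ?d) \<le> 1"
  proof -
    have "2 ^ 1 * (real m * (gram_const * (1 + 2 ^ len / ?d))) \<le>
        2 ^ 1 * (2 ^ len * (2 ^ (6 * len ^ 2 + 2 * len) * 2 ^ (2 * len + 1)))"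
      using consts_nonneg d_bounds(1)
      by (intro mult_left_mono mult_mono nm_le gram_const_le quot) simp_all
    also have "\<dots> = 2 ^ (6 * len ^ 2 + 5 * len + 2)" 
      unfolding power_add[symmetric] by (rule arg_cong[of _ _ "(^) 2"]) simp
    also have "\<dots> \<le> 2 ^ len ^ 3" by (intro power_increasing exponent_bounds) simp
    finally have "2 ^ 1 * (real m * (gram_const * (1 + 2 ^ len / ?d))) / 2 ^ len ^ 3 \<le> 1"
      by (simp add: pos_divide_le_eq)
    then show ?thesis by (simp add: mult.assoc)
  qed
  have large: "R / 2 * (1 + 2 ^ len / ?d) * (1 + real m * 2 ^ len * top_const) < 2 ^ len ^ 5"
  proof -
    have "real m * 2 ^ len * top_const \<le> 2 ^ len * 2 ^ len * 2 ^ (len ^ 4 + 4 * len ^ 2 + len)"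
      using consts_nonneg by (intro mult_mono nm_le top_const_le) simp_all
    also have "\<dots> = 2 ^ (len ^ 4 + 4 * len ^ 2 + 3 * len)"
      unfolding power_add[symmetric] by (rule arg_cong[of _ _ "(^) 2"]) simp
    finally have "1 + real m * 2 ^ len * top_const \<le> 1 + 2 ^ (len ^ 4 + 4 * len ^ 2 + 3 * len)" by simp
    also have "\<dots> \<le> 2 ^ 1 * 2 ^ (len ^ 4 + 4 * len ^ 2 + 3 * len)"
    proof -
      have "(1::real) \<le> 2 ^ (len ^ 4 + 4 * len ^ 2 + 3 * len)" by (rule one_le_power) simp
      then show ?thesis unfolding power_one_right by linarith
    qed
    finally have 1: "1 + real m * 2 ^ len * top_const \<le> 2 ^ 1 * 2 ^ (len ^ 4 + 4 * len ^ 2 + 3 * len)" .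
    have "R / 2 * (1 + 2 ^ len / ?d) * (1 + real m * 2 ^ len * top_const) \<le>
        2 ^ (2 * len) * 2 ^ (2 * len + 1) * (2 ^ 1 * 2 ^ (len ^ 4 + 4 * len ^ 2 + 3 * len))"
      using R(1) R_le d_bounds(1) consts_nonneg by (intro mult_mono quot 1) simp_all
    also have "\<dots> = 2 ^ (len ^ 4 + 4 * len ^ 2 + 7 * len + 2)"
      unfolding power_add[symmetric] by (rule arg_cong[of _ _ "(^) 2"]) simp
    also have "\<dots> < 2 ^ len ^ 5" by (intro power_strict_increasing exponent_bounds) simp
    finally show ?thesis .
  qed
  have "R / 2 \<le> vnorm (lift_mat M ?t ?d *\<^sub>v map_vec real_of_int z)"
    if z: "z \<in> carrier_vec (n + 1)" "z \<noteq> 0\<^sub>v (n + 1)" for z :: "int vec"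
  proof -
    let ?z = "map_vec real_of_int z"
    define y where "y = vec n (($) z)"
    have y: "y \<in> carrier_vec n" by (simp add: y_def)
    have zc: "?z \<in> carrier_vec (n + 1)" using z by simp
    have "y = 0\<^sub>v n \<Longrightarrow> z $ n = 0 \<Longrightarrow> False"
    proof -
      assume 0: "y = 0\<^sub>v n" "z $ n = 0"
      have "z $ i = 0" if "i < n + 1" for i
        using that 0(2) arg_cong[OF 0(1), of "\<lambda>v. v $ i"] by (cases "i = n") (auto simp: y_def)
      then have "z = 0\<^sub>v (n + 1)" by (intro eq_vecI) (use z in auto)
      then show False using z by simp
    qed
    then have nz: "z $ n \<noteq> 0 \<or> y \<noteq> 0\<^sub>v n" by blast
    show ?thesis
    \<comment> \<open>If the last coordinate reaches \<open>R / 2\<close>, it alone makes the vector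
      long; otherwise the multiple of the target is small enough for \<open>nudged_far\<close>,
      applied to the upper part.\<close>
    proof (cases "\<bar>real_of_int (z $ n)\<bar> * ?d < R / 2")
      case True
      have "R / 2 \<le> vnorm (real_of_int (z $ n) \<cdot>\<^sub>v ?t + M *\<^sub>v map_vec real_of_int y)"
        by (rule nudged_far[OF real_t d_bounds(1) R(1) far' small large y nz True])
      also have "\<dots> \<le> vnorm (lift_mat M ?t ?d *\<^sub>v ?z)"
      proof (rule vnorm_le_append)
        fix i assume "i < dim_vec (real_of_int (z $ n) \<cdot>\<^sub>v ?t + M *\<^sub>v map_vec real_of_int y)"
        then have i: "i < n" using M by simp
        have yc: "map_vec real_of_int y \<in> carrier_vec n" using y by simp
        have "(M *\<^sub>v map_vec real_of_int y) $ i = (\<Sum>j<n. M $$ (i, j) * ?z $ j)"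
          unfolding index_mult_mat_vec_sum[OF M yc i] using z by (intro sum.cong) (auto simp: y_def)
        then show "(real_of_int (z $ n) \<cdot>\<^sub>v ?t + M *\<^sub>v map_vec real_of_int y) $ i =
            (lift_mat M ?t ?d *\<^sub>v ?z) $ i"
          unfolding lift_mat_mult[OF M zc] using i M real_t z by simp
      qed (use M in \<open>simp add: lift_mat_def Let_def\<close>)
      finally show ?thesis .
    next
      case False
      have "\<bar>(lift_mat M ?t ?d *\<^sub>v ?z) $ n\<bar> \<le> vnorm (lift_mat M ?t ?d *\<^sub>v ?z)"
        by (rule abs_le_vnorm) (use M in \<open>simp add: lift_mat_def Let_def\<close>)
      moreover have "(lift_mat M ?t ?d *\<^sub>v ?z) $ n = ?d * real_of_int (z $ n)"
        unfolding lift_mat_mult[OF M zc] using z by simp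
      ultimately show ?thesis using False d_bounds by (simp add: abs_mult mult.commute)
    qed
  qed
  from lat_distortion_lift_ge[OF M real_t(1) d_bounds(1) M_inj this] R
  have "R / 2 / ?d \<le> distortion" unfolding distortion_eq by simp
  then show ?thesis using d_bounds by (simp add: R_def)
qed

end

theorem theorem4p3:
  shows "\<exists>C::real. \<forall>\<gamma> :: nat \<Rightarrow> real. (\<forall>n. 1 \<le> \<gamma> n) \<longrightarrow>
           (\<exists>\<gamma>' :: nat \<Rightarrow> real.
              (\<forall>n. 1 \<le> \<gamma>' n \<and> \<gamma>' n \<le> C * \<gamma> (n + 1)) \<and>
              polytime_reduces (gap_cvp \<gamma>' (\<lambda>n. 1 / \<gamma>' n)) (gap_ldp \<gamma>))"
proof (intro exI[of _ 40] allI impI)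
  fix \<gamma> :: "nat \<Rightarrow> real" assume \<gamma>: "\<forall>n. 1 \<le> \<gamma> n"
  \<comment> \<open>A NO instance has distortion at least \<open>\<gamma>' n / 2\<close>, which must
    exceed \<open>16 * \<gamma> (n + 1)\<close>; every factor above 32 achieves this. The argument
    is \<open>n + 1\<close>, the dimension of the lattices produced.\<close>
  define \<gamma>' where "\<gamma>' n = 40 * \<gamma> (n + 1)" for n
  have ge: "1 \<le> \<gamma>' n" for n using \<gamma>[rule_format, of "n + 1"] by (simp add: \<gamma>'_def)
  have "polytime_reduces (gap_cvp \<gamma>' (\<lambda>n. 1 / \<gamma>' n)) (gap_ldp \<gamma>)"
    unfolding polytime_reduces_def
  proof (intro exI[of _ "program_fun reduction"] conjI ballI)
    show "polytime (program_fun reduction)"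
      by (rule polytime_program_fun[OF _ heads_below_reduction]) simp
  next
    fix w assume "w \<in> fst (gap_cvp \<gamma>' (\<lambda>n. 1 / \<gamma>' n))"
    then obtain n B t d where w: "w = enc_cvp B t d" and inst: "cvp_instance n B t d"
      and le: "lat_dist (real_vec t) (lat (real_mat B)) \<le> of_rat d"
      unfolding gap_cvp_def by (simp only: fst_conv mem_Collect_eq) blast
    interpret cvp_input n B t d by standard (rule inst)
    have "distortion \<le> of_rat 16" using yes_instance[OF le] by simp
    with ldp_instance show "program_fun reduction w \<in> fst (gap_ldp \<gamma>)"
      unfolding w program_output gap_ldp_def fst_conv mem_Collect_eq by blast
  next
    fix w assume "w \<in> snd (gap_cvp \<gamma>' (\<lambda>n. 1 / \<gamma>' n))"
    then obtain n B t d where w: "w = enc_cvp B t d" and inst: "cvp_instance n B t d"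
      and far: "\<And>k::int. k \<noteq> 0 \<Longrightarrow>
        lat_dist (real_of_int k \<cdot>\<^sub>v real_vec t) (lat (real_mat B)) > \<gamma>' n * of_rat d"
      and short: "of_rat d < 1 / \<gamma>' n * lambda1 (lat (real_mat B))"
      unfolding gap_cvp_def by (simp only: snd_conv mem_Collect_eq) blast
    interpret cvp_input n B t d by standard (rule inst)
    have "\<gamma>' n / 2 \<le> distortion" by (rule no_instance[OF ge far short])
    moreover have "\<gamma> (n + 1) * 16 < \<gamma>' n / 2"
      using \<gamma>[rule_format, of "n + 1"] by (simp add: \<gamma>'_def)
    ultimately have "distortion > \<gamma> (n + 1) * of_rat 16" by simp
    with ldp_instance show "program_fun reduction w \<in> snd (gap_ldp \<gamma>)"
      unfolding w program_output gap_ldp_def snd_conv mem_Collect_eq by blast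
  qed
  then show "\<exists>\<gamma>'. (\<forall>n. 1 \<le> \<gamma>' n \<and> \<gamma>' n \<le> 40 * \<gamma> (n + 1)) \<and>
      polytime_reduces (gap_cvp \<gamma>' (\<lambda>n. 1 / \<gamma>' n)) (gap_ldp \<gamma>)"
    using ge by (intro exI[of _ \<gamma>']) (simp add: \<gamma>'_def)
qed

end
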